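(* Let $C$ be a cocommutative $k$-coalgebra and let $(\Psi,\psi)$ be a $C$-measuring of Lie-Rinehart algebras from $(R,\mathfrak L,\nabla)$ to $(R',\mathfrak L',\nabla')$. Then, for each $x\in C$, the family of maps (for $n\ge0$) $$\wedge^n_R\mathfrak L\longrightarrow\wedge^n_{R'}\mathfrak L',\qquad Z_1\wedge\dots\wedge Z_n\mapsto x_{(1)}(Z_1)\wedge\dots\wedge x_{(n)}(Z_n)$$ gives a morphism of complexes from $(\wedge^\bullet_R\mathfrak L,\partial)$ to $(\wedge^\bullet_{R'}\mathfrak L',\partial')$. Accordingly, for each $x\in C$, there are induced morphisms $\underline\Psi_\bullet^{Lie}(x):H_\bullet(R,\mathfrak L,\nabla)\longrightarrow H_\bullet(R',\mathfrak L',\nabla')$ on homology groups.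
   Context: $k$ is a field containing $\mathbb Q$; $Vect_k(V,W)$ denotes $k$-linear maps; Sweedler notation with summation suppressed. Lie-Rinehart algebra $(R,\mathfrak L)$ over $k$: $R$ is a commutative $k$-algebra, $\mathfrak L$ is an $R$-module and a $k$-Lie algebra with a Lie algebra morphism $\mathfrak L\to Der_k(R)$, $Z\mapsto(r\mapsto Z(r))$, such that $(rZ)(r')=r(Z(r'))$ and $[Z,rZ']=r[Z,Z']+Z(r)Z'$. A (right) connection is a linear map $\nabla:\mathfrak L\otimes R\to R$, written $Z\otimes r\mapsto\nabla_Z(r)$, with $\nabla_Z(r'r)=r'\nabla_Z(r)-Z(r')r=\nabla_{r'Z}(r)$; it is flat if $[\nabla_Z,\nabla_{Z'}]=\nabla_{[Z',Z]}$. Throughout, a Lie-Rinehart algebra $(R,\mathfrak L,\nabla)$ is equipped with a flat connection $\nabla$ and $\mathfrak L$ is projective as an $R$-module. A $C$-measuring $(\Psi,\psi)$ from $(R,\mathfrak L,\nabla)$ to $(R',\mathfrak L',\nabla')$, for $C$ a cocommutative $k$-coalgebra with counit $\epsilon_C$, is a pair of linear maps $\Psi:C\to Vect_k(\mathfrak L,\mathfrak L')$, $\psi:C\to Vect_k(R,R')$ (write $x(Z)=\Psi(x)(Z)$, $x(r)=\psi(x)(r)$) such that (a) $x(rr')=x_{(1)}(r)x_{(2)}(r')$ and $x(1_R)=\epsilon_C(x)1_{R'}$; (b) $x([Z_1,Z_2])=[x_{(1)}(Z_1),x_{(2)}(Z_2)]$; (c) $x(Z(r))=(x_{(1)}(Z))(x_{(2)}(r))$,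 $x(\nabla_Z(r))=\nabla'_{x_{(1)}(Z)}(x_{(2)}(r))$, $x(rZ)=x_{(1)}(r)x_{(2)}(Z)$. $H_\bullet(R,\mathfrak L,\nabla)$ is the homology of the exterior algebra $\wedge_R^\bullet\mathfrak L$ with differential $$\partial(Z_1\wedge\dots\wedge Z_n)=\sum_{i=1}^n(-1)^{i+1}\nabla_{Z_i}(1_R)Z_1\wedge\dots\wedge\hat Z_i\wedge\dots\wedge Z_n+\sum_{i<j}(-1)^{i+j}[Z_i,Z_j]\wedge Z_1\wedge\dots\wedge\hat Z_i\wedge\dots\wedge\hat Z_j\wedge\dots\wedge Z_n.$$ In degree $0$ the map $R\to R'$ in the claim is $\psi(x)$. *)

theory Defs
  imports
    "HOL-Library.Poly_Mapping"
    "HOL-Algebra.Module"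
    "HOL-Algebra.AbelCoset"
    "HOL-Algebra.Algebraic_Closure_Type"
begin

text \<open>
  The given algebraic structures (the field \<open>k\<close>, the algebras, modules and coalgebras) live on
  types; the constructed spaces (tensor and exterior powers, homology) are quotients and are
  modules over \<open>k\<close> in the sense of HOL-Algebra.  Commutative rings have the sort
  \<open>{comm_ring,comm_monoid_mult}\<close> instead of \<open>comm_ring_1\<close>, because the latter excludes the zero
  ring; for the same reason modules and spans of HOL.Modules cannot be used over them.
\<close>

section \<open>Modules over a commutative ring\<close>

definition is_module :: "('a::{comm_ring,comm_monoid_mult} \<Rightarrow> 'm::ab_group_add \<Rightarrow> 'm) \<Rightarrow> bool" where
  "is_module s \<longleftrightarrow>
     (\<forall>a u v. s a (u + v) = s a u + s a v) \<and>
     (\<forall>a b u. s (a + b) u = s a u + s b u) \<and>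
     (\<forall>a b u. s (a * b) u = s a (s b u)) \<and>
     (\<forall>u. s 1 u = u)"

text \<open>The free module with basis \<open>'b\<close> is \<open>'b \<Rightarrow>\<^sub>0 'a\<close>; the basis vector of \<open>b\<close> is
  \<open>Poly_Mapping.single b 1\<close>.\<close>

definition free_scale ::
    "'a::{comm_ring,comm_monoid_mult} \<Rightarrow> ('b \<Rightarrow>\<^sub>0 'a) \<Rightarrow> ('b \<Rightarrow>\<^sub>0 'a)" where
  "free_scale a p = Poly_Mapping.map (\<lambda>r. a * r) p"

definition lin_ext ::
    "('a::zero \<Rightarrow> 'm \<Rightarrow> 'm::ab_group_add) \<Rightarrow> ('b \<Rightarrow> 'm) \<Rightarrow> ('b \<Rightarrow>\<^sub>0 'a) \<Rightarrow> 'm" where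
  "lin_ext s f p = (\<Sum>b\<in>Poly_Mapping.keys p. s (Poly_Mapping.lookup p b) (f b))"

inductive_set submodule_gen ::
    "('b \<Rightarrow>\<^sub>0 'a::{comm_ring,comm_monoid_mult}) set \<Rightarrow> ('b \<Rightarrow>\<^sub>0 'a) set" for S where
  base: "p \<in> S \<Longrightarrow> p \<in> submodule_gen S"
| zero: "0 \<in> submodule_gen S"
| add: "p \<in> submodule_gen S \<Longrightarrow> q \<in> submodule_gen S \<Longrightarrow> p + q \<in> submodule_gen S"
| scale: "p \<in> submodule_gen S \<Longrightarrow> free_scale a p \<in> submodule_gen S"

text \<open>Projectivity: the canonical surjection from the free module on the underlying set of the
  module splits, i.e. the module is a direct summand of a free module.\<close>

definition projective_module ::
    "('a::{comm_ring,comm_monoid_mult} \<Rightarrow> 'm::ab_group_add \<Rightarrow> 'm) \<Rightarrow> bool" where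
  "projective_module s \<longleftrightarrow> is_module s \<and>
     (\<exists>\<sigma> :: 'm \<Rightarrow> ('m \<Rightarrow>\<^sub>0 'a).
        (\<forall>u v. \<sigma> (u + v) = \<sigma> u + \<sigma> v) \<and>
        (\<forall>a u. \<sigma> (s a u) = free_scale a (\<sigma> u)) \<and>
        (\<forall>u. lin_ext s (\<lambda>v. v) (\<sigma> u) = u))"

section \<open>Quotients and linear maps over \<open>k\<close>\<close>

text \<open>The fields \<open>mult\<close> and \<open>one\<close> of the record \<open>module\<close> play no role for a module.\<close>

definition quot_module :: "('k, 'm) module \<Rightarrow> 'm set \<Rightarrow> ('k, 'm set) module" where
  "quot_module M N =
     \<lparr>carrier = a_rcosets\<^bsub>M\<^esub> N, monoid.mult = undefined, one = undefined,
      ring.zero = N, add = set_add M,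
      module.smult = (\<lambda>c A. \<Union>a\<in>A. N +>\<^bsub>M\<^esub> (c \<odot>\<^bsub>M\<^esub> a))\<rparr>"

text \<open>Linear maps are made extensional (\<open>undefined\<close> outside the carrier), so that equality of
  functions is equality of linear maps.\<close>

definition linear_maps :: "('k, 'm) module \<Rightarrow> ('k, 'n) module \<Rightarrow> ('m \<Rightarrow> 'n) set" where
  "linear_maps M N =
     {f \<in> carrier M \<rightarrow>\<^sub>E carrier N.
        (\<forall>u\<in>carrier M. \<forall>v\<in>carrier M. f (u \<oplus>\<^bsub>M\<^esub> v) = f u \<oplus>\<^bsub>N\<^esub> f v) \<and>
        (\<forall>c. \<forall>u\<in>carrier M. f (c \<odot>\<^bsub>M\<^esub> u) = c \<odot>\<^bsub>N\<^esub> f u)}"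

section \<open>Tensor and exterior powers\<close>

text \<open>The free module on the \<open>n\<close>-tuples of elements of \<open>'m\<close>, with scalars restricted along \<open>\<eta>\<close>.\<close>

definition free_tuples ::
    "('k \<Rightarrow> 'a::{comm_ring,comm_monoid_mult}) \<Rightarrow> nat \<Rightarrow> ('k, 'm list \<Rightarrow>\<^sub>0 'a) module" where
  "free_tuples \<eta> n =
     \<lparr>carrier = {p. \<forall>us\<in>Poly_Mapping.keys p. length us = n},
      monoid.mult = undefined, one = undefined, ring.zero = 0, add = (+),
      module.smult = (\<lambda>c. free_scale (\<eta> c))\<rparr>"

definition multilinear_rels ::
    "('a::{comm_ring,comm_monoid_mult} \<Rightarrow> 'm::ab_group_add \<Rightarrow> 'm) \<Rightarrow> nat \<Rightarrow> ('m list \<Rightarrow>\<^sub>0 'a) set" where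
  "multilinear_rels s n =
     {Poly_Mapping.single (us @ (u + v) # ws) 1 - Poly_Mapping.single (us @ u # ws) 1
        - Poly_Mapping.single (us @ v # ws) 1 | us u v ws. length us + 1 + length ws = n} \<union>
     {Poly_Mapping.single (us @ s a u # ws) 1 - Poly_Mapping.single (us @ u # ws) a
        | us a u ws. length us + 1 + length ws = n}"

definition alternating_rels ::
    "nat \<Rightarrow> ('m list \<Rightarrow>\<^sub>0 'a::{comm_ring,comm_monoid_mult}) set" where
  "alternating_rels n =
     {Poly_Mapping.single (us @ u # vs @ u # ws) 1
        | us u vs ws. length us + 1 + length vs + 1 + length ws = n}"

section \<open>Cocommutative coalgebras\<close>

text \<open>The comultiplication takes values in the tensor square, whose elements are cosets of formal
  linear combinations of pairs.\<close>

record (overloaded) ('k, 'c) coalg =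
  cscale :: "'k \<Rightarrow> 'c \<Rightarrow> 'c"
  comult :: "'c \<Rightarrow> ('c list \<Rightarrow>\<^sub>0 'k) set"
  counit :: "'c \<Rightarrow> 'k"

definition tensor_rels ::
    "('k::field_char_0, 'c::ab_group_add) coalg \<Rightarrow> nat \<Rightarrow> ('c list \<Rightarrow>\<^sub>0 'k) set" where
  "tensor_rels C n = submodule_gen (multilinear_rels (cscale C) n)"

definition tensor_power ::
    "('k::field_char_0, 'c::ab_group_add) coalg \<Rightarrow> nat \<Rightarrow> ('k, ('c list \<Rightarrow>\<^sub>0 'k) set) module" where
  "tensor_power C n = quot_module (free_tuples (\<lambda>c. c) n) (tensor_rels C n)"

definition tensor_class ::
    "('k::field_char_0, 'c::ab_group_add) coalg \<Rightarrow> nat \<Rightarrow> ('c list \<Rightarrow>\<^sub>0 'k) \<Rightarrow> ('c list \<Rightarrow>\<^sub>0 'k) set" where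
  "tensor_class C n p = tensor_rels C n +>\<^bsub>free_tuples (\<lambda>c::'k. c) n\<^esub> p"

text \<open>A chosen expression of the comultiplication as a formal linear combination of pairs, and the
  comultiplication applied to the tensor factor at position \<open>i\<close> (counted from \<open>0\<close>).\<close>

definition comult_rep ::
    "('k::field_char_0, 'c::ab_group_add) coalg \<Rightarrow> 'c \<Rightarrow> ('c list \<Rightarrow>\<^sub>0 'k)" where
  "comult_rep C x = (SOME t. t \<in> comult C x)"

definition comult_at ::
    "('k::field_char_0, 'c::ab_group_add) coalg \<Rightarrow> nat \<Rightarrow> ('c list \<Rightarrow>\<^sub>0 'k) \<Rightarrow> ('c list \<Rightarrow>\<^sub>0 'k)" where
  "comult_at C i = lin_ext free_scale (\<lambda>xs.
     lin_ext free_scale (\<lambda>ys. Poly_Mapping.single (take i xs @ ys @ drop (Suc i) xs) 1)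
       (comult_rep C (xs ! i)))"

text \<open>Sweedler notation: \<open>sweedler C n x\<close> is a formal linear combination of \<open>n\<close>-tuples
  representing \<open>x\<^sub>(\<^sub>1\<^sub>) \<otimes> \<dots> \<otimes> x\<^sub>(\<^sub>n\<^sub>)\<close>, and a Sweedler sum \<open>f(x\<^sub>(\<^sub>1\<^sub>), \<dots>, x\<^sub>(\<^sub>n\<^sub>))\<close> with
  values in a space with scalar action \<open>s\<close> is \<open>lin_ext s f (sweedler C n x)\<close>.  It does not depend
  on the chosen representative if \<open>f\<close> is multilinear, as it is wherever this is used.\<close>

fun sweedler ::
    "('k::field_char_0, 'c::ab_group_add) coalg \<Rightarrow> nat \<Rightarrow> 'c \<Rightarrow> ('c list \<Rightarrow>\<^sub>0 'k)" where
  "sweedler C 0 x = Poly_Mapping.single [] (counit C x)"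
| "sweedler C (Suc 0) x = Poly_Mapping.single [x] 1"
| "sweedler C (Suc (Suc n)) x = comult_at C 0 (sweedler C (Suc n) x)"

definition cocommutative_coalgebra ::
    "('k::field_char_0, 'c::ab_group_add) coalg \<Rightarrow> bool" where
  "cocommutative_coalgebra C \<longleftrightarrow>
     vector_space (cscale C) \<and>
     \<comment> \<open>linearity of the comultiplication and of the counit\<close>
     (\<forall>x. comult C x \<in> carrier (tensor_power C 2)) \<and>
     (\<forall>x y. comult C (x + y) = comult C x \<oplus>\<^bsub>tensor_power C 2\<^esub> comult C y) \<and>
     (\<forall>c x. comult C (cscale C c x) = c \<odot>\<^bsub>tensor_power C 2\<^esub> comult C x) \<and>
     Vector_Spaces.linear (cscale C) (*) (counit C) \<and>
     \<comment> \<open>coassociativity\<close>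
     (\<forall>x. tensor_class C 3 (comult_at C 0 (comult_rep C x)) =
          tensor_class C 3 (comult_at C 1 (comult_rep C x))) \<and>
     \<comment> \<open>counit laws\<close>
     (\<forall>x. lin_ext (cscale C) (\<lambda>xs. cscale C (counit C (xs ! 0)) (xs ! 1)) (comult_rep C x) = x) \<and>
     (\<forall>x. lin_ext (cscale C) (\<lambda>xs. cscale C (counit C (xs ! 1)) (xs ! 0)) (comult_rep C x) = x) \<and>
     \<comment> \<open>cocommutativity\<close>
     (\<forall>x. tensor_class C 2
            (lin_ext free_scale (\<lambda>xs. Poly_Mapping.single [xs ! 1, xs ! 0] 1) (comult_rep C x)) =
          comult C x)"

section \<open>Lie-Rinehart algebras\<close>

text \<open>\<open>rscale\<close> is the action of \<open>k\<close> on \<open>R\<close>, \<open>lscale\<close> the action of \<open>R\<close> on \<open>L\<close>,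
  \<open>anchor A Z r\<close> is \<open>Z(r)\<close> and \<open>conn A Z r\<close> is \<open>\<nabla>\<^sub>Z(r)\<close>.\<close>

record ('k, 'r, 'l) lie_rinehart =
  rscale :: "'k \<Rightarrow> 'r \<Rightarrow> 'r"
  lscale :: "'r \<Rightarrow> 'l \<Rightarrow> 'l"
  bracket :: "'l \<Rightarrow> 'l \<Rightarrow> 'l"
  anchor :: "'l \<Rightarrow> 'r \<Rightarrow> 'r"
  conn :: "'l \<Rightarrow> 'r \<Rightarrow> 'r"

text \<open>The structure map \<open>k \<rightarrow> R\<close>, and the action of \<open>k\<close> on \<open>L\<close> through it.\<close>

definition unit_map ::
    "('k, 'r::{comm_ring,comm_monoid_mult}, 'l) lie_rinehart \<Rightarrow> 'k \<Rightarrow> 'r" where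
  "unit_map A c = rscale A c 1"

definition lkscale ::
    "('k, 'r::{comm_ring,comm_monoid_mult}, 'l) lie_rinehart \<Rightarrow> 'k \<Rightarrow> 'l \<Rightarrow> 'l" where
  "lkscale A c Z = lscale A (unit_map A c) Z"

definition comm_algebra ::
    "('k::field \<Rightarrow> 'r::{comm_ring,comm_monoid_mult} \<Rightarrow> 'r) \<Rightarrow> bool" where
  "comm_algebra s \<longleftrightarrow> vector_space s \<and> (\<forall>c r r'. s c (r * r') = s c r * r')"

definition lie_algebra ::
    "('k::field \<Rightarrow> 'l::ab_group_add \<Rightarrow> 'l) \<Rightarrow> ('l \<Rightarrow> 'l \<Rightarrow> 'l) \<Rightarrow> bool" where
  "lie_algebra s br \<longleftrightarrow> vector_space s \<and>
     (\<forall>U. Vector_Spaces.linear s s (\<lambda>V. br U V)) \<and>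
     (\<forall>V. Vector_Spaces.linear s s (\<lambda>U. br U V)) \<and>
     (\<forall>U. br U U = 0) \<and>
     (\<forall>U V W. br U (br V W) + br V (br W U) + br W (br U V) = 0)"

definition derivation ::
    "('k::field \<Rightarrow> 'r::{comm_ring,comm_monoid_mult} \<Rightarrow> 'r) \<Rightarrow> ('r \<Rightarrow> 'r) \<Rightarrow> bool" where
  "derivation s D \<longleftrightarrow> Vector_Spaces.linear s s D \<and> (\<forall>r r'. D (r * r') = D r * r' + r * D r')"

definition lie_rinehart_algebra ::
    "('k::field_char_0, 'r::{comm_ring,comm_monoid_mult}, 'l::ab_group_add) lie_rinehart \<Rightarrow> bool" where
  "lie_rinehart_algebra A \<longleftrightarrow>
     comm_algebra (rscale A) \<and> is_module (lscale A) \<and> lie_algebra (lkscale A) (bracket A) \<and>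
     \<comment> \<open>the Lie algebra morphism to the derivations\<close>
     (\<forall>Z. derivation (rscale A) (anchor A Z)) \<and>
     (\<forall>r. Vector_Spaces.linear (lkscale A) (rscale A) (\<lambda>Z. anchor A Z r)) \<and>
     (\<forall>Z Z' r. anchor A (bracket A Z Z') r =
        anchor A Z (anchor A Z' r) - anchor A Z' (anchor A Z r)) \<and>
     \<comment> \<open>the Lie-Rinehart compatibilities\<close>
     (\<forall>r Z r'. anchor A (lscale A r Z) r' = r * anchor A Z r') \<and>
     (\<forall>Z r Z'. bracket A Z (lscale A r Z') =
        lscale A r (bracket A Z Z') + lscale A (anchor A Z r) Z')"

definition flat_connection ::
    "('k::field_char_0, 'r::{comm_ring,comm_monoid_mult}, 'l::ab_group_add) lie_rinehart \<Rightarrow> bool" where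
  "flat_connection A \<longleftrightarrow>
     (\<forall>Z. Vector_Spaces.linear (rscale A) (rscale A) (\<lambda>r. conn A Z r)) \<and>
     (\<forall>r. Vector_Spaces.linear (lkscale A) (rscale A) (\<lambda>Z. conn A Z r)) \<and>
     (\<forall>Z r r'. conn A Z (r' * r) = r' * conn A Z r - anchor A Z r' * r) \<and>
     (\<forall>Z r r'. conn A (lscale A r' Z) r = r' * conn A Z r - anchor A Z r' * r) \<and>
     (\<forall>Z Z' r. conn A Z (conn A Z' r) - conn A Z' (conn A Z r) = conn A (bracket A Z' Z) r)"

definition projective_flat_lie_rinehart ::
    "('k::field_char_0, 'r::{comm_ring,comm_monoid_mult}, 'l::ab_group_add) lie_rinehart \<Rightarrow> bool" where
  "projective_flat_lie_rinehart A \<longleftrightarrow>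
     lie_rinehart_algebra A \<and> flat_connection A \<and> projective_module (lscale A)"

section \<open>Complexes and homology\<close>

text \<open>The differential in degree \<open>n\<close> goes to degree \<open>n - 1\<close>; in degree \<open>0\<close>, where truncated
  subtraction gives \<open>0 - 1 = 0\<close>, it is required to vanish.\<close>

definition chain_complex ::
    "(nat \<Rightarrow> ('k::field_char_0, 'm) module) \<Rightarrow> (nat \<Rightarrow> 'm \<Rightarrow> 'm) \<Rightarrow> bool" where
  "chain_complex M d \<longleftrightarrow>
     (\<forall>n. Module.module (ring_of_type_algebra :: 'k ring) (M n)) \<and>
     (\<forall>n. d n \<in> linear_maps (M n) (M (n - 1))) \<and>
     (\<forall>u\<in>carrier (M 0). d 0 u = \<zero>\<^bsub>M 0\<^esub>) \<and>
     (\<forall>n. \<forall>u\<in>carrier (M (Suc n)). d n (d (Suc n) u) = \<zero>\<^bsub>M (n - 1)\<^esub>)"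

definition chain_map ::
    "(nat \<Rightarrow> ('k::field_char_0, 'm) module) \<Rightarrow> (nat \<Rightarrow> 'm \<Rightarrow> 'm) \<Rightarrow>
     (nat \<Rightarrow> ('k, 'n) module) \<Rightarrow> (nat \<Rightarrow> 'n \<Rightarrow> 'n) \<Rightarrow> (nat \<Rightarrow> 'm \<Rightarrow> 'n) \<Rightarrow> bool" where
  "chain_map M d M' d' F \<longleftrightarrow>
     chain_complex M d \<and> chain_complex M' d' \<and>
     (\<forall>n. F n \<in> linear_maps (M n) (M' n)) \<and>
     (\<forall>n. \<forall>u\<in>carrier (M n). F (n - 1) (d n u) = d' n (F n u))"

definition cycles :: "(nat \<Rightarrow> ('k, 'm) module) \<Rightarrow> (nat \<Rightarrow> 'm \<Rightarrow> 'm) \<Rightarrow> nat \<Rightarrow> 'm set" where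
  "cycles M d n = {u \<in> carrier (M n). d n u = \<zero>\<^bsub>M (n - 1)\<^esub>}"

definition boundaries :: "(nat \<Rightarrow> ('k, 'm) module) \<Rightarrow> (nat \<Rightarrow> 'm \<Rightarrow> 'm) \<Rightarrow> nat \<Rightarrow> 'm set" where
  "boundaries M d n = d (Suc n) ` carrier (M (Suc n))"

definition homology ::
    "(nat \<Rightarrow> ('k, 'm) module) \<Rightarrow> (nat \<Rightarrow> 'm \<Rightarrow> 'm) \<Rightarrow> nat \<Rightarrow> ('k, 'm set) module" where
  "homology M d n = quot_module ((M n)\<lparr>carrier := cycles M d n\<rparr>) (boundaries M d n)"

definition homology_class ::
    "(nat \<Rightarrow> ('k, 'm) module) \<Rightarrow> (nat \<Rightarrow> 'm \<Rightarrow> 'm) \<Rightarrow> nat \<Rightarrow> 'm \<Rightarrow> 'm set" where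
  "homology_class M d n z = boundaries M d n +>\<^bsub>M n\<^esub> z"

section \<open>The exterior algebra complex of a Lie-Rinehart algebra\<close>

definition ext_rels ::
    "('k, 'r::{comm_ring,comm_monoid_mult}, 'l::ab_group_add) lie_rinehart \<Rightarrow> nat \<Rightarrow>
     ('l list \<Rightarrow>\<^sub>0 'r) set" where
  "ext_rels A n = submodule_gen (multilinear_rels (lscale A) n \<union> alternating_rels n)"

text \<open>The exterior power over \<open>R\<close>, regarded as a module over \<open>k\<close> since the differential is only
  \<open>k\<close>-linear.\<close>

definition ext_power ::
    "('k, 'r::{comm_ring,comm_monoid_mult}, 'l::ab_group_add) lie_rinehart \<Rightarrow> nat \<Rightarrow>
     ('k, ('l list \<Rightarrow>\<^sub>0 'r) set) module" where
  "ext_power A n = quot_module (free_tuples (unit_map A) n) (ext_rels A n)"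

text \<open>\<open>ext_class A n\<close> sends \<open>Poly_Mapping.single [Z\<^sub>1, \<dots>, Z\<^sub>n] r\<close> to \<open>r Z\<^sub>1 \<and> \<dots> \<and> Z\<^sub>n\<close>.\<close>

definition ext_class ::
    "('k, 'r::{comm_ring,comm_monoid_mult}, 'l::ab_group_add) lie_rinehart \<Rightarrow> nat \<Rightarrow>
     ('l list \<Rightarrow>\<^sub>0 'r) \<Rightarrow> ('l list \<Rightarrow>\<^sub>0 'r) set" where
  "ext_class A n p = ext_rels A n +>\<^bsub>free_tuples (unit_map A) n\<^esub> p"

definition wedge ::
    "('k, 'r::{comm_ring,comm_monoid_mult}, 'l::ab_group_add) lie_rinehart \<Rightarrow> 'l list \<Rightarrow>
     ('l list \<Rightarrow>\<^sub>0 'r) set" where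
  "wedge A Zs = ext_class A (length Zs) (Poly_Mapping.single Zs 1)"

text \<open>Indices start at \<open>0\<close> here, so \<open>(-1)\<^sup>i\<^sup>+\<^sup>1\<close> becomes \<open>(-1)\<^sup>i\<close>, while \<open>(-1)\<^sup>i\<^sup>+\<^sup>j\<close> is unchanged;
  \<open>nths Zs (- I)\<close> omits the entries with index in \<open>I\<close>.\<close>

definition boundary_formula ::
    "('k, 'r::{comm_ring,comm_monoid_mult}, 'l::ab_group_add) lie_rinehart \<Rightarrow> 'l list \<Rightarrow>
     ('l list \<Rightarrow>\<^sub>0 'r)" where
  "boundary_formula A Zs =
     (\<Sum>i<length Zs. Poly_Mapping.single (nths Zs (- {i})) ((- 1) ^ i * conn A (Zs ! i) 1)) +
     (\<Sum>(i, j) \<in> {(i, j). i < j \<and> j < length Zs}.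
        Poly_Mapping.single (bracket A (Zs ! i) (Zs ! j) # nths Zs (- {i, j})) ((- 1) ^ (i + j)))"

definition is_lr_differential ::
    "('k, 'r::{comm_ring,comm_monoid_mult}, 'l::ab_group_add) lie_rinehart \<Rightarrow>
     (nat \<Rightarrow> ('l list \<Rightarrow>\<^sub>0 'r) set \<Rightarrow> ('l list \<Rightarrow>\<^sub>0 'r) set) \<Rightarrow> bool" where
  "is_lr_differential A d \<longleftrightarrow>
     (\<forall>n. d n \<in> linear_maps (ext_power A n) (ext_power A (n - 1))) \<and>
     (\<forall>u\<in>carrier (ext_power A 0). d 0 u = \<zero>\<^bsub>ext_power A 0\<^esub>) \<and>
     (\<forall>Zs. Zs \<noteq> [] \<longrightarrow>
        d (length Zs) (wedge A Zs) = ext_class A (length Zs - 1) (boundary_formula A Zs))"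

definition lr_differential ::
    "('k, 'r::{comm_ring,comm_monoid_mult}, 'l::ab_group_add) lie_rinehart \<Rightarrow>
     nat \<Rightarrow> ('l list \<Rightarrow>\<^sub>0 'r) set \<Rightarrow> ('l list \<Rightarrow>\<^sub>0 'r) set" where
  "lr_differential A = (THE d. is_lr_differential A d)"

section \<open>Measurings\<close>

definition lr_measuring ::
    "('k::field_char_0, 'c::ab_group_add) coalg \<Rightarrow>
     ('k, 'r::{comm_ring,comm_monoid_mult}, 'l::ab_group_add) lie_rinehart \<Rightarrow>
     ('k, 's::{comm_ring,comm_monoid_mult}, 'm::ab_group_add) lie_rinehart \<Rightarrow>
     ('c \<Rightarrow> 'l \<Rightarrow> 'm) \<Rightarrow> ('c \<Rightarrow> 'r \<Rightarrow> 's) \<Rightarrow> bool" where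
  "lr_measuring C A A' \<Psi> \<psi> \<longleftrightarrow>
     (\<forall>x. Vector_Spaces.linear (lkscale A) (lkscale A') (\<Psi> x)) \<and>
     (\<forall>Z. Vector_Spaces.linear (cscale C) (lkscale A') (\<lambda>x. \<Psi> x Z)) \<and>
     (\<forall>x. Vector_Spaces.linear (rscale A) (rscale A') (\<psi> x)) \<and>
     (\<forall>r. Vector_Spaces.linear (cscale C) (rscale A') (\<lambda>x. \<psi> x r)) \<and>
     (\<forall>x r r'. \<psi> x (r * r') =
        lin_ext (rscale A') (\<lambda>xs. \<psi> (xs ! 0) r * \<psi> (xs ! 1) r') (sweedler C 2 x)) \<and>
     (\<forall>x. \<psi> x 1 = rscale A' (counit C x) 1) \<and>
     (\<forall>x Z Z'. \<Psi> x (bracket A Z Z') =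
        lin_ext (lkscale A') (\<lambda>xs. bracket A' (\<Psi> (xs ! 0) Z) (\<Psi> (xs ! 1) Z')) (sweedler C 2 x)) \<and>
     (\<forall>x Z r. \<psi> x (anchor A Z r) =
        lin_ext (rscale A') (\<lambda>xs. anchor A' (\<Psi> (xs ! 0) Z) (\<psi> (xs ! 1) r)) (sweedler C 2 x)) \<and>
     (\<forall>x Z r. \<psi> x (conn A Z r) =
        lin_ext (rscale A') (\<lambda>xs. conn A' (\<Psi> (xs ! 0) Z) (\<psi> (xs ! 1) r)) (sweedler C 2 x)) \<and>
     (\<forall>x r Z. \<Psi> x (lscale A r Z) =
        lin_ext (lkscale A') (\<lambda>xs. lscale A' (\<psi> (xs ! 0) r) (\<Psi> (xs ! 1) Z)) (sweedler C 2 x))"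

text \<open>The family of maps \<open>Z\<^sub>1 \<and> \<dots> \<and> Z\<^sub>n \<mapsto> x\<^sub>(\<^sub>1\<^sub>)(Z\<^sub>1) \<and> \<dots> \<and> x\<^sub>(\<^sub>n\<^sub>)(Z\<^sub>n)\<close>.  Degree \<open>0\<close> is stated
  separately: the exterior power is then a copy of \<open>R\<close>, which is not spanned over \<open>k\<close> by the empty
  wedge product.\<close>

definition is_wedge_family ::
    "('k::field_char_0, 'c::ab_group_add) coalg \<Rightarrow>
     ('k, 'r::{comm_ring,comm_monoid_mult}, 'l::ab_group_add) lie_rinehart \<Rightarrow>
     ('k, 's::{comm_ring,comm_monoid_mult}, 'm::ab_group_add) lie_rinehart \<Rightarrow>
     ('c \<Rightarrow> 'l \<Rightarrow> 'm) \<Rightarrow> ('c \<Rightarrow> 'r \<Rightarrow> 's) \<Rightarrow> 'c \<Rightarrow>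
     (nat \<Rightarrow> ('l list \<Rightarrow>\<^sub>0 'r) set \<Rightarrow> ('m list \<Rightarrow>\<^sub>0 's) set) \<Rightarrow> bool" where
  "is_wedge_family C A A' \<Psi> \<psi> x F \<longleftrightarrow>
     (\<forall>n. F n \<in> linear_maps (ext_power A n) (ext_power A' n)) \<and>
     (\<forall>r. F 0 (ext_class A 0 (Poly_Mapping.single [] r)) =
        ext_class A' 0 (Poly_Mapping.single [] (\<psi> x r))) \<and>
     (\<forall>Zs. Zs \<noteq> [] \<longrightarrow>
        F (length Zs) (wedge A Zs) =
          ext_class A' (length Zs)
            (lin_ext (\<lambda>c. free_scale (unit_map A' c))
               (\<lambda>xs. Poly_Mapping.single (map2 \<Psi> xs Zs) 1) (sweedler C (length Zs) x)))"

end

theory Submission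
  imports Defs
begin

text \<open>
  Everything is computed on formal linear combinations of words, modulo the relations of the
  exterior algebra.  The differential is governed by \<open>\<partial>(Z \<and> w) = \<theta>\<^sub>Z w - Z \<and> \<partial>w\<close>, where \<open>\<theta>\<^sub>Z\<close> is
  minus the Lie derivative along \<open>Z\<close>, twisted by the connection; \<open>\<partial>\<^sup>2 = 0\<close> follows from
  \<open>[\<theta>\<^sub>Y, \<theta>\<^sub>Z] = - \<theta>\<^sub>[\<^sub>Y\<^sub>,\<^sub>Z\<^sub>]\<close>, which is flatness together with the Jacobi identity, and its consequence
  \<open>[\<partial>, \<theta>\<^sub>Z] = 0\<close>.  A measuring acts by \<open>x(Z \<and> w) = x\<^sub>(\<^sub>1\<^sub>)(Z) \<and> x\<^sub>(\<^sub>2\<^sub>)(w)\<close>.  By coassociativity and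
  cocommutativity \<open>x(\<theta>\<^sub>Z w) = \<theta>\<^bsub>x\<^sub>(\<^sub>1\<^sub>)(Z)\<^esub> x\<^sub>(\<^sub>2\<^sub>)(w)\<close>, and induction on words gives \<open>x \<partial> = \<partial>' x\<close>.  That
  the relation \<open>Z \<and> Z = 0\<close> is respected uses cocommutativity and division by \<open>2\<close>.
\<close>

section \<open>Additive maps out of free modules\<close>

text \<open>Two obstacles shape the proof. On formal words nothing is multilinear outright: a letter
  u + v or a u starts a new basis word, so additivity in a letter, and with it the independence of a
  Sweedler sum from its representative, holds only modulo relations. Hence almost every identity is
  a congruence, and the Sweedler calculus is built for maps that are linear modulo a subgroup.
  Secondly, the differential is not R-linear, so it is not automatic that it respects the relation
  between (a u) \<and> q and u \<and> (a q). The defect of \<open>bd\<close> in the coefficient and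
  that of \<open>theta Z\<close> in Z are both given by contraction with da, and they cancel. The
  recursion for the differential comes from separating, in the explicit formula, the terms that
  involve the first letter. Since this recursion changes degrees, relations are handled in all
  degrees at once and compared with those of a single exterior power by taking homogeneous
  parts.\<close>

definition add_ext :: "('b \<Rightarrow> 'a::zero \<Rightarrow> 'm::ab_group_add) \<Rightarrow> ('b \<Rightarrow>\<^sub>0 'a) \<Rightarrow> 'm" where
  "add_ext f p = (\<Sum>b\<in>Poly_Mapping.keys p. f b (Poly_Mapping.lookup p b))"

text \<open>Zero is covered as a \<open>single\<close> with coefficient 0, so later inductions have
  two cases.\<close>

lemma poly_mapping_single_induct [case_names single add]:
  fixes p :: "'b \<Rightarrow>\<^sub>0 'a::comm_monoid_add"
  assumes single: "\<And>b r. P (Poly_Mapping.single b r)"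
    and add: "\<And>p q. P p \<Longrightarrow> P q \<Longrightarrow> P (p + q)"
  shows "P p"
proof (induction p rule: update_induct)
  case const
  then show ?case using single[of undefined 0] by simp
next
  case (update f a b)
  have "Poly_Mapping.update a b f = Poly_Mapping.single a b + f"
  proof (rule poly_mapping_eqI)
    fix k
    show "Poly_Mapping.lookup (Poly_Mapping.update a b f) k =
        Poly_Mapping.lookup (Poly_Mapping.single a b + f) k"
      using update by (cases "a = k") (simp_all add: lookup_update lookup_add lookup_single in_keys_iff)
  qed
  then show ?case using single add update by metis
qed

text \<open>Coefficients of p + q may cancel, so p, q and p + q have different keys; a common finite
  index set makes their sums comparable.\<close>

lemma add_ext_superset:
  assumes "\<And>b. f b 0 = 0" "finite B" "Poly_Mapping.keys p \<subseteq> B"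
  shows "add_ext f p = (\<Sum>b\<in>B. f b (Poly_Mapping.lookup p b))"
  unfolding add_ext_def using assms
  by (intro sum.mono_neutral_left) (auto simp: in_keys_iff)

text \<open>Coefficients enter only additively: r \<mapsto> \<open>nb Z r\<close> and r \<mapsto>
  \<open>\<psi> x r\<close> are in general not R-linear, so \<open>theta\<close>, \<open>bd\<close>
  and \<open>fm\<close> are not R-linear extensions of their values on words.\<close>

lemma additive_add_ext:
  fixes f :: "'b \<Rightarrow> 'a::ab_group_add \<Rightarrow> 'm::ab_group_add"
  assumes "\<And>b. additive (f b)"
  shows "additive (add_ext f)"
proof
  fix p q :: "'b \<Rightarrow>\<^sub>0 'a"
  let ?B = "Poly_Mapping.keys p \<union> Poly_Mapping.keys q"
  have 0: "f b 0 = 0" for b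
    using additive.zero[OF assms] .
  have "add_ext f (p + q) = (\<Sum>b\<in>?B. f b (Poly_Mapping.lookup (p + q) b))"
    by (rule add_ext_superset[where f = f, OF 0]) (use Poly_Mapping.keys_add[of p q] in auto)
  also have "\<dots> = (\<Sum>b\<in>?B. f b (Poly_Mapping.lookup p b)) + (\<Sum>b\<in>?B. f b (Poly_Mapping.lookup q b))"
    by (simp add: lookup_add additive.add[OF assms] sum.distrib)
  also have "\<dots> = add_ext f p + add_ext f q"
    by (simp add: add_ext_superset[where f = f, OF 0, of ?B])
  finally show "add_ext f (p + q) = add_ext f p + add_ext f q" .
qed

lemma add_ext_single [simp]: "f b 0 = 0 \<Longrightarrow> add_ext f (Poly_Mapping.single b r) = f b r"
  by (cases "r = 0") (simp_all add: add_ext_def)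

lemma additive_single: "additive (Poly_Mapping.single b)"
  by (simp add: additive_def single_add)

section \<open>Scalars and prefixed letters in free modules\<close>

lemma lookup_free_scale:
  "Poly_Mapping.lookup (free_scale a p) b = a * Poly_Mapping.lookup p b"
  by (simp add: free_scale_def Poly_Mapping.map.rep_eq when_def)

lemma free_scale_single [simp]:
  "free_scale a (Poly_Mapping.single b r) = Poly_Mapping.single b (a * r)"
  by (rule poly_mapping_eqI) (simp add: lookup_free_scale lookup_single when_def)

lemma free_scale_add: "free_scale a (p + q) = free_scale a p + free_scale a q"
  by (rule poly_mapping_eqI) (simp add: lookup_free_scale lookup_add distrib_left)

lemma additive_free_scale: "additive (free_scale a)"
  by (simp add: additive_def free_scale_add)

lemmas free_scale_diff = additive.diff[OF additive_free_scale]
lemmas free_scale_zero [simp] = additive.zero[OF additive_free_scale]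

lemma free_scale_add_left: "free_scale (a + b) p = free_scale a p + free_scale b p"
  by (rule poly_mapping_eqI) (simp add: lookup_free_scale lookup_add distrib_right)

lemma free_scale_mult: "free_scale (a * b) p = free_scale a (free_scale b p)"
  by (rule poly_mapping_eqI) (simp add: lookup_free_scale mult.assoc)

lemma free_scale_one [simp]: "free_scale 1 p = p"
  by (rule poly_mapping_eqI) (simp add: lookup_free_scale)

lemma free_scale_minus_one: "free_scale (- 1) p = - p"
  by (rule poly_mapping_eqI) (simp add: lookup_free_scale)

lemma free_scale_zero_left [simp]: "free_scale 0 p = 0"
  by (rule poly_mapping_eqI) (simp add: lookup_free_scale)

lemma keys_free_scale: "Poly_Mapping.keys (free_scale a p) \<subseteq> Poly_Mapping.keys p"
  by (auto simp: in_keys_iff lookup_free_scale)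

definition cons_op :: "'l \<Rightarrow> ('l list \<Rightarrow>\<^sub>0 'r::ab_group_add) \<Rightarrow> ('l list \<Rightarrow>\<^sub>0 'r)" where
  "cons_op Z = add_ext (\<lambda>Zs. Poly_Mapping.single (Z # Zs))"

lemma additive_cons_op: "additive (cons_op Z)"
  unfolding cons_op_def by (intro additive_add_ext additive_single)

lemmas cons_op_add = additive.add[OF additive_cons_op]
lemmas cons_op_diff = additive.diff[OF additive_cons_op]
lemmas cons_op_minus = additive.minus[OF additive_cons_op]
lemmas cons_op_zero [simp] = additive.zero[OF additive_cons_op]

lemma cons_op_single [simp]: "cons_op Z (Poly_Mapping.single Zs r) = Poly_Mapping.single (Z # Zs) r"
  by (simp add: cons_op_def)

lemma free_scale_cons_op: "free_scale a (cons_op Z p) = cons_op Z (free_scale a p)"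
  by (induction p rule: poly_mapping_single_induct) (simp_all add: free_scale_add cons_op_add)

text \<open>The step prefixes a letter to an arbitrary combination instead of a single word, so
  identities between operators follow from their rules for \<open>cons_op\<close>.\<close>

lemma word_induct [case_names Nil Cons add]:
  fixes p :: "'l list \<Rightarrow>\<^sub>0 'r::ab_group_add"
  assumes Nil: "\<And>r. P (Poly_Mapping.single [] r)"
    and Cons: "\<And>Z p. P p \<Longrightarrow> P (cons_op Z p)"
    and add: "\<And>p q. P p \<Longrightarrow> P q \<Longrightarrow> P (p + q)"
  shows "P p"
proof (induction p rule: poly_mapping_single_induct)
  case (single b r)
  show ?case
  proof (induction b)
    case (Cons Z Zs)
    then show ?case using assms(2)[of "Poly_Mapping.single Zs r" Z] by simp
  qed (rule Nil)
qed (rule add)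

section \<open>Congruence modulo an additive subgroup\<close>

text \<open>Shared by the relations of the tensor powers of the coalgebra and by those of the
  exterior algebra.\<close>

locale add_subgroup =
  fixes N :: "'t::ab_group_add set"
  assumes zero_mem [simp]: "0 \<in> N"
    and diff_mem: "p \<in> N \<Longrightarrow> q \<in> N \<Longrightarrow> p - q \<in> N"
begin

definition eqm :: "'t \<Rightarrow> 't \<Rightarrow> bool" (infix "\<doteq>" 50) where
  "p \<doteq> q \<longleftrightarrow> p - q \<in> N"

lemma minus_mem: "p \<in> N \<Longrightarrow> - p \<in> N"
  using diff_mem[of 0 p] by simp

lemma add_mem: "p \<in> N \<Longrightarrow> q \<in> N \<Longrightarrow> p + q \<in> N"
  using diff_mem[of p "- q"] minus_mem by simp

lemma eqm_refl [simp]: "p \<doteq> p"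
  by (simp add: eqm_def)

lemma eqm_sym: "p \<doteq> q \<Longrightarrow> q \<doteq> p"
  using minus_mem[of "p - q"] by (simp add: eqm_def)

lemma eqm_trans [trans]: "p \<doteq> q \<Longrightarrow> q \<doteq> r \<Longrightarrow> p \<doteq> r"
  using add_mem[of "p - q" "q - r"] by (simp add: eqm_def)

lemma eqm_add: "p \<doteq> q \<Longrightarrow> p' \<doteq> q' \<Longrightarrow> p + p' \<doteq> q + q'"
  using add_mem[of "p - q" "p' - q'"] by (simp add: eqm_def algebra_simps)

lemma eqm_diff: "p \<doteq> q \<Longrightarrow> p' \<doteq> q' \<Longrightarrow> p - p' \<doteq> q - q'"
  using diff_mem[of "p - q" "p' - q'"] by (simp add: eqm_def algebra_simps)

lemma eqm_sum: "(\<And>i. i \<in> I \<Longrightarrow> f i \<doteq> g i) \<Longrightarrow> sum f I \<doteq> sum g I"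
  by (induction I rule: infinite_finite_induct) (auto intro: eqm_add)

lemma sum_mem: "(\<And>i. i \<in> I \<Longrightarrow> f i \<in> N) \<Longrightarrow> sum f I \<in> N"
  by (induction I rule: infinite_finite_induct) (auto intro: add_mem)

lemma eqm_mem: "p \<doteq> q \<Longrightarrow> q \<in> N \<Longrightarrow> p \<in> N"
  using add_mem[of "p - q" q] by (simp add: eqm_def)

lemma eqm_additive:
  assumes "additive f" "\<And>p. p \<in> N \<Longrightarrow> f p \<in> N" "p \<doteq> q"
  shows "f p \<doteq> f q"
  using assms(2)[of "p - q"] assms(3) by (simp add: eqm_def additive.diff[OF assms(1)])

end

section \<open>The differential on formal linear combinations of words\<close>

locale flat_lie_rinehart =
  fixes A :: "('k::field_char_0, 'r::{comm_ring,comm_monoid_mult}, 'l::ab_group_add) lie_rinehart"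
  assumes lie_rinehart: "lie_rinehart_algebra A"
    and flat: "flat_connection A"
begin

abbreviation br where "br \<equiv> bracket A"
abbreviation an where "an \<equiv> anchor A"
abbreviation nb where "nb \<equiv> conn A"
abbreviation ls where "ls \<equiv> lscale A"
abbreviation \<eta> where "\<eta> \<equiv> unit_map A"

lemma rscale_eq: "rscale A c r = \<eta> c * r"
  using lie_rinehart by (simp add: lie_rinehart_algebra_def comm_algebra_def unit_map_def)
    (metis mult_1_left)

lemma vector_space_rscale: "vector_space (rscale A)"
  using lie_rinehart by (simp add: lie_rinehart_algebra_def comm_algebra_def)

lemma vector_space_lkscale: "vector_space (lkscale A)"
  using lie_rinehart by (simp add: lie_rinehart_algebra_def lie_algebra_def)

lemma lkscale_eq: "lkscale A c Z = ls (\<eta> c) Z"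
  by (simp add: lkscale_def)

lemma \<eta>_add: "\<eta> (c + d) = \<eta> c + \<eta> d"
  using vector_space.vector_space_assms(2)[OF vector_space_rscale] by (simp add: unit_map_def)

lemma \<eta>_one [simp]: "\<eta> 1 = 1"
  using vector_space.vector_space_assms(4)[OF vector_space_rscale] by (simp add: unit_map_def)

lemma \<eta>_mult: "\<eta> (c * d) = \<eta> c * \<eta> d"
  using vector_space.vector_space_assms(3)[OF vector_space_rscale, of c d 1]
  by (simp add: rscale_eq)

lemma ls_add: "ls a (u + v) = ls a u + ls a v"
  and ls_add_left: "ls (a + b) u = ls a u + ls b u"
  and ls_one [simp]: "ls 1 u = u"
  using lie_rinehart by (simp_all add: lie_rinehart_algebra_def is_module_def)

lemma ls_minus: "ls (- a) u = - ls a u"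
  using ls_add_left[of "- a" a u] ls_add_left[of 0 0 u] by (simp add: eq_neg_iff_add_eq_0)

lemma ls_minus_right: "ls a (- u) = - ls a u"
  using ls_add[of a "- u" u] ls_add[of a 0 0] by (simp add: eq_neg_iff_add_eq_0)

lemma an_derivation: "an Z (r * r') = an Z r * r' + r * an Z r'"
  using lie_rinehart by (simp add: lie_rinehart_algebra_def derivation_def)

text \<open>The Leibniz rule on 1 * 1 kills 1, and linearity then kills all constants. The terms
  \<open>an Z a\<close> and \<open>contr a\<close> that keep \<open>theta\<close> and
  \<open>bd\<close> from being R-linear therefore vanish for a = \<open>\<eta> c\<close>, which
  leaves these operators k-linear.\<close>

lemma an_\<eta> [simp]: "an Z (\<eta> c) = 0"
proof -
  have "an Z 1 = an Z 1 + an Z 1"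
    using an_derivation[of Z 1 1] by simp
  moreover have "an Z (\<eta> c) = rscale A c (an Z 1)"
    using lie_rinehart
    by (simp add: lie_rinehart_algebra_def derivation_def unit_map_def Vector_Spaces.linear_iff)
  ultimately show ?thesis by (simp add: rscale_eq)
qed

lemma br_ls: "br Z (ls r Z') = ls r (br Z Z') + ls (an Z r) Z'"
  using lie_rinehart by (simp_all add: lie_rinehart_algebra_def)

lemma additive_br: "additive (br Z)"
  and br_add_left: "br (Z + Z') Y = br Z Y + br Z' Y"
  and br_self [simp]: "br Z Z = 0"
  and jacobi: "br U (br V W) + br V (br W U) + br W (br U V) = 0"
  using lie_rinehart
  by (simp_all add: lie_rinehart_algebra_def lie_algebra_def Vector_Spaces.linear_iff additive_def)

lemmas br_add = additive.add[OF additive_br]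
lemmas br_minus = additive.minus[OF additive_br]

lemma br_swap: "br Z Y = - br Y Z"
proof -
  have "br (Z + Y) (Z + Y) = br Z Y + br Y Z"
    by (simp add: br_add br_add_left algebra_simps del: br_self) simp
  then show ?thesis by (simp add: eq_neg_iff_add_eq_0)
qed

lemma additive_nb: "additive (nb Z)"
  and nb_add_left: "nb (Z + Z') r = nb Z r + nb Z' r"
  and nb_mult: "nb Z (r' * r) = r' * nb Z r - an Z r' * r"
  and nb_ls: "nb (ls r' Z) r = nb Z (r' * r)"
  and nb_flat: "nb (br Z' Z) r = nb Z (nb Z' r) - nb Z' (nb Z r)"
  using flat by (simp_all add: flat_connection_def Vector_Spaces.linear_iff additive_def)

lemmas nb_add = additive.add[OF additive_nb]

subsection \<open>The relations of the exterior algebra\<close>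

text \<open>The relations of all degrees together. The arbitrary tail \<open>q\<close> supplies
  multiplication on the right and \<open>null_cons\<close> on the left, so the rules fit operators
  that recurse on the first letter. Only adjacent equal letters are made null here;
  \<open>null_repeated\<close> treats the general case.\<close>

inductive_set ext_null :: "('l list \<Rightarrow>\<^sub>0 'r) set" where
  null_zero [simp]: "0 \<in> ext_null"
| null_diff: "p \<in> ext_null \<Longrightarrow> q \<in> ext_null \<Longrightarrow> p - q \<in> ext_null"
| null_cons: "p \<in> ext_null \<Longrightarrow> cons_op Z p \<in> ext_null"
| null_add: "cons_op (u + v) q - cons_op u q - cons_op v q \<in> ext_null"
| null_scale: "cons_op (ls a u) q - cons_op u (free_scale a q) \<in> ext_null"
| null_alt: "cons_op u (cons_op u q) \<in> ext_null"

sublocale E: add_subgroup ext_null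
  by unfold_locales (auto intro: null_diff)

notation E.eqm (infix "\<doteq>" 50)

lemmas null_intros = ext_null.null_add ext_null.null_scale ext_null.null_alt ext_null.null_cons
  ext_null.null_diff

text \<open>The tail \<open>q\<close> of each generator absorbs the scalar; commutativity of R
  enters for \<open>null_scale\<close>.\<close>

lemma null_free_scale: "p \<in> ext_null \<Longrightarrow> free_scale a p \<in> ext_null"
proof (induction rule: ext_null.induct)
  case (null_add u v q)
  then show ?case
    using ext_null.null_add[of u v "free_scale a q"]
    by (simp add: free_scale_diff free_scale_cons_op)
next
  case (null_scale b u q)
  have "free_scale a (free_scale b q) = free_scale b (free_scale a q)"
    by (simp add: mult.commute flip: free_scale_mult)
  then show ?case
    using ext_null.null_scale[of b u "free_scale a q"]
    by (simp add: free_scale_diff free_scale_cons_op)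
qed (auto simp: free_scale_diff free_scale_cons_op intro: ext_null.intros)

lemma cons_op_add_left: "cons_op (u + v) q \<doteq> cons_op u q + cons_op v q"
  using null_add[of u v q] by (simp add: E.eqm_def algebra_simps)

lemma cons_op_ls: "cons_op (ls a u) q \<doteq> cons_op u (free_scale a q)"
  using null_scale by (simp add: E.eqm_def)

lemma cons_op_zero_left: "cons_op 0 q \<in> ext_null"
  using E.minus_mem[OF null_add[of 0 0 q]] by simp

lemma cons_op_minus_left: "cons_op (- u) q \<doteq> - cons_op u q"
  using E.diff_mem[OF cons_op_zero_left[of q] null_add[of u "- u" q]]
  by (simp add: E.eqm_def algebra_simps)

text \<open>Polarisation of (u + v) \<and> (u + v) = 0. As \<open>cons_op\<close> is additive in the
  letter only modulo relations, the expansion is corrected by instances of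
  \<open>null_add\<close>.\<close>

lemma cons_op_swap: "cons_op u (cons_op v q) \<doteq> - cons_op v (cons_op u q)"
proof -
  let ?e = cons_op
  have "?e u (?e v q) + ?e v (?e u q) =
    ?e (u + v) (?e (u + v) q) - ?e u (?e u q) - ?e v (?e v q)
    - (?e (u + v) (?e (u + v) q) - ?e u (?e (u + v) q) - ?e v (?e (u + v) q))
    - ?e u (?e (u + v) q - ?e u q - ?e v q) - ?e v (?e (u + v) q - ?e u q - ?e v q)"
    by (simp add: cons_op_diff)
  also have "\<dots> \<in> ext_null"
    by (rule null_intros)+
  finally show ?thesis by (simp add: E.eqm_def)
qed

subsection \<open>Lie derivative, differential and contraction\<close>

text \<open>Minus the Lie derivative along \<open>Z\<close>, twisted by the connection.  The differential is
  determined by it through \<open>\<partial>(Z \<and> w) = \<theta>\<^sub>Z w - Z \<and> \<partial>w\<close>.\<close>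

primrec theta_word :: "'l \<Rightarrow> 'l list \<Rightarrow> 'r \<Rightarrow> ('l list \<Rightarrow>\<^sub>0 'r)" where
  "theta_word Z [] r = Poly_Mapping.single [] (nb Z r)"
| "theta_word Z (Y # Ys) r = cons_op Y (theta_word Z Ys r) - Poly_Mapping.single (br Z Y # Ys) r"

definition theta :: "'l \<Rightarrow> ('l list \<Rightarrow>\<^sub>0 'r) \<Rightarrow> ('l list \<Rightarrow>\<^sub>0 'r)" where
  "theta Z = add_ext (theta_word Z)"

primrec bd_word :: "'l list \<Rightarrow> 'r \<Rightarrow> ('l list \<Rightarrow>\<^sub>0 'r)" where
  "bd_word [] r = 0"
| "bd_word (Z # Zs) r = theta_word Z Zs r - cons_op Z (bd_word Zs r)"

definition bd :: "('l list \<Rightarrow>\<^sub>0 'r) \<Rightarrow> ('l list \<Rightarrow>\<^sub>0 'r)" where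
  "bd = add_ext bd_word"

text \<open>Contraction with the \<open>1\<close>-form \<open>da\<close>, i.e. \<open>Z \<mapsto> Z(a)\<close>.\<close>

primrec contr_word :: "'r \<Rightarrow> 'l list \<Rightarrow> 'r \<Rightarrow> ('l list \<Rightarrow>\<^sub>0 'r)" where
  "contr_word a [] r = 0"
| "contr_word a (Z # Zs) r = Poly_Mapping.single Zs (an Z a * r) - cons_op Z (contr_word a Zs r)"

definition contr :: "'r \<Rightarrow> ('l list \<Rightarrow>\<^sub>0 'r) \<Rightarrow> ('l list \<Rightarrow>\<^sub>0 'r)" where
  "contr a = add_ext (contr_word a)"

lemma additive_theta_word: "additive (theta_word Z Ys)"
  by (induction Ys) (auto simp: additive_def nb_add single_add cons_op_add algebra_simps)

lemma additive_bd_word: "additive (bd_word Ys)"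
  using additive_theta_word
  by (induction Ys) (auto simp: additive_def cons_op_add algebra_simps)

lemma additive_contr_word: "additive (contr_word a Ys)"
  by (induction Ys) (auto simp: additive_def single_add cons_op_add algebra_simps)

lemma additive_theta: "additive (theta Z)"
  unfolding theta_def by (intro additive_add_ext additive_theta_word)

lemma additive_bd: "additive bd"
  unfolding bd_def by (intro additive_add_ext additive_bd_word)

lemma additive_contr: "additive (contr a)"
  unfolding contr_def by (intro additive_add_ext additive_contr_word)

lemmas theta_add = additive.add[OF additive_theta]
lemmas theta_diff = additive.diff[OF additive_theta]
lemmas theta_zero [simp] = additive.zero[OF additive_theta]
lemmas bd_add = additive.add[OF additive_bd]
lemmas bd_diff = additive.diff[OF additive_bd]
lemmas bd_zero [simp] = additive.zero[OF additive_bd]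
lemmas contr_add = additive.add[OF additive_contr]

lemma theta_single: "theta Z (Poly_Mapping.single Zs r) = theta_word Z Zs r"
  by (simp add: theta_def additive.zero[OF additive_theta_word])

lemma bd_single: "bd (Poly_Mapping.single Zs r) = bd_word Zs r"
  by (simp add: bd_def additive.zero[OF additive_bd_word])

lemma contr_single: "contr a (Poly_Mapping.single Zs r) = contr_word a Zs r"
  by (simp add: contr_def additive.zero[OF additive_contr_word])

lemma theta_Nil [simp]: "theta Z (Poly_Mapping.single [] r) = Poly_Mapping.single [] (nb Z r)"
  by (simp add: theta_single)

lemma bd_Nil [simp]: "bd (Poly_Mapping.single [] r) = 0"
  by (simp add: bd_single)

lemma contr_Nil [simp]: "contr a (Poly_Mapping.single [] r) = 0"
  by (simp add: contr_single)

lemma theta_cons_op: "theta Z (cons_op Y p) = cons_op Y (theta Z p) - cons_op (br Z Y) p"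
  by (induction p rule: poly_mapping_single_induct)
    (simp_all add: theta_single theta_add cons_op_add)

lemma bd_cons_op: "bd (cons_op Z p) = theta Z p - cons_op Z (bd p)"
  by (induction p rule: poly_mapping_single_induct)
    (simp_all add: theta_single bd_single theta_add bd_add cons_op_add)

lemma contr_cons_op: "contr a (cons_op Z p) = free_scale (an Z a) p - cons_op Z (contr a p)"
  by (induction p rule: poly_mapping_single_induct)
    (simp_all add: contr_single contr_add cons_op_add free_scale_add)

lemma theta_free_scale: "theta Z (free_scale a p) = free_scale a (theta Z p) - free_scale (an Z a) p"
  by (induction p rule: word_induct)
    (simp_all add: nb_mult single_diff free_scale_cons_op theta_cons_op cons_op_diff
      free_scale_diff free_scale_add theta_add)

text \<open>This defect is the reason for introducing \<open>contr\<close>: every letter contributes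
  the term \<open>an Z a\<close> of \<open>theta_free_scale\<close>, with alternating signs.\<close>

lemma bd_free_scale: "bd (free_scale a p) = free_scale a (bd p) - contr a p"
  by (induction p rule: word_induct)
    (simp_all add: free_scale_cons_op bd_cons_op contr_cons_op theta_free_scale cons_op_diff
      free_scale_diff free_scale_add bd_add contr_add)

subsection \<open>Compatibility with the relations\<close>

text \<open>Letter by letter, \<open>theta Z\<close> differentiates by minus the bracket with Z, so
  a relation goes to relations of the same kind. For \<open>null_scale\<close> the anchor term of
  [Z, a u] cancels against that of \<open>theta_free_scale\<close>; for \<open>null_alt\<close> the
  two cross terms cancel by antisymmetry.\<close>

lemma theta_null: "p \<in> ext_null \<Longrightarrow> theta Z p \<in> ext_null"
proof (induction rule: ext_null.induct)
  case (null_diff p q)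
  then show ?case by (simp add: theta_diff ext_null.null_diff)
next
  case (null_cons p Y)
  have "cons_op (br Z Y) p \<in> ext_null"
    by (rule ext_null.null_cons) fact
  with null_cons show ?case
    by (simp add: theta_cons_op ext_null.intros)
next
  case (null_add u v q)
  have "theta Z (cons_op (u + v) q - cons_op u q - cons_op v q) =
    (cons_op (u + v) (theta Z q) - cons_op u (theta Z q) - cons_op v (theta Z q)) -
    (cons_op (br Z u + br Z v) q - cons_op (br Z u) q - cons_op (br Z v) q)"
    by (simp add: theta_diff theta_cons_op br_add)
  also have "\<dots> \<in> ext_null"
    by (rule null_intros)+
  finally show ?case .
next
  case (null_scale a u q)
  have "theta Z (cons_op (ls a u) q - cons_op u (free_scale a q)) =
    (cons_op (ls a u) (theta Z q) - cons_op u (free_scale a (theta Z q)))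
    - (cons_op (ls a (br Z u) + ls (an Z a) u) q
        - cons_op (ls a (br Z u)) q - cons_op (ls (an Z a) u) q)
    - (cons_op (ls a (br Z u)) q - cons_op (br Z u) (free_scale a q))
    - (cons_op (ls (an Z a) u) q - cons_op u (free_scale (an Z a) q))"
    by (simp add: theta_diff theta_cons_op theta_free_scale br_ls cons_op_diff)
  also have "\<dots> \<in> ext_null"
    by (rule null_intros)+
  finally show ?case .
next
  case (null_alt u q)
  have "theta Z (cons_op u (cons_op u q)) = cons_op u (cons_op u (theta Z q))
     - (cons_op u (cons_op (br Z u) q) - (- cons_op (br Z u) (cons_op u q)))"
    by (simp add: theta_cons_op cons_op_diff)
  also have "\<dots> \<in> ext_null"
  proof (rule E.diff_mem)
    show "cons_op u (cons_op u (theta Z q)) \<in> ext_null"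
      by (rule ext_null.null_alt)
    show "cons_op u (cons_op (br Z u) q) - - cons_op (br Z u) (cons_op u q) \<in> ext_null"
      using cons_op_swap[of u "br Z u" q] by (simp add: E.eqm_def)
  qed
  finally show ?case .
qed simp

text \<open>Only a congruence, because \<open>br u Y + br v Y\<close> occurs as one letter.\<close>

lemma theta_add_left: "theta (u + v) q \<doteq> theta u q + theta v q"
proof (induction q rule: word_induct)
  case (Cons Y q)
  have "cons_op Y (theta (u + v) q) \<doteq> cons_op Y (theta u q + theta v q)"
    by (intro E.eqm_additive[OF additive_cons_op] null_cons Cons)
  from E.eqm_diff[OF this cons_op_add_left[of "br u Y" "br v Y" q]]
  show ?case by (simp add: theta_cons_op cons_op_add br_add_left algebra_simps)
next
  case (add p q)
  then show ?case using E.eqm_add[OF add] by (simp add: theta_add algebra_simps)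
qed (simp add: nb_add_left single_add)

lemma theta_minus_left: "theta (- u) q \<doteq> - theta u q"
proof -
  have "theta 0 q - (theta u q + theta (- u) q) \<in> ext_null"
    using theta_add_left[of u "- u" q] by (simp add: E.eqm_def)
  \<comment> \<open>The instance 0 = 0 + 0 says that \<open>theta 0 q\<close> is null.\<close>
  moreover have "theta 0 q - (theta 0 q + theta 0 q) \<in> ext_null"
    using theta_add_left[of 0 0 q] by (simp add: E.eqm_def)
  ultimately have "- (theta 0 q - (theta 0 q + theta 0 q)) - (theta 0 q - (theta u q + theta (- u) q))
      \<in> ext_null"
    by (metis E.diff_mem E.minus_mem)
  also have "- (theta 0 q - (theta 0 q + theta 0 q)) - (theta 0 q - (theta u q + theta (- u) q)) =
      theta (- u) q - - theta u q"
    by simp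
  finally show ?thesis by (simp add: E.eqm_def)
qed

text \<open>A counterpart of the rule for the Lie derivative along a multiple of a vector field. In
  \<open>bd_null\<close> its last term cancels the \<open>contr a\<close> of
  \<open>bd_free_scale\<close>. The empty word is the axiom \<open>nb_ls\<close>.\<close>

lemma theta_ls: "theta (ls a u) q \<doteq> theta u (free_scale a q) + cons_op u (contr a q)"
proof (induction q rule: word_induct)
  case (Cons Y q)
  \<comment> \<open>Antisymmetry carries the Leibniz rule over to the left argument and reverses the
    sign of the anchor term.\<close>
  have br: "br (ls a u) Y = ls a (br u Y) + ls (- an Y a) u"
    using br_swap[of "ls a u" Y] br_swap[of u Y] ls_minus_right[of a "br Y u"]
    by (simp add: br_ls ls_minus)
  have "cons_op Y (theta (ls a u) q) \<doteq> cons_op Y (theta u (free_scale a q) + cons_op u (contr a q))"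
    by (intro E.eqm_additive[OF additive_cons_op] null_cons Cons)
  also have "\<dots> \<doteq> cons_op Y (theta u (free_scale a q)) - cons_op u (cons_op Y (contr a q))"
    using E.eqm_add[OF E.eqm_refl cons_op_swap] by (simp add: cons_op_add)
  finally have 1: "cons_op Y (theta (ls a u) q) \<doteq> \<dots>" .
  have "cons_op (br (ls a u) Y) q \<doteq> cons_op (ls a (br u Y)) q + cons_op (ls (- an Y a) u) q"
    unfolding br by (rule cons_op_add_left)
  also have "\<dots> \<doteq> cons_op (br u Y) (free_scale a q) + cons_op u (free_scale (- an Y a) q)"
    by (intro E.eqm_add cons_op_ls)
  also have "free_scale (- an Y a) q = - free_scale (an Y a) q"
    by (rule poly_mapping_eqI) (simp add: lookup_free_scale)
  finally have 2: "cons_op (br (ls a u) Y) q \<doteq>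
    cons_op (br u Y) (free_scale a q) - cons_op u (free_scale (an Y a) q)"
    by (simp add: cons_op_minus)
  from E.eqm_diff[OF 1 2] show ?case
    by (simp add: theta_cons_op contr_cons_op free_scale_cons_op cons_op_diff algebra_simps)
next
  case (add p q)
  then show ?case using E.eqm_add[OF add]
    by (simp add: theta_add free_scale_add contr_add cons_op_add algebra_simps)
qed (simp add: nb_ls)


lemma bd_null: "p \<in> ext_null \<Longrightarrow> bd p \<in> ext_null"
proof (induction rule: ext_null.induct)
  case (null_diff p q)
  then show ?case by (simp add: bd_diff ext_null.null_diff)
next
  case (null_cons p Y)
  then show ?case by (simp add: bd_cons_op ext_null.null_diff ext_null.null_cons theta_null)
next
  case (null_add u v q)
  have "bd (cons_op (u + v) q - cons_op u q - cons_op v q) =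
    (theta (u + v) q - (theta u q + theta v q)) -
    (cons_op (u + v) (bd q) - cons_op u (bd q) - cons_op v (bd q))"
    by (simp add: bd_diff bd_cons_op)
  also have "\<dots> \<in> ext_null"
    by (rule E.diff_mem[OF theta_add_left[unfolded E.eqm_def] ext_null.null_add])
  finally show ?case .
next
  case (null_scale a u q)
  have "bd (cons_op (ls a u) q - cons_op u (free_scale a q)) =
    (theta (ls a u) q - (theta u (free_scale a q) + cons_op u (contr a q))) -
    (cons_op (ls a u) (bd q) - cons_op u (free_scale a (bd q)))"
    by (simp add: bd_diff bd_cons_op bd_free_scale cons_op_diff)
  also have "\<dots> \<in> ext_null"
    by (rule E.diff_mem[OF theta_ls[unfolded E.eqm_def] ext_null.null_scale])
  finally show ?case .
next
  case (null_alt u q)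
  \<comment> \<open>The two terms with u and \<open>theta u q\<close> cancel. What is left is [u, u]
    = 0 as a letter, and u \<and> u in front of \<open>bd q\<close>.\<close>
  show ?case
    by (simp add: bd_cons_op theta_cons_op cons_op_diff cons_op_zero_left E.diff_mem
        ext_null.null_alt)
qed simp

text \<open>Flatness of the connection enters here.\<close>

lemma theta_commutator:
  "theta Y (theta Z q) - theta Z (theta Y q) \<doteq> - theta (br Y Z) q"
proof (induction q rule: word_induct)
  case (Nil r)
  show ?case by (simp add: nb_flat single_diff)
next
  case (Cons W q)
  have jac: "br Y (br Z W) + - br Z (br Y W) = br (br Y Z) W"
    using jacobi[of Y Z W] br_swap[of W "br Y Z"] br_swap[of W Y]
    by (simp add: br_minus algebra_simps add_eq_0_iff)
  have "cons_op W (theta Y (theta Z q) - theta Z (theta Y q)) \<doteq> cons_op W (- theta (br Y Z) q)"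
    by (intro E.eqm_additive[OF additive_cons_op] null_cons Cons)
  moreover have "cons_op (br (br Y Z) W) q \<doteq> cons_op (br Y (br Z W)) q - cons_op (br Z (br Y W)) q"
    using E.eqm_trans[OF cons_op_add_left E.eqm_add[OF E.eqm_refl cons_op_minus_left]]
    by (simp flip: jac)
  ultimately have "cons_op W (theta Y (theta Z q) - theta Z (theta Y q)) +
      (cons_op (br Y (br Z W)) q - cons_op (br Z (br Y W)) q) \<doteq>
      cons_op W (- theta (br Y Z) q) + cons_op (br (br Y Z) W) q"
    using E.eqm_add E.eqm_sym by blast
  then show ?case
    by (simp add: theta_cons_op theta_diff cons_op_diff cons_op_minus algebra_simps)
next
  case (add p q)
  from E.eqm_add[OF add] show ?case
    by (simp add: theta_add algebra_simps)
qed

text \<open>On Y \<and> q the differential brings in \<open>theta Y\<close>, so the difference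
  contains the commutator of \<open>theta Y\<close> and \<open>theta Z\<close>. By
  \<open>theta_commutator\<close> it cancels the term that comes from the bracket letter [Z, Y]; the
  rest is the induction hypothesis behind Y.\<close>

lemma bd_theta: "bd (theta Z q) \<doteq> theta Z (bd q)"
proof (induction q rule: word_induct)
  case (Cons Y q)
  have "bd (theta Z (cons_op Y q)) - theta Z (bd (cons_op Y q)) =
    (theta Y (theta Z q) - theta Z (theta Y q) - (- theta (br Y Z) q))
    - (theta (- br Y Z) q - (- theta (br Y Z) q))
    - cons_op Y (bd (theta Z q) - theta Z (bd q))"
    by (simp add: theta_cons_op bd_cons_op bd_diff theta_diff cons_op_diff br_swap[of Z Y])
  also have "\<dots> \<in> ext_null"
    by (rule E.diff_mem[OF E.diff_mem[OF theta_commutator[unfolded E.eqm_def]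
      theta_minus_left[unfolded E.eqm_def]] ext_null.null_cons[OF Cons[unfolded E.eqm_def]]])
  finally show ?case by (simp add: E.eqm_def)
next
  case (add p q)
  from E.eqm_add[OF add] show ?case
    by (simp add: theta_add bd_add algebra_simps)
qed simp

lemma bd_bd: "bd (bd q) \<in> ext_null"
proof (induction q rule: word_induct)
  case (Cons Z q)
  have "bd (bd (cons_op Z q)) = (bd (theta Z q) - theta Z (bd q)) + cons_op Z (bd (bd q))"
    by (simp add: bd_cons_op bd_diff)
  also have "\<dots> \<in> ext_null"
    by (rule E.add_mem[OF bd_theta[unfolded E.eqm_def] ext_null.null_cons[OF Cons]])
  finally show ?case .
next
  case (add p q)
  then show ?case by (simp add: bd_add E.add_mem)
qed simp

end

section \<open>Linear extensions and Sweedler sums\<close>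

context vector_space
begin

lemma lin_ext_eq: "lin_ext scale f = add_ext (\<lambda>b r. scale r (f b))"
  by (simp add: fun_eq_iff lin_ext_def add_ext_def)

lemma additive_lin_ext: "additive (lin_ext scale f)"
  unfolding lin_ext_eq by (intro additive_add_ext) (simp add: additive_def scale_left_distrib)

lemmas lin_ext_add = additive.add[OF additive_lin_ext]
lemmas lin_ext_diff = additive.diff[OF additive_lin_ext]

lemma lin_ext_single [simp]: "lin_ext scale f (Poly_Mapping.single b r) = scale r (f b)"
  unfolding lin_ext_eq by simp

lemma lin_ext_zero [simp]: "lin_ext scale f 0 = 0"
  by (simp add: lin_ext_def)

lemma lin_ext_free_scale: "lin_ext scale f (free_scale c p) = scale c (lin_ext scale f p)"
  by (induction p rule: poly_mapping_single_induct)
    (simp_all add: free_scale_add lin_ext_add scale_right_distrib)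

lemma lin_ext_cong:
  "(\<And>b. b \<in> Poly_Mapping.keys p \<Longrightarrow> f b = g b) \<Longrightarrow> lin_ext scale f p = lin_ext scale g p"
  by (simp add: lin_ext_def)

lemma lin_ext_fun_add:
  "lin_ext scale (\<lambda>b. f b + g b) p = lin_ext scale f p + lin_ext scale g p"
  by (simp add: lin_ext_def scale_right_distrib sum.distrib)

lemma lin_ext_fun_diff:
  "lin_ext scale (\<lambda>b. f b - g b) p = lin_ext scale f p - lin_ext scale g p"
  by (simp add: lin_ext_def scale_right_diff_distrib sum_subtractf)

lemma lin_ext_fun_scale:
  "lin_ext scale (\<lambda>b. scale c (f b)) p = scale c (lin_ext scale f p)"
  by (simp add: lin_ext_def scale_sum_right mult.commute)

lemma lin_ext_swap:
  "lin_ext scale (\<lambda>b. lin_ext scale (f b) q) p = lin_ext scale (\<lambda>c. lin_ext scale (\<lambda>b. f b c) p) q"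
  by (simp add: lin_ext_def scale_sum_right mult.commute sum.swap[of _ "Poly_Mapping.keys p"])

lemma lin_ext_apply:
  assumes "additive h" "\<And>c x. h (scale c x) = s' c (h x)"
  shows "h (lin_ext scale f p) = lin_ext s' (\<lambda>b. h (f b)) p"
  by (simp add: lin_ext_def additive.sum[OF assms(1)] assms(2))

end

lemma vector_space_free_scale:
  "vector_space (free_scale :: 'k::field \<Rightarrow> ('b \<Rightarrow>\<^sub>0 'k) \<Rightarrow> ('b \<Rightarrow>\<^sub>0 'k))"
  by unfold_locales (simp_all add: free_scale_add free_scale_add_left free_scale_mult)

interpretation free_scale: vector_space "free_scale :: 'k::field \<Rightarrow> ('b \<Rightarrow>\<^sub>0 'k) \<Rightarrow> ('b \<Rightarrow>\<^sub>0 'k)"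
  by (rule vector_space_free_scale)

lemma (in vector_space) lin_ext_lin_ext:
  "lin_ext scale f (lin_ext free_scale g p) = lin_ext scale (\<lambda>b. lin_ext scale f (g b)) p"
  by (rule free_scale.lin_ext_apply[OF additive_lin_ext lin_ext_free_scale])

section \<open>Cosets in the tensor powers of the coalgebra\<close>

lemma tensor_rels_keys: "p \<in> tensor_rels C n \<Longrightarrow> us \<in> Poly_Mapping.keys p \<Longrightarrow> length us = n"
  unfolding tensor_rels_def
proof (induction arbitrary: us rule: submodule_gen.induct)
  case (base p)
  then show ?case
    by (auto simp: multilinear_rels_def in_keys_iff lookup_minus lookup_single when_def
        split: if_splits)
next
  case (add p q)
  then show ?case using Poly_Mapping.keys_add[of p q] by blast
next
  case (scale p a)
  then show ?case using keys_free_scale[of a p] by blast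
qed simp

lemma tensor_rels_diff:
  assumes "p \<in> tensor_rels C n" "q \<in> tensor_rels C n"
  shows "p - q \<in> tensor_rels C n"
  using submodule_gen.add[of p _ "free_scale (- 1) q"] submodule_gen.scale[of q _ "- 1"] assms
  unfolding tensor_rels_def by (simp add: free_scale_minus_one)

lemma tensor_rels_zero: "0 \<in> tensor_rels C n"
  unfolding tensor_rels_def by (rule submodule_gen.zero)

interpretation tensor_rels: add_subgroup "tensor_rels C n"
  by unfold_locales (auto intro: tensor_rels_zero tensor_rels_diff)

lemma tensor_class_eq: "tensor_class C n p = {q. q - p \<in> tensor_rels C n}"
proof -
  have "q \<in> tensor_class C n p" if "q - p \<in> tensor_rels C n" for q
    using that by (force simp: tensor_class_def a_r_coset_def' free_tuples_def
        intro: bexI[of _ "q - p"])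
  then show ?thesis
    by (auto simp: tensor_class_def a_r_coset_def' free_tuples_def)
qed

lemma tensor_class_eqD: "tensor_class C n p = tensor_class C n q \<Longrightarrow> p - q \<in> tensor_rels C n"
  by (auto simp: tensor_class_eq set_eq_iff tensor_rels_zero dest!: spec[of _ p])

lemma tensor_class_add:
  "tensor_class C n p \<oplus>\<^bsub>tensor_power C n\<^esub> tensor_class C n q = tensor_class C n (p + q)"
proof -
  have "\<exists>a b. r = a + b \<and> a - p \<in> tensor_rels C n \<and> b - q \<in> tensor_rels C n"
    if "r - (p + q) \<in> tensor_rels C n" for r
    using that by (intro exI[of _ "r - q"] exI[of _ q]) (simp add: algebra_simps tensor_rels_zero)
  moreover have "a + b - (p + q) \<in> tensor_rels C n"
    if "a - p \<in> tensor_rels C n" "b - q \<in> tensor_rels C n" for a b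
    using tensor_rels.add_mem[OF that] by (simp add: algebra_simps)
  ultimately show ?thesis
    by (auto simp: tensor_class_eq tensor_power_def quot_module_def set_add_def' free_tuples_def)
      blast+
qed

text \<open>The scalar action of \<open>quot_module\<close> is a union over all representatives of a
  coset, so one shows that they all yield the same coset and that there is at least one.\<close>

lemma tensor_class_smult:
  "c \<odot>\<^bsub>tensor_power C n\<^esub> tensor_class C n p = tensor_class C n (free_scale c p)"
proof -
  have *: "c \<odot>\<^bsub>tensor_power C n\<^esub> tensor_class C n p =
      (\<Union>a\<in>tensor_class C n p. tensor_class C n (free_scale c a))"
    by (simp add: tensor_power_def quot_module_def tensor_class_def) (simp add: free_tuples_def)
  have "tensor_class C n (free_scale c a) = tensor_class C n (free_scale c p)"
    if "a \<in> tensor_class C n p" for a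
  proof -
    have "free_scale c (a - p) \<in> tensor_rels C n"
      using that submodule_gen.scale unfolding tensor_class_eq tensor_rels_def by blast
    then have "tensor_rels.eqm C n (free_scale c a) (free_scale c p)"
      by (simp add: tensor_rels.eqm_def free_scale_diff)
    then show ?thesis
      unfolding tensor_class_eq tensor_rels.eqm_def[symmetric]
      using tensor_rels.eqm_trans tensor_rels.eqm_sym by blast
  qed
  moreover have "p \<in> tensor_class C n p"
    by (simp add: tensor_class_eq tensor_rels_zero)
  ultimately show ?thesis unfolding * by blast
qed

lemma carrier_tensor_power:
  "carrier (tensor_power C n) = tensor_class C n ` carrier (free_tuples (\<lambda>c::'k. c) n)"
  for C :: "('k::field_char_0, 'c::ab_group_add) coalg"
  unfolding tensor_power_def quot_module_def A_RCOSETS_def' tensor_class_def by auto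

text \<open>The subgroup N is part of the target because maps such as y \<mapsto>
  \<open>cons_op (\<Psi> y Z) p\<close> are linear only modulo the exterior relations; the value of
  a Sweedler sum has a meaning modulo N.\<close>

locale sweedler_sums = vector_space s + add_subgroup N
  for s :: "'k::field_char_0 \<Rightarrow> 't::ab_group_add \<Rightarrow> 't" and N :: "'t set" +
  fixes C :: "('k, 'c::ab_group_add) coalg"
  assumes coalg: "cocommutative_coalgebra C"
    and scale_mem: "p \<in> N \<Longrightarrow> s c p \<in> N"
begin

abbreviation cs where "cs \<equiv> cscale C"

lemma comult_rep_class: "comult C x = tensor_class C 2 (comult_rep C x)"
  and comult_rep_keys: "xs \<in> Poly_Mapping.keys (comult_rep C x) \<Longrightarrow> length xs = 2"
proof -
  have "comult C x \<in> carrier (tensor_power C 2)"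
    using coalg by (simp add: cocommutative_coalgebra_def)
  then obtain p where p: "comult C x = tensor_class C 2 p" "p \<in> carrier (free_tuples (\<lambda>c::'k. c) 2)"
    unfolding carrier_tensor_power by blast
  then have p2: "length xs = 2" if "xs \<in> Poly_Mapping.keys p" for xs
    using that by (simp add: free_tuples_def)
  \<comment> \<open>The choice is legitimate since the comultiplication of x is a coset, which
    contains p.\<close>
  have "comult_rep C x \<in> comult C x"
    unfolding comult_rep_def
  proof (rule someI)
    show "p \<in> comult C x" by (simp add: p(1) tensor_class_eq tensor_rels_zero)
  qed
  then have *: "comult_rep C x - p \<in> tensor_rels C 2"
    by (simp add: p(1) tensor_class_eq)
  show "comult C x = tensor_class C 2 (comult_rep C x)"
    using * tensor_rels.eqm_trans tensor_rels.eqm_sym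
    unfolding p(1) tensor_class_eq tensor_rels.eqm_def[symmetric] by blast
  assume "xs \<in> Poly_Mapping.keys (comult_rep C x)"
  \<comment> \<open>The chosen representative differs from p by a relation, and relations of degree
    2 involve only pairs.\<close>
  then have "xs \<in> Poly_Mapping.keys (comult_rep C x - p) \<or> xs \<in> Poly_Mapping.keys p"
    by (auto simp: in_keys_iff lookup_minus)
  then show "length xs = 2"
    using p2 tensor_rels_keys[OF *] by blast
qed

definition lin_mod :: "('c \<Rightarrow> 't) \<Rightarrow> bool" where
  "lin_mod g \<longleftrightarrow> (\<forall>x y. g (x + y) \<doteq> g x + g y) \<and> (\<forall>c x. g (cs c x) \<doteq> s c (g x))"

definition multilin :: "nat \<Rightarrow> ('c list \<Rightarrow> 't) \<Rightarrow> bool" where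
  "multilin n f \<longleftrightarrow>
     (\<forall>us ws. length us + 1 + length ws = n \<longrightarrow> lin_mod (\<lambda>u. f (us @ u # ws)))"

definition bilin :: "('c \<Rightarrow> 'c \<Rightarrow> 't) \<Rightarrow> bool" where
  "bilin f \<longleftrightarrow> (\<forall>b. lin_mod (\<lambda>a. f a b)) \<and> (\<forall>a. lin_mod (f a))"

definition trilin :: "('c \<Rightarrow> 'c \<Rightarrow> 'c \<Rightarrow> 't) \<Rightarrow> bool" where
  "trilin f \<longleftrightarrow> (\<forall>b. bilin (\<lambda>a. f a b)) \<and> (\<forall>a. bilin (f a))"

text \<open>\<open>f(x\<^sub>(\<^sub>1\<^sub>), x\<^sub>(\<^sub>2\<^sub>))\<close> in Sweedler notation.\<close>

definition sw :: "'c \<Rightarrow> ('c \<Rightarrow> 'c \<Rightarrow> 't) \<Rightarrow> 't" where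
  "sw x f = lin_ext s (\<lambda>xs. f (xs ! 0) (xs ! 1)) (comult_rep C x)"

lemma eqm_scale: "p \<doteq> q \<Longrightarrow> s c p \<doteq> s c q"
  using scale_mem[of "p - q" c] by (simp add: eqm_def scale_right_diff_distrib)

lemma lin_ext_eqm:
  "(\<And>b. b \<in> Poly_Mapping.keys p \<Longrightarrow> f b \<doteq> g b) \<Longrightarrow> lin_ext s f p \<doteq> lin_ext s g p"
  unfolding lin_ext_def by (intro eqm_sum eqm_scale)

lemma lin_mod_cong:
  assumes "lin_mod g" "\<And>x. f x \<doteq> g x"
  shows "lin_mod f"
  unfolding lin_mod_def
proof (intro conjI allI)
  fix x y
  have "f (x + y) \<doteq> g (x + y)" by (rule assms)
  also have "\<dots> \<doteq> g x + g y" using assms(1) by (simp add: lin_mod_def)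
  also have "\<dots> \<doteq> f x + f y" by (intro eqm_add eqm_sym[OF assms(2)])
  finally show "f (x + y) \<doteq> f x + f y" .
next
  fix c x
  have "f (cs c x) \<doteq> g (cs c x)" by (rule assms)
  also have "\<dots> \<doteq> s c (g x)" using assms(1) by (simp add: lin_mod_def)
  also have "\<dots> \<doteq> s c (f x)" by (intro eqm_scale eqm_sym[OF assms(2)])
  finally show "f (cs c x) \<doteq> s c (f x)" .
qed

lemma lin_mod_apply:
  assumes "lin_mod g" "additive h" "\<And>p. p \<in> N \<Longrightarrow> h p \<in> N" "\<And>c p. h (s c p) \<doteq> s c (h p)"
  shows "lin_mod (\<lambda>x. h (g x))"
  unfolding lin_mod_def
proof (intro conjI allI)
  note h = eqm_additive[OF assms(2,3)]
  show "h (g (x + y)) \<doteq> h (g x) + h (g y)" for x y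
    using h[of "g (x + y)" "g x + g y"] assms(1) by (simp add: lin_mod_def additive.add[OF assms(2)])
  show "h (g (cs c x)) \<doteq> s c (h (g x))" for c x
    using eqm_trans[OF h[of "g (cs c x)" "s c (g x)"] assms(4)] assms(1) by (simp add: lin_mod_def)
qed

lemma lin_mod_add: "lin_mod f \<Longrightarrow> lin_mod g \<Longrightarrow> lin_mod (\<lambda>x. f x + g x)"
  unfolding lin_mod_def
  using eqm_add[of "f (_ + _)" "f _ + f _" "g (_ + _)" "g _ + g _"]
    eqm_add[of "f (cs _ _)" "s _ (f _)" "g (cs _ _)" "s _ (g _)"]
  by (simp add: algebra_simps scale_right_distrib)

lemma lin_mod_lin_ext:
  assumes "\<And>b. b \<in> Poly_Mapping.keys p \<Longrightarrow> lin_mod (\<lambda>x. f x b)"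
  shows "lin_mod (\<lambda>x. lin_ext s (f x) p)"
  unfolding lin_mod_def lin_ext_fun_add[symmetric] lin_ext_fun_scale[symmetric]
  using assms by (auto simp: lin_mod_def intro!: lin_ext_eqm)

text \<open>Meant for the counit law, in which x itself is a linear combination formed from its
  comultiplication.\<close>

lemma lin_mod_comult: "lin_mod f \<Longrightarrow> f (lin_ext cs h p) \<doteq> lin_ext s (\<lambda>b. f (h b)) p"
proof -
  assume f: "lin_mod f"
  have vs: "vector_space cs"
    using coalg by (simp add: cocommutative_coalgebra_def)
  interpret cs: vector_space cs by fact
  show ?thesis
  proof (induction p rule: poly_mapping_single_induct)
    case (single b r)
    show ?case using f by (simp add: lin_mod_def)
  next
    case (add p q)
    have "f (lin_ext cs h (p + q)) \<doteq> f (lin_ext cs h p) + f (lin_ext cs h q)"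
      using f by (simp add: lin_mod_def cs.lin_ext_add)
    with eqm_add[OF add] show ?case by (simp add: lin_ext_add) (blast intro: eqm_trans)
  qed
qed

text \<open>The universal property of the tensor power, checked on generators; through
  \<open>multilin_class_eq\<close> it makes Sweedler sums independent of representatives modulo
  N.\<close>

lemma multilin_null:
  assumes "multilin n f" "p \<in> tensor_rels C n"
  shows "lin_ext s f p \<in> N"
  using assms(2) unfolding tensor_rels_def
proof (induction rule: submodule_gen.induct)
  case (base p)
  then consider us u v ws where "length us + 1 + length ws = n"
      "p = Poly_Mapping.single (us @ (u + v) # ws) 1 - Poly_Mapping.single (us @ u # ws) 1
        - Poly_Mapping.single (us @ v # ws) 1"
    | us a u ws where "length us + 1 + length ws = n"
      "p = Poly_Mapping.single (us @ cs a u # ws) 1 - Poly_Mapping.single (us @ u # ws) a"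
    by (auto simp: multilinear_rels_def)
  then show ?case
  proof cases
    case 1
    with assms(1) have "f (us @ (u + v) # ws) \<doteq> f (us @ u # ws) + f (us @ v # ws)"
      by (simp add: multilin_def lin_mod_def)
    then show ?thesis by (simp add: 1 lin_ext_diff lin_ext_add eqm_def diff_diff_eq)
  next
    case 2
    with assms(1) have "f (us @ cs a u # ws) \<doteq> s a (f (us @ u # ws))"
      by (simp add: multilin_def lin_mod_def)
    then show ?thesis by (simp add: 2 lin_ext_diff eqm_def)
  qed
qed (simp_all add: lin_ext_add lin_ext_free_scale add_mem scale_mem)

lemma multilin_class_eq:
  "multilin n f \<Longrightarrow> tensor_class C n p = tensor_class C n q \<Longrightarrow> lin_ext s f p \<doteq> lin_ext s f q"
  using multilin_null[OF _ tensor_class_eqD] by (simp add: eqm_def lin_ext_diff)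

lemma sw_eqm: "(\<And>a b. f a b \<doteq> g a b) \<Longrightarrow> sw x f \<doteq> sw x g"
  unfolding sw_def by (rule lin_ext_eqm)

lemma sw_add: "sw x (\<lambda>a b. f a b + g a b) = sw x f + sw x g"
  by (simp add: sw_def lin_ext_fun_add)

lemma sw_diff: "sw x (\<lambda>a b. f a b - g a b) = sw x f - sw x g"
  by (simp add: sw_def lin_ext_fun_diff)

lemma sw_minus: "sw x (\<lambda>a b. - f a b) = - sw x f"
  using sw_diff[of x "\<lambda>a b. 0" f] by (simp add: sw_def lin_ext_def)

lemma sw_mem: "(\<And>a b. f a b \<in> N) \<Longrightarrow> sw x f \<in> N"
  unfolding sw_def lin_ext_def by (intro sum_mem scale_mem)

lemma sw_apply:
  assumes "additive h" "\<And>c p. h (s c p) = s c (h p)"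
  shows "h (sw x f) = sw x (\<lambda>a b. h (f a b))"
  unfolding sw_def by (rule lin_ext_apply[OF assms])

lemma lin_mod_sw: "(\<And>a b. lin_mod (\<lambda>y. f y a b)) \<Longrightarrow> lin_mod (\<lambda>y. sw x (f y))"
  unfolding sw_def by (rule lin_mod_lin_ext)

lemma multilin_two: "bilin f \<Longrightarrow> multilin 2 (\<lambda>xs. f (xs ! 0) (xs ! 1))"
  unfolding multilin_def
proof (intro allI impI)
  fix us ws :: "'c list"
  assume *: "bilin f" "length us + 1 + length ws = 2"
  then consider w where "us = []" "ws = [w]" | w where "us = [w]" "ws = []"
    by (cases us; cases ws) auto
  then show "lin_mod (\<lambda>u. f ((us @ u # ws) ! 0) ((us @ u # ws) ! 1))"
    by cases (use * in \<open>simp_all add: bilin_def\<close>)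
qed

lemma multilin_three: "trilin f \<Longrightarrow> multilin 3 (\<lambda>xs. f (xs ! 0) (xs ! 1) (xs ! 2))"
  unfolding multilin_def
proof (intro allI impI)
  fix us ws :: "'c list"
  assume *: "trilin f" "length us + 1 + length ws = 3"
  then have "length us = 0 \<and> length ws = 2 \<or> length us = 1 \<and> length ws = 1 \<or>
      length us = 2 \<and> length ws = 0"
    by arith
  then consider w w' where "us = []" "ws = [w, w']" | w w' where "us = [w]" "ws = [w']"
    | w w' where "us = [w, w']" "ws = []"
    by (auto simp: numeral_2_eq_2 length_Suc_conv)
  then show "lin_mod (\<lambda>u. f ((us @ u # ws) ! 0) ((us @ u # ws) ! 1) ((us @ u # ws) ! 2))"
    by cases (use * in \<open>simp_all add: trilin_def bilin_def\<close>)
qed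

text \<open>The chosen representatives need not depend linearly on x; only their classes do, and a
  bilinear f sees only the class modulo N.\<close>

lemma lin_mod_sw_left: "bilin f \<Longrightarrow> lin_mod (\<lambda>x. sw x f)"
  unfolding lin_mod_def
proof (intro conjI allI)
  assume f: "bilin f"
  fix x y c
  have "tensor_class C 2 (comult_rep C (x + y)) = tensor_class C 2 (comult_rep C x + comult_rep C y)"
    using coalg by (simp flip: comult_rep_class tensor_class_add add: cocommutative_coalgebra_def)
  from multilin_class_eq[OF multilin_two[OF f] this]
  show "sw (x + y) f \<doteq> sw x f + sw y f" by (simp add: sw_def lin_ext_add)
  have "tensor_class C 2 (comult_rep C (cs c x)) = tensor_class C 2 (free_scale c (comult_rep C x))"
    using coalg by (simp flip: comult_rep_class tensor_class_smult add: cocommutative_coalgebra_def)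
  from multilin_class_eq[OF multilin_two[OF f] this]
  show "sw (cs c x) f \<doteq> s c (sw x f)" by (simp add: sw_def lin_ext_free_scale)
qed

lemma sw_cocomm: "bilin f \<Longrightarrow> sw x f \<doteq> sw x (\<lambda>a b. f b a)"
proof -
  assume f: "bilin f"
  have "tensor_class C 2
      (lin_ext free_scale (\<lambda>xs. Poly_Mapping.single [xs ! 1, xs ! 0] 1) (comult_rep C x)) =
      tensor_class C 2 (comult_rep C x)"
    using coalg by (simp flip: comult_rep_class add: cocommutative_coalgebra_def)
  from multilin_class_eq[OF multilin_two[OF f] this]
  show ?thesis by (simp add: sw_def lin_ext_lin_ext eqm_sym)
qed

lemma lin_ext_comult_at:
  "lin_ext s f (comult_at C i p) = lin_ext s (\<lambda>xs.
     lin_ext s (\<lambda>ys. f (take i xs @ ys @ drop (Suc i) xs)) (comult_rep C (xs ! i))) p"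
  by (simp add: comult_at_def lin_ext_lin_ext)

lemma lin_ext_comult_rep:
  "lin_ext s f (comult_rep C x) = sw x (\<lambda>a b. f [a, b])"
  unfolding sw_def
proof (rule lin_ext_cong)
  fix xs assume "xs \<in> Poly_Mapping.keys (comult_rep C x)"
  then have "length xs = 2" by (rule comult_rep_keys)
  then have "xs = [xs ! 0, xs ! 1]" by (auto simp: length_Suc_conv eval_nat_numeral)
  then show "f xs = f [xs ! 0, xs ! 1]" by simp
qed

lemma sw_coassoc:
  assumes "trilin f"
  shows "sw x (\<lambda>a b. sw a (\<lambda>c d. f c d b)) \<doteq> sw x (\<lambda>a b. sw b (f a))"
proof -
  have "tensor_class C 3 (comult_at C 0 (comult_rep C x)) =
      tensor_class C 3 (comult_at C 1 (comult_rep C x))"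
    using coalg by (simp add: cocommutative_coalgebra_def)
  from multilin_class_eq[OF multilin_three[OF assms] this]
  show ?thesis by (simp add: lin_ext_comult_at lin_ext_comult_rep)
qed

text \<open>To exchange the first two of three factors, regroup them into one comultiplication,
  apply cocommutativity there, and regroup back. In this form cocommutativity enters
  \<open>fm_free_scale\<close>, \<open>fm_null\<close> and \<open>fm_theta\<close>.\<close>

lemma sw_swap:
  assumes f: "trilin f"
  shows "sw x (\<lambda>y z. sw z (f y)) \<doteq> sw x (\<lambda>y z. sw z (\<lambda>a b. f a y b))"
proof -
  have "sw x (\<lambda>y z. sw z (f y)) \<doteq> sw x (\<lambda>y z. sw y (\<lambda>a b. f a b z))"
    by (rule eqm_sym[OF sw_coassoc[OF f]])
  also have "\<dots> \<doteq> sw x (\<lambda>y z. sw y (\<lambda>a b. f b a z))"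
    using f by (intro sw_eqm sw_cocomm) (auto simp: trilin_def bilin_def)
  also have "\<dots> \<doteq> sw x (\<lambda>y z. sw z (\<lambda>a b. f a y b))"
    using f by (intro sw_coassoc[where f = "\<lambda>a b. f b a"]) (auto simp: trilin_def bilin_def)
  finally show ?thesis .
qed

text \<open>The counit sits on the second factor because \<open>fm_word\<close> lets its last factor
  act on the coefficient, and on 1 this action is the counit.\<close>

lemma sw_counit:
  assumes "lin_mod g"
  shows "sw x (\<lambda>a b. s (counit C b) (g a)) \<doteq> g x"
proof -
  have "g (lin_ext cs (\<lambda>xs. cs (counit C (xs ! 1)) (xs ! 0)) (comult_rep C x)) = g x"
    using coalg by (simp add: cocommutative_coalgebra_def)
  with lin_mod_comult[OF assms, of "\<lambda>xs. cs (counit C (xs ! 1)) (xs ! 0)" "comult_rep C x"]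
  have "g x \<doteq> lin_ext s (\<lambda>xs. g (cs (counit C (xs ! 1)) (xs ! 0))) (comult_rep C x)"
    by simp
  also have "\<dots> \<doteq> sw x (\<lambda>a b. s (counit C b) (g a))"
    unfolding sw_def by (rule lin_ext_eqm) (use assms in \<open>simp add: lin_mod_def\<close>)
  finally show ?thesis by (rule eqm_sym)
qed

section \<open>Iterated comultiplication as a recursion on tuples\<close>

lemma multilinD:
  "multilin n f \<Longrightarrow> length us + 1 + length ws = n \<Longrightarrow> lin_mod (\<lambda>u. f (us @ u # ws))"
  by (simp add: multilin_def)

lemma multilin_Cons: "multilin (Suc n) f \<Longrightarrow> multilin n (\<lambda>xs. f (a # xs))"
  unfolding multilin_def
proof (intro allI impI)
  fix us ws :: "'c list"
  assume "\<forall>us ws. length us + 1 + length ws = Suc n \<longrightarrow> lin_mod (\<lambda>u. f (us @ u # ws))"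
    and "length us + 1 + length ws = n"
  then show "lin_mod (\<lambda>u. f (a # us @ u # ws))"
    by (auto dest: spec[of _ "a # us"])
qed

lemma multilin_hd: "multilin (Suc n) f \<Longrightarrow> length ws = n \<Longrightarrow> lin_mod (\<lambda>a. f (a # ws))"
  using multilinD[of "Suc n" f "[]" ws] by simp

lemma sweedler_two: "sweedler C 2 x = comult_rep C x"
proof -
  have "lin_ext free_scale (\<lambda>ys. Poly_Mapping.single ys 1) p = p" for p :: "'c list \<Rightarrow>\<^sub>0 'k"
    by (induction p rule: poly_mapping_single_induct) (simp_all add: free_scale.lin_ext_add)
  then show ?thesis
    by (simp add: numeral_2_eq_2 comult_at_def)
qed

lemma sweedler_keys: "xs \<in> Poly_Mapping.keys (sweedler C (Suc n) x) \<Longrightarrow> length xs = Suc n"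
proof (induction n arbitrary: xs)
  case (Suc n)
  have *: "xs \<in> Poly_Mapping.keys (lin_ext free_scale f p) \<Longrightarrow>
    \<exists>b\<in>Poly_Mapping.keys p. xs \<in> Poly_Mapping.keys (f b)"
    for f :: "'c list \<Rightarrow> ('c list \<Rightarrow>\<^sub>0 'k)" and xs p
    unfolding lin_ext_def
    by (drule set_mp[OF Poly_Mapping.keys_sum]) (use keys_free_scale in fastforce)
  from Suc.prems obtain us vs where "us \<in> Poly_Mapping.keys (sweedler C (Suc n) x)"
    "vs \<in> Poly_Mapping.keys (comult_rep C (us ! 0))" "xs = vs @ drop 1 us"
    by (auto simp: comult_at_def dest!: * split: if_splits)
  then show ?case
    using Suc.IH[of us] comult_rep_keys[of vs] by simp
qed simp

text \<open>\<^const>\<open>sweedler\<close> splits the first tensor factor; the recursion on words splits the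
  remaining ones.\<close>

lemma lin_mod_lin_ext_sweedler: "multilin (Suc n) f \<Longrightarrow> lin_mod (\<lambda>x. lin_ext s f (sweedler C (Suc n) x))"
  and lin_ext_sweedler: "multilin (Suc (Suc n)) f \<Longrightarrow> lin_ext s f (sweedler C (Suc (Suc n)) x) \<doteq>
    sw x (\<lambda>y z. lin_ext s (\<lambda>zs. f (y # zs)) (sweedler C (Suc n) z))"
proof (induction n arbitrary: f x)
  case 0
  {
    case 1
    then show ?case using multilin_hd[of 0 f "[]"] by simp
  next
    case 2
    show ?case
      by (simp add: lin_ext_comult_at lin_ext_comult_rep)
  }
next
  case (Suc n)
  {
    case 1
    \<comment> \<open>By the second claim the sum is congruent to a \<open>sw\<close> of a bilinear
      map, so its linearity is that of the comultiplication. The second claim in turn uses the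
      first, hence the joint induction.\<close>
    have "bilin (\<lambda>y z. lin_ext s (\<lambda>zs. f (y # zs)) (sweedler C (Suc n) z))"
      unfolding bilin_def
      using Suc(1)[OF multilin_Cons[OF 1]]
      by (auto intro!: lin_mod_lin_ext multilin_hd[OF 1] dest!: sweedler_keys)
    from lin_mod_cong[OF lin_mod_sw_left[OF this] Suc(2)[OF 1]]
    show ?case .
  next
    case 2
    \<comment> \<open>\<open>g\<close> carries out the last splitting of the first factor, so the
      hypothesis applies to tuples one shorter. \<open>h\<close> collects the factors beyond the
      first two, and regrouping \<open>h\<close> by coassociativity finishes the step.\<close>
    define g where "g xs = sw (xs ! 0) (\<lambda>a b. f (a # b # tl xs))" for xs
    define h where "h a b z = lin_ext s (\<lambda>zs. f (a # b # zs)) (sweedler C (Suc n) z)" for a b z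
    have f2: "lin_mod (\<lambda>b. f (a # b # zs))" if "length zs = Suc n" for a zs
      by (rule multilin_hd[OF multilin_Cons[OF 2] that])
    have f1: "lin_mod (\<lambda>a. f (a # b # zs))" if "length zs = Suc n" for b zs
      using multilin_hd[OF 2, of "b # zs"] that by simp
    have "trilin h"
      unfolding trilin_def bilin_def h_def
      by (auto intro!: Suc(1) multilin_Cons 2 lin_mod_lin_ext f1 f2 dest!: sweedler_keys)
    have g: "multilin (Suc (Suc n)) g"
      unfolding multilin_def
    proof (intro allI impI)
      fix us ws :: "'c list"
      assume len: "length us + 1 + length ws = Suc (Suc n)"
      show "lin_mod (\<lambda>u. g (us @ u # ws))"
      proof (cases us)
        case Nil
        then show ?thesis using len f1 f2
          by (auto simp: g_def bilin_def intro!: lin_mod_sw_left)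
      next
        case (Cons v vs)
        have "lin_mod (\<lambda>u. f ((a # b # vs) @ u # ws))" for a b
          using 2 len Cons unfolding multilin_def by (metis Suc_eq_plus1 add_Suc length_Cons)
        then show ?thesis using Cons by (auto simp: g_def intro!: lin_mod_sw)
      qed
    qed
    have "lin_ext s f (sweedler C (Suc (Suc (Suc n))) x) = lin_ext s g (sweedler C (Suc (Suc n)) x)"
      by (subst sweedler.simps(3)) (simp add: lin_ext_comult_at lin_ext_comult_rep g_def[abs_def] drop_Suc
          del: sweedler.simps)
    also have "\<dots> \<doteq> sw x (\<lambda>y z. lin_ext s (\<lambda>zs. g (y # zs)) (sweedler C (Suc n) z))"
      by (rule Suc(2)[OF g])
    also have "\<dots> = sw x (\<lambda>y z. sw y (\<lambda>a b. h a b z))"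
      unfolding g_def h_def sw_def by (subst lin_ext_swap) simp
    also have "\<dots> \<doteq> sw x (\<lambda>y z. sw z (h y))"
      by (rule sw_coassoc) fact
    also have "\<dots> \<doteq> sw x (\<lambda>y z. lin_ext s (\<lambda>zs. f (y # zs)) (sweedler C (Suc (Suc n)) z))"
      unfolding h_def by (intro sw_eqm eqm_sym[OF Suc(2)] multilin_Cons 2)
    finally show ?case .
  }
qed

end

section \<open>The map of complexes induced by a measuring\<close>

context flat_lie_rinehart
begin

lemma vector_space_free_scale: "vector_space (\<lambda>c. free_scale (\<eta> c) :: ('b \<Rightarrow>\<^sub>0 'r) \<Rightarrow> _)"
  by unfold_locales (simp_all add: free_scale_add free_scale_add_left free_scale_mult \<eta>_add \<eta>_mult)

lemma contr_\<eta> [simp]: "contr (\<eta> c) p = 0"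
  by (induction p rule: word_induct) (simp_all add: contr_cons_op contr_add)

lemma br_ls_left_\<eta>: "br (ls (\<eta> c) Z) Y = ls (\<eta> c) (br Z Y)"
  using br_swap[of "ls (\<eta> c) Z" Y] br_swap[of Z Y] ls_add_left[of 0 0 Z]
  by (simp add: br_ls ls_minus_right)

lemma br_ls_right_\<eta>: "br Z (ls (\<eta> c) Y) = ls (\<eta> c) (br Z Y)"
  using ls_add_left[of 0 0 Y] by (simp add: br_ls)

lemma theta_\<eta>: "theta Z (free_scale (\<eta> c) p) = free_scale (\<eta> c) (theta Z p)"
  by (simp add: theta_free_scale)

lemma bd_\<eta>: "bd (free_scale (\<eta> c) p) = free_scale (\<eta> c) (bd p)"
  by (simp add: bd_free_scale)

lemma theta_ls_\<eta>: "theta (ls (\<eta> c) Z) p \<doteq> free_scale (\<eta> c) (theta Z p)"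
  using theta_ls[of "\<eta> c" Z p] by (simp add: theta_\<eta>)

lemma cons_op_ls_\<eta>: "cons_op (ls (\<eta> c) Z) p \<doteq> free_scale (\<eta> c) (cons_op Z p)"
  using cons_op_ls[of "\<eta> c" Z p] by (simp add: free_scale_cons_op)

end

locale lie_rinehart_measuring =
  L: flat_lie_rinehart A + L': flat_lie_rinehart A'
  for A :: "('k::field_char_0, 'r::{comm_ring,comm_monoid_mult}, 'l::ab_group_add) lie_rinehart"
    and A' :: "('k, 's::{comm_ring,comm_monoid_mult}, 'm::ab_group_add) lie_rinehart" +
  fixes C :: "('k, 'c::ab_group_add) coalg" and \<Psi> :: "'c \<Rightarrow> 'l \<Rightarrow> 'm" and \<psi> :: "'c \<Rightarrow> 'r \<Rightarrow> 's"
  assumes coalgebra: "cocommutative_coalgebra C"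
    and measuring: "lr_measuring C A A' \<Psi> \<psi>"
begin

abbreviation sc :: "'k \<Rightarrow> ('m list \<Rightarrow>\<^sub>0 's) \<Rightarrow> ('m list \<Rightarrow>\<^sub>0 's)" where
  "sc c \<equiv> free_scale (L'.\<eta> c)"

sublocale sweedler_sums sc L'.ext_null C
proof (intro sweedler_sums.intro L'.vector_space_free_scale sweedler_sums_axioms.intro)
  show "add_subgroup L'.ext_null" ..
qed (use coalgebra L'.null_free_scale in auto)

notation L'.E.eqm (infix "\<doteq>" 50)

sublocale R': vector_space "rscale A'"
  by (rule L'.vector_space_rscale)

sublocale M': vector_space "lkscale A'"
  by (rule L'.vector_space_lkscale)

lemma \<Psi>_add_left: "\<Psi> (x + y) Z = \<Psi> x Z + \<Psi> y Z"
  and \<Psi>_scale_left: "\<Psi> (cs c x) Z = L'.ls (L'.\<eta> c) (\<Psi> x Z)"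
  and \<Psi>_add: "\<Psi> x (Z + Z') = \<Psi> x Z + \<Psi> x Z'"
  and \<psi>_add_left: "\<psi> (x + y) r = \<psi> x r + \<psi> y r"
  and \<psi>_scale_left: "\<psi> (cs c x) r = L'.\<eta> c * \<psi> x r"
  and \<psi>_add: "\<psi> x (r + r') = \<psi> x r + \<psi> x r'"
  and \<psi>_one: "\<psi> x 1 = L'.\<eta> (counit C x)"
  using measuring
  by (simp_all add: lr_measuring_def Vector_Spaces.linear_iff lkscale_def L'.rscale_eq)

lemma \<psi>_mult: "\<psi> x (r * r') =
    lin_ext (rscale A') (\<lambda>xs. \<psi> (xs ! 0) r * \<psi> (xs ! 1) r') (comult_rep C x)"
  and \<psi>_nb: "\<psi> x (L.nb Z r) =
    lin_ext (rscale A') (\<lambda>xs. L'.nb (\<Psi> (xs ! 0) Z) (\<psi> (xs ! 1) r)) (comult_rep C x)"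
  and \<Psi>_br: "\<Psi> x (L.br Z Z') =
    lin_ext (lkscale A') (\<lambda>xs. L'.br (\<Psi> (xs ! 0) Z) (\<Psi> (xs ! 1) Z')) (comult_rep C x)"
  and \<Psi>_ls: "\<Psi> x (L.ls r Z) =
    lin_ext (lkscale A') (\<lambda>xs. L'.ls (\<psi> (xs ! 0) r) (\<Psi> (xs ! 1) Z)) (comult_rep C x)"
  using measuring unfolding lr_measuring_def sweedler_two by blast+

lemma single_lin_ext:
  "Poly_Mapping.single [] (lin_ext (rscale A') f t) = lin_ext sc (\<lambda>b. Poly_Mapping.single [] (f b)) t"
  by (rule R'.lin_ext_apply) (simp_all add: additive_single L'.rscale_eq)

text \<open>For the measuring axioms on brackets and R-multiples, which replace a letter by a
  Sweedler sum: the sum can be taken out of the letter modulo relations.\<close>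

lemma cons_op_lin_ext:
  "cons_op (lin_ext (lkscale A') f t) p \<doteq> lin_ext sc (\<lambda>b. cons_op (f b) p) t"
proof (induction t rule: poly_mapping_single_induct)
  case (single b r)
  show ?case using L'.cons_op_ls_\<eta>[of r "f b" p] by (simp flip: L'.lkscale_eq)
next
  case (add t u)
  from L'.E.eqm_trans[OF L'.cons_op_add_left L'.E.eqm_add[OF add]]
  show ?case by (simp add: lin_ext_add M'.lin_ext_add)
qed

subsection \<open>Multilinearity\<close>

lemma lin_mod_cons_op_left: "lin_mod (\<lambda>y. cons_op (\<Psi> y Z) p)"
  by (simp add: lin_mod_def \<Psi>_add_left \<Psi>_scale_left L'.cons_op_add_left L'.cons_op_ls_\<eta>)

lemma lin_mod_cons_op: "lin_mod h \<Longrightarrow> lin_mod (\<lambda>y. cons_op Z (h y))"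
  by (rule lin_mod_apply[OF _ additive_cons_op])
    (simp_all add: L'.null_cons free_scale_cons_op)

lemma lin_mod_theta_left: "lin_mod (\<lambda>y. L'.theta (\<Psi> y Z) p)"
  by (simp add: lin_mod_def \<Psi>_add_left \<Psi>_scale_left L'.theta_add_left L'.theta_ls_\<eta>)

lemma lin_mod_theta: "lin_mod h \<Longrightarrow> lin_mod (\<lambda>y. L'.theta Z (h y))"
  by (rule lin_mod_apply[OF _ L'.additive_theta]) (simp_all add: L'.theta_null L'.theta_\<eta>)

lemma lin_mod_free_scale_left: "lin_mod (\<lambda>y. free_scale (\<psi> y a) p)"
  by (simp add: lin_mod_def \<psi>_add_left \<psi>_scale_left free_scale_add_left free_scale_mult)

lemma free_scale_commute: "free_scale a (free_scale b p) = free_scale b (free_scale a p)"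
  for p :: "'b \<Rightarrow>\<^sub>0 's"
  by (simp add: mult.commute flip: free_scale_mult)

lemma lin_mod_free_scale: "lin_mod h \<Longrightarrow> lin_mod (\<lambda>y. free_scale a (h y))"
  by (rule lin_mod_apply[OF _ additive_free_scale])
    (simp_all add: L'.null_free_scale free_scale_commute)

lemma lin_mod_cons_op_br:
  "lin_mod (\<lambda>y. cons_op (L'.br (\<Psi> y Z) Y) p)" "lin_mod (\<lambda>y. cons_op (L'.br Y (\<Psi> y Z)) p)"
  by (simp_all add: lin_mod_def \<Psi>_add_left \<Psi>_scale_left L'.br_add_left L'.br_add L'.cons_op_add_left
      L'.br_ls_left_\<eta> L'.br_ls_right_\<eta> L'.cons_op_ls_\<eta>)

lemmas lin_mod_intros = lin_mod_cons_op_left lin_mod_cons_op lin_mod_theta_left lin_mod_theta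
  lin_mod_free_scale_left lin_mod_free_scale lin_mod_cons_op_br lin_mod_sw

subsection \<open>The action on words\<close>

text \<open>The last factor of x acts on the coefficient, so a word of length n takes n + 1 factors.
  Degree 0 is thereby the start of the same recursion; \<open>fm_word_sweedler\<close> removes the
  additional factor when the coefficient is 1.\<close>

primrec fm_word :: "'l list \<Rightarrow> 'r \<Rightarrow> 'c \<Rightarrow> ('m list \<Rightarrow>\<^sub>0 's)" where
  "fm_word [] r x = Poly_Mapping.single [] (\<psi> x r)"
| "fm_word (Z # Zs) r x = sw x (\<lambda>y z. cons_op (\<Psi> y Z) (fm_word Zs r z))"

definition fm :: "'c \<Rightarrow> ('l list \<Rightarrow>\<^sub>0 'r) \<Rightarrow> ('m list \<Rightarrow>\<^sub>0 's)" where
  "fm x = add_ext (\<lambda>Zs r. fm_word Zs r x)"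

lemma additive_fm_word: "additive (\<lambda>r. fm_word Zs r x)"
  by (induction Zs arbitrary: x)
    (simp_all add: additive_def \<psi>_add single_add cons_op_add sw_add)

lemma additive_fm: "additive (fm x)"
  unfolding fm_def by (intro additive_add_ext additive_fm_word)

lemmas fm_add = additive.add[OF additive_fm]
lemmas fm_diff = additive.diff[OF additive_fm]
lemmas fm_zero [simp] = additive.zero[OF additive_fm]

lemma fm_single: "fm x (Poly_Mapping.single Zs r) = fm_word Zs r x"
  by (simp add: fm_def additive.zero[OF additive_fm_word])

lemma fm_Nil [simp]: "fm x (Poly_Mapping.single [] r) = Poly_Mapping.single [] (\<psi> x r)"
  by (simp add: fm_single)

lemma fm_cons_op: "fm x (cons_op Z p) = sw x (\<lambda>y z. cons_op (\<Psi> y Z) (fm z p))"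
  by (induction p rule: poly_mapping_single_induct)
    (simp_all add: fm_single fm_add cons_op_add sw_add)

lemma lin_mod_fm: "lin_mod (\<lambda>x. fm x p)"
proof (induction p rule: word_induct)
  case (Nil r)
  show ?case by (simp add: lin_mod_def \<psi>_add_left \<psi>_scale_left single_add)
next
  case (Cons Z p)
  then have "bilin (\<lambda>y z. cons_op (\<Psi> y Z) (fm z p))"
    by (simp add: bilin_def lin_mod_intros)
  then show ?case by (simp add: fm_cons_op lin_mod_sw_left)
next
  case (add p q)
  then show ?case by (simp add: fm_add lin_mod_add)
qed

lemma cons_op_sw: "cons_op Z (sw x f) = sw x (\<lambda>a b. cons_op Z (f a b))"
  by (rule sw_apply[OF additive_cons_op]) (simp add: free_scale_cons_op)

lemma theta_sw: "L'.theta Z (sw x f) = sw x (\<lambda>a b. L'.theta Z (f a b))"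
  by (rule sw_apply[OF L'.additive_theta]) (simp add: L'.theta_\<eta>)

lemma bd_sw: "L'.bd (sw x f) = sw x (\<lambda>a b. L'.bd (f a b))"
  by (rule sw_apply[OF L'.additive_bd]) (simp add: L'.bd_\<eta>)

lemma free_scale_sw: "free_scale a (sw x f) = sw x (\<lambda>c d. free_scale a (f c d))"
  by (rule sw_apply[OF additive_free_scale]) (rule free_scale_commute)

lemma cons_op_eqm: "p \<doteq> q \<Longrightarrow> cons_op Z p \<doteq> cons_op Z q"
  by (rule L'.E.eqm_additive[OF additive_cons_op L'.null_cons])

text \<open>The recursion reaches the coefficient last, so the factor acting on a must be moved
  forward past the factors acting on letters; \<open>sw_swap\<close> does this one letter at a time.
  The empty word is multiplicativity of \<open>\<psi>\<close>.\<close>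

lemma fm_free_scale: "fm x (free_scale a p) \<doteq> sw x (\<lambda>y z. free_scale (\<psi> y a) (fm z p))"
proof (induction p arbitrary: x rule: word_induct)
  case (Nil r)
  show ?case by (simp add: \<psi>_mult single_lin_ext sw_def)
next
  case (Cons Z p)
  let ?f = "\<lambda>y c d. cons_op (\<Psi> y Z) (free_scale (\<psi> c a) (fm d p))"
  have "fm x (free_scale a (cons_op Z p)) = sw x (\<lambda>y z. cons_op (\<Psi> y Z) (fm z (free_scale a p)))"
    by (simp add: free_scale_cons_op fm_cons_op)
  also have "\<dots> \<doteq> sw x (\<lambda>y z. cons_op (\<Psi> y Z) (sw z (\<lambda>c d. free_scale (\<psi> c a) (fm d p))))"
    by (intro sw_eqm cons_op_eqm Cons)
  also have "\<dots> = sw x (\<lambda>y z. sw z (?f y))"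
    by (simp add: cons_op_sw)
  also have "\<dots> \<doteq> sw x (\<lambda>y z. sw z (\<lambda>c d. ?f c y d))"
    by (rule sw_swap) (simp add: trilin_def bilin_def lin_mod_intros lin_mod_fm)
  also have "\<dots> = sw x (\<lambda>y z. free_scale (\<psi> y a) (fm z (cons_op Z p)))"
    by (simp add: fm_cons_op free_scale_sw free_scale_cons_op)
  finally show ?case .
next
  case (add p q)
  from L'.E.eqm_add[OF add] show ?case
    by (simp add: free_scale_add fm_add sw_add)
qed

text \<open>In the alternating case, cocommutativity makes the image equal to its own negative.\<close>

lemma fm_null: "p \<in> L.ext_null \<Longrightarrow> fm x p \<in> L'.ext_null"
proof (induction arbitrary: x rule: L.ext_null.induct)
  case (null_diff p q)
  then show ?case by (simp add: fm_diff L'.null_diff)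
next
  case (null_cons p Z)
  then show ?case unfolding fm_cons_op by (intro sw_mem L'.null_cons)
next
  case (null_add u v q)
  have "fm x (cons_op (u + v) q - cons_op u q - cons_op v q) =
    sw x (\<lambda>y z. cons_op (\<Psi> y u + \<Psi> y v) (fm z q) - cons_op (\<Psi> y u) (fm z q) - cons_op (\<Psi> y v) (fm z q))"
    by (simp add: fm_diff fm_cons_op sw_diff \<Psi>_add)
  also have "\<dots> \<in> L'.ext_null"
    by (intro sw_mem L'.null_add)
  finally show ?case .
next
  case (null_scale a u q)
  let ?f = "\<lambda>c d z. cons_op (\<Psi> d u) (free_scale (\<psi> c a) (fm z q))"
  \<comment> \<open>The axiom on R-multiples splits the factor that acts on the first letter.
    Regrouping exposes the factor acting on a in front, where \<open>fm_free_scale\<close>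
    recognises it.\<close>
  have "fm x (cons_op (L.ls a u) q) \<doteq> sw x (\<lambda>y z. sw y (\<lambda>c d. cons_op (L'.ls (\<psi> c a) (\<Psi> d u)) (fm z q)))"
    unfolding fm_cons_op \<Psi>_ls sw_def[of _ "\<lambda>c d. cons_op (L'.ls (\<psi> c a) (\<Psi> d u)) (fm _ q)"]
    by (intro sw_eqm cons_op_lin_ext)
  also have "\<dots> \<doteq> sw x (\<lambda>y z. sw y (\<lambda>c d. ?f c d z))"
    by (intro sw_eqm L'.cons_op_ls)
  also have "\<dots> \<doteq> sw x (\<lambda>y z. sw z (?f y))"
    by (rule sw_coassoc) (simp add: trilin_def bilin_def lin_mod_intros lin_mod_fm)
  also have "\<dots> = sw x (\<lambda>y z. free_scale (\<psi> y a) (fm z (cons_op u q)))"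
    by (simp add: fm_cons_op free_scale_sw free_scale_cons_op)
  also have "\<dots> \<doteq> fm x (cons_op u (free_scale a q))"
    using fm_free_scale[of x a "cons_op u q"] by (simp add: L'.E.eqm_sym free_scale_cons_op)
  finally show ?case by (simp add: L'.E.eqm_def fm_diff)
next
  case (null_alt u q)
  let ?f = "\<lambda>y a b. cons_op (\<Psi> y u) (cons_op (\<Psi> a u) (fm b q))"
  let ?g = "fm x (cons_op u (cons_op u q))"
  have g: "?g = sw x (\<lambda>y z. sw z (?f y))"
    by (simp add: fm_cons_op cons_op_sw)
  also have "\<dots> \<doteq> sw x (\<lambda>y z. sw z (\<lambda>a b. ?f a y b))"
    by (rule sw_swap) (simp add: trilin_def bilin_def lin_mod_intros lin_mod_fm)
  also have "\<dots> \<doteq> sw x (\<lambda>y z. sw z (\<lambda>a b. - ?f y a b))"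
    by (intro sw_eqm L'.cons_op_swap)
  also have "\<dots> = - ?g"
    by (simp add: g sw_minus)
  finally have "?g + ?g \<in> L'.ext_null"
    by (simp add: L'.E.eqm_def)
  then have "sc (1 / 2) (?g + ?g) \<in> L'.ext_null"
    by (rule L'.null_free_scale)
  also have "sc (1 / 2) (?g + ?g) = sc (1 / 2 + 1 / 2) ?g"
    by (simp only: free_scale_add L'.\<eta>_add free_scale_add_left)
  finally show ?case by simp
qed simp

text \<open>For a first letter Y, the term with Y kept in front has the factors of Y and Z in the
  wrong order and takes \<open>sw_swap\<close>; the bracket letter carries both factors and takes
  only \<open>sw_coassoc\<close>. The empty word is compatibility with the connections.\<close>

lemma fm_theta: "fm x (L.theta Z p) \<doteq> sw x (\<lambda>y z. L'.theta (\<Psi> y Z) (fm z p))"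
proof (induction p arbitrary: x rule: word_induct)
  case (Nil r)
  show ?case by (simp add: \<psi>_nb single_lin_ext sw_def)
next
  case (Cons Y p)
  let ?f = "\<lambda>y a b. cons_op (\<Psi> y Y) (L'.theta (\<Psi> a Z) (fm b p))"
  let ?g = "\<lambda>y a b. cons_op (L'.br (\<Psi> y Z) (\<Psi> a Y)) (fm b p)"
  have "fm x (cons_op Y (L.theta Z p)) = sw x (\<lambda>y z. cons_op (\<Psi> y Y) (fm z (L.theta Z p)))"
    by (simp add: fm_cons_op)
  also have "\<dots> \<doteq> sw x (\<lambda>y z. cons_op (\<Psi> y Y) (sw z (\<lambda>a b. L'.theta (\<Psi> a Z) (fm b p))))"
    by (intro sw_eqm cons_op_eqm Cons)
  also have "\<dots> = sw x (\<lambda>y z. sw z (?f y))"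
    by (simp add: cons_op_sw)
  also have "\<dots> \<doteq> sw x (\<lambda>y z. sw z (\<lambda>a b. ?f a y b))"
    by (rule sw_swap) (simp add: trilin_def bilin_def lin_mod_intros lin_mod_fm)
  finally have 1: "fm x (cons_op Y (L.theta Z p)) \<doteq> sw x (\<lambda>y z. sw z (\<lambda>a b. ?f a y b))" .
  have "fm x (cons_op (L.br Z Y) p) \<doteq> sw x (\<lambda>y z. sw y (\<lambda>a b. ?g a b z))"
    unfolding fm_cons_op \<Psi>_br sw_def[of _ "\<lambda>a b. cons_op (L'.br (\<Psi> a Z) (\<Psi> b Y)) (fm _ p)"]
    by (intro sw_eqm cons_op_lin_ext)
  also have "\<dots> \<doteq> sw x (\<lambda>y z. sw z (?g y))"
    by (rule sw_coassoc) (simp add: trilin_def bilin_def lin_mod_intros lin_mod_fm)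
  finally have 2: "fm x (cons_op (L.br Z Y) p) \<doteq> sw x (\<lambda>y z. sw z (?g y))" .
  from L'.E.eqm_diff[OF 1 2] show ?case
    by (simp add: L.theta_cons_op fm_diff) (simp add: fm_cons_op theta_sw L'.theta_cons_op sw_diff)
next
  case (add p q)
  from L'.E.eqm_add[OF add] show ?case
    by (simp add: L.theta_add L'.theta_add fm_add sw_add)
qed

lemma fm_bd: "fm x (L.bd p) \<doteq> L'.bd (fm x p)"
proof (induction p arbitrary: x rule: word_induct)
  case (Cons Z p)
  have "sw x (\<lambda>y z. cons_op (\<Psi> y Z) (fm z (L.bd p))) \<doteq> sw x (\<lambda>y z. cons_op (\<Psi> y Z) (L'.bd (fm z p)))"
    by (intro sw_eqm cons_op_eqm Cons)
  from L'.E.eqm_diff[OF fm_theta[of x Z p] this] show ?case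
    by (simp add: L.bd_cons_op fm_diff) (simp add: fm_cons_op bd_sw L'.bd_cons_op sw_diff)
next
  case (add p q)
  from L'.E.eqm_add[OF add] show ?case
    by (simp add: L.bd_add L'.bd_add fm_add)
qed simp

section \<open>Agreement with the Sweedler formula on wedge products\<close>

lemma multilin_map2:
  "multilin (length Zs) (\<lambda>xs. Poly_Mapping.single (map2 \<Psi> xs Zs) 1)"
  unfolding multilin_def
proof (intro allI impI)
  fix us ws :: "'c list"
  assume "length us + 1 + length ws = length Zs"
  then show "lin_mod (\<lambda>u. Poly_Mapping.single (map2 \<Psi> (us @ u # ws) Zs) 1)"
  proof (induction us arbitrary: Zs)
    case Nil
    then obtain Y Ys where "Zs = Y # Ys" by (cases Zs) auto
    then show ?case
      using lin_mod_cons_op_left[of Y "Poly_Mapping.single (map2 \<Psi> ws Ys) 1"] by simp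
  next
    case (Cons v us)
    then obtain Y Ys where Zs: "Zs = Y # Ys" by (cases Zs) auto
    with Cons have "lin_mod (\<lambda>u. Poly_Mapping.single (map2 \<Psi> (us @ u # ws) Ys) 1)"
      by simp
    from lin_mod_cons_op[OF this, of "\<Psi> v Y"] show ?case by (simp add: Zs)
  qed
qed

lemma fm_word_sweedler:
  "Zs \<noteq> [] \<Longrightarrow> fm x (Poly_Mapping.single Zs 1) \<doteq>
    lin_ext sc (\<lambda>xs. Poly_Mapping.single (map2 \<Psi> xs Zs) 1) (sweedler C (length Zs) x)"
proof (induction Zs arbitrary: x)
  case (Cons Z Zs)
  show ?case
  proof (cases Zs)
    case Nil
    \<comment> \<open>The second factor meets the coefficient 1 and turns into its counit, which
      leaves one factor for one letter.\<close>
    have "lin_mod (\<lambda>y. Poly_Mapping.single [\<Psi> y Z] 1)"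
      using lin_mod_cons_op_left[of Z "Poly_Mapping.single [] 1"] by simp
    from sw_counit[OF this, of x] show ?thesis
      by (simp add: Nil fm_single \<psi>_one)
  next
    case (Cons Y Ys)
    let ?F = "\<lambda>Zs xs. Poly_Mapping.single (map2 \<Psi> xs Zs) (1::'s)"
    have ne: "Zs \<noteq> []" and len: "length (Z # Zs) = Suc (Suc (length Ys))"
      using Cons by simp_all
    have "fm x (Poly_Mapping.single (Z # Zs) 1) = sw x (\<lambda>y z. cons_op (\<Psi> y Z) (fm z (Poly_Mapping.single Zs 1)))"
      by (simp flip: fm_cons_op)
    also have "\<dots> \<doteq> sw x (\<lambda>y z. cons_op (\<Psi> y Z) (lin_ext sc (?F Zs) (sweedler C (length Zs) z)))"
      by (intro sw_eqm cons_op_eqm Cons.IH ne)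
    also have "\<dots> = sw x (\<lambda>y z. lin_ext sc (\<lambda>zs. ?F (Z # Zs) (y # zs)) (sweedler C (length Zs) z))"
      by (subst lin_ext_apply[OF additive_cons_op]) (simp_all add: free_scale_cons_op)
    also have "\<dots> \<doteq> lin_ext sc (?F (Z # Zs)) (sweedler C (length (Z # Zs)) x)"
      using lin_ext_sweedler[of "length Ys" "?F (Z # Zs)" x] multilin_map2[of "Z # Zs"]
      by (simp only: len) (simp add: Cons L'.E.eqm_sym del: sweedler.simps)
    finally show ?thesis .
  qed
qed simp

end

section \<open>Homogeneous elements and the exterior powers\<close>

definition homog :: "nat \<Rightarrow> ('l list \<Rightarrow>\<^sub>0 'r::zero) set" where
  "homog n = {p. \<forall>us\<in>Poly_Mapping.keys p. length us = n}"

lemma homog_single: "length us = n \<Longrightarrow> Poly_Mapping.single us r \<in> homog n"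
  by (simp add: homog_def)

lemma homog_zero [simp]: "0 \<in> homog n"
  by (simp add: homog_def)

lemma homog_add: "p \<in> homog n \<Longrightarrow> q \<in> homog n \<Longrightarrow> p + q \<in> homog n"
  using Poly_Mapping.keys_add[of p q] by (auto simp: homog_def)

lemma homog_diff: "p \<in> homog n \<Longrightarrow> q \<in> homog n \<Longrightarrow> p - q \<in> homog n"
  for p q :: "'l list \<Rightarrow>\<^sub>0 'r::ab_group_add"
  by (auto simp: homog_def in_keys_iff lookup_minus)

lemma homog_sum: "(\<And>i. i \<in> I \<Longrightarrow> f i \<in> homog n) \<Longrightarrow> sum f I \<in> homog n"
  by (induction I rule: infinite_finite_induct) (auto intro: homog_add)

lemma homog_free_scale: "p \<in> homog n \<Longrightarrow> free_scale a p \<in> homog n"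
  using keys_free_scale[of a p] by (auto simp: homog_def)

text \<open>The projection that turns membership in the ungraded \<open>ext_null\<close> into
  membership in a single \<open>ext_rels A n\<close>.\<close>

definition homog_part :: "nat \<Rightarrow> ('l list \<Rightarrow>\<^sub>0 'r::ab_group_add) \<Rightarrow> ('l list \<Rightarrow>\<^sub>0 'r)" where
  "homog_part n = add_ext (\<lambda>us r. if length us = n then Poly_Mapping.single us r else 0)"

lemma additive_homog_part: "additive (homog_part n)"
  unfolding homog_part_def by (intro additive_add_ext) (simp add: additive_def single_add)

lemmas homog_part_add = additive.add[OF additive_homog_part]
lemmas homog_part_diff = additive.diff[OF additive_homog_part]
lemmas homog_part_zero [simp] = additive.zero[OF additive_homog_part]

lemma homog_part_single [simp]:
  "homog_part n (Poly_Mapping.single us r) = (if length us = n then Poly_Mapping.single us r else 0)"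
  by (simp add: homog_part_def)

lemma homog_part_homog: "p \<in> homog n \<Longrightarrow> homog_part n p = p"
proof -
  assume p: "p \<in> homog n"
  have "add_ext Poly_Mapping.single q = q" for q :: "'a list \<Rightarrow>\<^sub>0 'b"
    by (induction q rule: poly_mapping_single_induct)
      (simp_all add: additive.add[OF additive_add_ext] additive_single)
  moreover have "homog_part n p = add_ext Poly_Mapping.single p"
    using p by (simp add: homog_part_def add_ext_def homog_def)
  ultimately show ?thesis by simp
qed

lemma homog_part_in_homog: "homog_part n p \<in> homog n"
  by (induction p rule: poly_mapping_single_induct)
    (simp_all add: homog_single homog_part_add homog_add)

text \<open>Obtained from unrestricted induction on q applied to \<open>homog_part n q\<close>,
  which keeps all summands in degree n.\<close>

lemma homog_induct [consumes 1, case_names zero single add]: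
  fixes p :: "'l list \<Rightarrow>\<^sub>0 'r::ab_group_add"
  assumes "p \<in> homog n" and zero: "P 0"
    and single: "\<And>us r. length us = n \<Longrightarrow> P (Poly_Mapping.single us r)"
    and add: "\<And>p q. p \<in> homog n \<Longrightarrow> q \<in> homog n \<Longrightarrow> P p \<Longrightarrow> P q \<Longrightarrow> P (p + q)"
  shows "P p"
proof -
  have "P (homog_part n q)" for q
    by (induction q rule: poly_mapping_single_induct)
      (auto simp: homog_part_add intro: zero single add homog_part_in_homog)
  then show ?thesis using homog_part_homog[OF assms(1)] by metis
qed

lemma homog_part_cons_op: "homog_part (Suc n) (cons_op Z p) = cons_op Z (homog_part n p)"
  by (induction p rule: poly_mapping_single_induct) (simp_all add: homog_part_add cons_op_add)

lemma homog_part_zero_cons_op: "homog_part 0 (cons_op Z p) = 0"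
  by (induction p rule: poly_mapping_single_induct) (simp_all add: homog_part_add cons_op_add)

lemma homog_part_free_scale: "homog_part n (free_scale a p) = free_scale a (homog_part n p)"
  by (induction p rule: poly_mapping_single_induct) (simp_all add: homog_part_add free_scale_add)

lemma homog_cons_op: "p \<in> homog n \<Longrightarrow> cons_op Z p \<in> homog (Suc n)"
  using homog_part_in_homog[of "Suc n" "cons_op Z p"]
  by (simp add: homog_part_cons_op homog_part_homog)

lemma foldr_cons_op_single:
  "foldr cons_op us (Poly_Mapping.single ws r) = Poly_Mapping.single (us @ ws) r"
  by (induction us) simp_all

lemma additive_foldr_cons_op: "additive (foldr cons_op us)"
  by (induction us) (simp_all add: additive_def cons_op_add)

section \<open>The ungraded relations compared with those in each degree\<close>

context flat_lie_rinehart
begin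

lemma null_foldr: "p \<in> ext_null \<Longrightarrow> foldr cons_op us p \<in> ext_null"
  by (induction us) (simp_all add: null_cons)

text \<open>The first u travels through \<open>vs\<close> by sign changes until it stands next to
  the second; \<open>alternating_rels\<close> allows such a gap.\<close>

lemma null_repeated: "Poly_Mapping.single (u # vs @ u # ws) r \<in> ext_null"
proof (induction vs)
  case Nil
  show ?case using null_alt[of u "Poly_Mapping.single ws r"] by simp
next
  case (Cons v vs)
  have "Poly_Mapping.single (u # v # vs @ u # ws) r \<doteq> - Poly_Mapping.single (v # u # vs @ u # ws) r"
    using cons_op_swap[of u v "Poly_Mapping.single (vs @ u # ws) r"] by simp
  moreover have "- Poly_Mapping.single (v # u # vs @ u # ws) r \<in> ext_null"
    using E.minus_mem[OF null_cons[OF Cons, of v]] by simp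
  ultimately show ?case using E.eqm_mem by simp
qed

lemma ext_rels_subset_null: "ext_rels A n \<subseteq> ext_null \<inter> homog n"
proof
  fix p assume "p \<in> ext_rels A n"
  then show "p \<in> ext_null \<inter> homog n"
    unfolding ext_rels_def
  proof (induction rule: submodule_gen.induct)
    case (base p)
    note foldr_diff = additive.diff[OF additive_foldr_cons_op]
    from base consider us u v ws where "length us + 1 + length ws = n"
        "p = Poly_Mapping.single (us @ (u + v) # ws) 1 - Poly_Mapping.single (us @ u # ws) 1
          - Poly_Mapping.single (us @ v # ws) 1"
      | us a u ws where "length us + 1 + length ws = n"
        "p = Poly_Mapping.single (us @ ls a u # ws) 1 - Poly_Mapping.single (us @ u # ws) a"
      | us u vs ws where "length us + 1 + length vs + 1 + length ws = n"
        "p = Poly_Mapping.single (us @ u # vs @ u # ws) 1"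
      unfolding multilinear_rels_def alternating_rels_def by blast
    then show ?case
    proof cases
      case 1
      with null_foldr[OF null_add[of u v "Poly_Mapping.single ws 1"], of us] show ?thesis
        by (simp add: foldr_diff foldr_cons_op_single homog_diff homog_single)
    next
      case 2
      with null_foldr[OF null_scale[of a u "Poly_Mapping.single ws 1"], of us] show ?thesis
        by (simp add: foldr_diff foldr_cons_op_single homog_diff homog_single)
    next
      case 3
      with null_foldr[OF null_repeated[of u vs ws 1], of us] show ?thesis
        by (simp add: foldr_cons_op_single homog_single)
    qed
  qed (auto intro: E.add_mem null_free_scale homog_add homog_free_scale)
qed

lemma ext_rels_zero [simp]: "0 \<in> ext_rels A n"
  and ext_rels_add: "p \<in> ext_rels A n \<Longrightarrow> q \<in> ext_rels A n \<Longrightarrow> p + q \<in> ext_rels A n"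
  and ext_rels_free_scale: "p \<in> ext_rels A n \<Longrightarrow> free_scale a p \<in> ext_rels A n"
  unfolding ext_rels_def by (auto intro: submodule_gen.intros)

lemma ext_rels_diff: "p \<in> ext_rels A n \<Longrightarrow> q \<in> ext_rels A n \<Longrightarrow> p - q \<in> ext_rels A n"
  using ext_rels_add[of p n "free_scale (- 1) q"] ext_rels_free_scale[of q n "- 1"]
  by (simp add: free_scale_minus_one)

lemma ext_rels_cons_op: "p \<in> ext_rels A n \<Longrightarrow> cons_op Z p \<in> ext_rels A (Suc n)"
  unfolding ext_rels_def
proof (induction rule: submodule_gen.induct)
  case (base p)
  then consider us u v ws where "length us + 1 + length ws = n"
      "p = Poly_Mapping.single (us @ (u + v) # ws) 1 - Poly_Mapping.single (us @ u # ws) 1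
        - Poly_Mapping.single (us @ v # ws) 1"
    | us a u ws where "length us + 1 + length ws = n"
      "p = Poly_Mapping.single (us @ ls a u # ws) 1 - Poly_Mapping.single (us @ u # ws) a"
    | us u vs ws where "length us + 1 + length vs + 1 + length ws = n"
      "p = Poly_Mapping.single (us @ u # vs @ u # ws) 1"
    unfolding multilinear_rels_def alternating_rels_def by blast
  then have "cons_op Z p \<in> multilinear_rels ls (Suc n) \<union> alternating_rels (Suc n)"
  proof cases
    case 1
    then have "cons_op Z p \<in> multilinear_rels ls (Suc n)"
      unfolding multilinear_rels_def
      by (intro UnI1 CollectI exI[of _ "Z # us"] exI[of _ u] exI[of _ v] exI[of _ ws])
        (simp add: cons_op_diff)
    then show ?thesis by simp
  next
    case 2
    then have "cons_op Z p \<in> multilinear_rels ls (Suc n)"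
      unfolding multilinear_rels_def
      by (intro UnI2 CollectI exI[of _ "Z # us"] exI[of _ a] exI[of _ u] exI[of _ ws])
        (simp add: cons_op_diff)
    then show ?thesis by simp
  next
    case 3
    then have "cons_op Z p \<in> alternating_rels (Suc n)"
      unfolding alternating_rels_def
      by (intro CollectI exI[of _ "Z # us"] exI[of _ u] exI[of _ vs] exI[of _ ws]) simp
    then show ?thesis by simp
  qed
  then show ?case by (rule submodule_gen.base)
qed (auto simp: cons_op_add simp flip: free_scale_cons_op intro: submodule_gen.intros)

text \<open>The generators of \<open>ext_rels\<close> have single words with coefficient 1 as tails;
  scaling and adding yields arbitrary homogeneous tails, as in \<open>ext_null\<close>.\<close>

lemma ext_rels_relations:
  assumes "q \<in> homog n"
  shows "cons_op (u + v) q - cons_op u q - cons_op v q \<in> ext_rels A (Suc n)"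
    and "cons_op (ls a u) q - cons_op u (free_scale a q) \<in> ext_rels A (Suc n)"
    and "cons_op u (cons_op u q) \<in> ext_rels A (Suc (Suc n))"
proof -
  have 1: "Poly_Mapping.single ((u + v) # ws) 1 - Poly_Mapping.single (u # ws) 1
      - Poly_Mapping.single (v # ws) 1 \<in> ext_rels A (Suc n)"
    and 2: "Poly_Mapping.single (ls a u # ws) 1 - Poly_Mapping.single (u # ws) a \<in> ext_rels A (Suc n)"
    and 3: "Poly_Mapping.single (u # u # ws) 1 \<in> ext_rels A (Suc (Suc n))"
    if "length ws = n" for ws
  proof -
    have "Poly_Mapping.single ((u + v) # ws) 1 - Poly_Mapping.single (u # ws) 1
        - Poly_Mapping.single (v # ws) 1 \<in> multilinear_rels ls (Suc n)"
      unfolding multilinear_rels_def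
      by (rule UnI1, rule CollectI, rule exI[of _ "[]"], rule exI[of _ u], rule exI[of _ v],
          rule exI[of _ ws]) (simp add: that)
    then show "Poly_Mapping.single ((u + v) # ws) 1 - Poly_Mapping.single (u # ws) 1
        - Poly_Mapping.single (v # ws) 1 \<in> ext_rels A (Suc n)"
      unfolding ext_rels_def by (intro submodule_gen.base UnI1)
    have "Poly_Mapping.single (ls a u # ws) 1 - Poly_Mapping.single (u # ws) a
        \<in> multilinear_rels ls (Suc n)"
      unfolding multilinear_rels_def
      by (rule UnI2, rule CollectI, rule exI[of _ "[]"], rule exI[of _ a], rule exI[of _ u],
          rule exI[of _ ws]) (simp add: that)
    then show "Poly_Mapping.single (ls a u # ws) 1 - Poly_Mapping.single (u # ws) a
        \<in> ext_rels A (Suc n)"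
      unfolding ext_rels_def by (intro submodule_gen.base UnI1)
    have "Poly_Mapping.single (u # u # ws) 1 \<in> alternating_rels (Suc (Suc n))"
      unfolding alternating_rels_def
      by (rule CollectI, rule exI[of _ "[]"], rule exI[of _ u], rule exI[of _ "[]"],
          rule exI[of _ ws]) (simp add: that)
    then show "Poly_Mapping.single (u # u # ws) 1 \<in> ext_rels A (Suc (Suc n))"
      unfolding ext_rels_def by (intro submodule_gen.base UnI2)
  qed
  show "cons_op (u + v) q - cons_op u q - cons_op v q \<in> ext_rels A (Suc n)"
    using assms
  proof (induction rule: homog_induct)
    case (single ws r)
    from ext_rels_free_scale[OF 1[OF this], of r] show ?case by (simp add: free_scale_diff)
  next
    case (add p q)
    from ext_rels_add[OF add(3,4)] show ?case by (simp add: cons_op_add algebra_simps)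
  qed simp
  show "cons_op (ls a u) q - cons_op u (free_scale a q) \<in> ext_rels A (Suc n)"
    using assms
  proof (induction rule: homog_induct)
    case (single ws r)
    from ext_rels_free_scale[OF 2[OF this], of r] show ?case
      by (simp add: free_scale_diff mult.commute)
  next
    case (add p q)
    from ext_rels_add[OF add(3,4)] show ?case by (simp add: cons_op_add free_scale_add algebra_simps)
  qed simp
  show "cons_op u (cons_op u q) \<in> ext_rels A (Suc (Suc n))"
    using assms
  proof (induction rule: homog_induct)
    case (single ws r)
    from ext_rels_free_scale[OF 3[OF this], of r] show ?case by simp
  next
    case (add p q)
    from ext_rels_add[OF add(3,4)] show ?case by (simp add: cons_op_add)
  qed simp
qed

text \<open>Projection commutes with prefixing up to a shift of degree, so it sends a generator with
  tail \<open>q\<close> to zero or to the same generator with a homogeneous part of \<open>q\<close>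
  as tail.\<close>

lemma homog_part_null: "p \<in> ext_null \<Longrightarrow> homog_part n p \<in> ext_rels A n"
proof (induction arbitrary: n rule: ext_null.induct)
  case (null_diff p q)
  then show ?case by (simp add: homog_part_diff ext_rels_diff)
next
  case (null_cons p Z)
  then show ?case
    by (cases n) (simp_all add: homog_part_zero_cons_op homog_part_cons_op ext_rels_cons_op)
next
  case (null_add u v q)
  show ?case
    by (cases n) (simp_all add: homog_part_diff homog_part_zero_cons_op homog_part_cons_op
        ext_rels_relations homog_part_in_homog)
next
  case (null_scale a u q)
  show ?case
    by (cases n) (simp_all add: homog_part_diff homog_part_zero_cons_op homog_part_cons_op
        homog_part_free_scale ext_rels_relations homog_part_in_homog)
next
  case (null_alt u q)
  have "homog_part n (cons_op u (cons_op u q)) = 0 \<or>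
    (\<exists>m. n = Suc (Suc m) \<and>
      homog_part n (cons_op u (cons_op u q)) = cons_op u (cons_op u (homog_part m q)))"
    by (cases n; cases "n - 1") (simp_all add: homog_part_zero_cons_op homog_part_cons_op)
  then show ?case using ext_rels_relations(3)[OF homog_part_in_homog] by auto
qed simp

text \<open>The bridge from congruences of words to the exterior powers: inclusion is checked on
  generators one way and by projection to degree n the other way.\<close>

lemma ext_rels_eq: "ext_rels A n = ext_null \<inter> homog n"
proof
  show "ext_null \<inter> homog n \<subseteq> ext_rels A n"
  proof
    fix p assume "p \<in> ext_null \<inter> homog n"
    then show "p \<in> ext_rels A n"
      using homog_part_null[of p n] homog_part_homog[of p n] by simp
  qed
qed (rule ext_rels_subset_null)

section \<open>Degrees of the operators on words\<close>

lemma theta_word_homog: "theta_word Z Zs r \<in> homog (length Zs)"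
  by (induction Zs) (auto intro!: homog_single homog_diff homog_cons_op)

lemma bd_word_homog: "bd_word Zs r \<in> homog (length Zs - 1)"
proof (induction Zs)
  case (Cons Z Zs)
  have "cons_op Z (bd_word Zs r) \<in> homog (length Zs)"
    \<comment> \<open>For empty \<open>Zs\<close>, truncated subtraction gives degree 0 instead of
      -1, and the hypothesis would put the product in degree 1; but \<open>bd_word [] r\<close> is
      0.\<close>
    using homog_cons_op[OF Cons] by (cases Zs) simp_all
  then show ?case using theta_word_homog by (simp add: homog_diff)
qed simp

lemma bd_homog: "p \<in> homog n \<Longrightarrow> bd p \<in> homog (n - 1)"
  by (induction rule: homog_induct) (use bd_word_homog in \<open>auto simp: bd_add bd_single intro: homog_add\<close>)

lemma bd_homog_zero: "p \<in> homog 0 \<Longrightarrow> bd p = 0"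
  by (induction rule: homog_induct) (auto simp: bd_add)

subsection \<open>The explicit formula for the differential\<close>

text \<open>The four shapes of omitted index sets that arise when
  \<open>sum.lessThan_Suc_shift\<close> splits off index 0.\<close>

lemma nths_Cons_Compl:
  "nths (Z # Zs) (- {0}) = Zs"
  "nths (Z # Zs) (- {Suc i}) = Z # nths Zs (- {i})"
  "nths (Z # Zs) (- {0, Suc j}) = nths Zs (- {j})"
  "nths (Z # Zs) (- {Suc i, Suc j}) = Z # nths Zs (- {i, j})"
proof -
  have "{k. k \<noteq> i} = - {i}" "{k. k \<noteq> j} = - {j}" "{k. k \<noteq> i \<and> k \<noteq> j} = - {i, j}"
    by auto
  then show "nths (Z # Zs) (- {0}) = Zs" "nths (Z # Zs) (- {Suc i}) = Z # nths Zs (- {i})"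
    "nths (Z # Zs) (- {0, Suc j}) = nths Zs (- {j})"
    "nths (Z # Zs) (- {Suc i, Suc j}) = Z # nths Zs (- {i, j})"
    by (simp_all add: nths_Cons nths_all)
qed

text \<open>\<open>theta_word\<close> leaves each bracket in its place with a minus sign; bringing
  it from position j to the front passes j letters, hence the exponent \<open>Suc j\<close>.\<close>

lemma theta_word_formula:
  "theta_word Z Zs r \<doteq> Poly_Mapping.single Zs (nb Z r) +
     (\<Sum>j<length Zs. Poly_Mapping.single (br Z (Zs ! j) # nths Zs (- {j})) ((- 1) ^ Suc j * r))"
proof (induction Zs)
  case (Cons Y Ys)
  let ?t = "\<lambda>j. Poly_Mapping.single (br Z (Ys ! j) # nths Ys (- {j})) ((- 1) ^ Suc j * r)"
  let ?t' = "\<lambda>j. Poly_Mapping.single (br Z (Ys ! j) # Y # nths Ys (- {j})) ((- 1) ^ Suc (Suc j) * r)"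
  have "cons_op Y (theta_word Z Ys r) \<doteq> cons_op Y (Poly_Mapping.single Ys (nb Z r) + (\<Sum>j<length Ys. ?t j))"
    by (intro E.eqm_additive[OF additive_cons_op] null_cons Cons)
  also have "\<dots> = Poly_Mapping.single (Y # Ys) (nb Z r) + (\<Sum>j<length Ys. cons_op Y (?t j))"
    by (simp add: cons_op_add additive.sum[OF additive_cons_op])
  also have "\<dots> \<doteq> Poly_Mapping.single (Y # Ys) (nb Z r) + (\<Sum>j<length Ys. ?t' j)"
  proof (intro E.eqm_add E.eqm_sum E.eqm_refl)
    fix j
    show "cons_op Y (?t j) \<doteq> ?t' j"
      using cons_op_swap[of Y "br Z (Ys ! j)" "Poly_Mapping.single (nths Ys (- {j})) ((- 1) ^ Suc j * r)"]
      by (simp flip: single_uminus)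
  qed
  finally have "cons_op Y (theta_word Z Ys r) - Poly_Mapping.single (br Z Y # Ys) r \<doteq>
      Poly_Mapping.single (Y # Ys) (nb Z r) + (\<Sum>j<length Ys. ?t' j)
      - Poly_Mapping.single (br Z Y # Ys) r"
    by (rule E.eqm_diff[OF _ E.eqm_refl])
  then show ?case
    by (simp add: nths_Cons_Compl sum.lessThan_Suc_shift single_uminus algebra_simps
        del: sum.lessThan_Suc)
qed simp

text \<open>With the larger index outside, splitting off 0 from both sums separates the pairs (0, j)
  from the shifted pairs.\<close>

lemma sum_pairs: "(\<Sum>(i, j) \<in> {(i, j). i < j \<and> j < n}. f i j) = (\<Sum>j<n. \<Sum>i<j. f i j)"
  for f :: "nat \<Rightarrow> nat \<Rightarrow> 'b::comm_monoid_add"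
  unfolding sum.Sigma[OF finite_lessThan ballI[OF finite_lessThan]]
  by (rule sum.reindex_bij_witness[of _ prod.swap prod.swap]) auto

text \<open>Terms that involve index 0 come from \<open>theta_word\<close>, all others from minus Z
  in front of the shorter differential. In the first sum this minus is the change of sign of the
  shifted index. In the second, two shifted indices leave the sign alone, and the minus cancels
  against moving the bracket past Z.\<close>

lemma bd_word_formula: "bd_word Zs 1 \<doteq> boundary_formula A Zs"
  unfolding boundary_formula_def sum_pairs
proof (induction Zs)
  case (Cons Z Zs)
  let ?n = "length Zs"
  let ?s = "Poly_Mapping.single :: 'l list \<Rightarrow> 'r \<Rightarrow> _"
  have "cons_op Z (bd_word Zs 1) \<doteq> cons_op Z (
      (\<Sum>i<?n. ?s (nths Zs (- {i})) ((- 1) ^ i * nb (Zs ! i) 1)) +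
      (\<Sum>j<?n. \<Sum>i<j. ?s (br (Zs ! i) (Zs ! j) # nths Zs (- {i, j})) ((- 1) ^ (i + j))))"
    by (intro E.eqm_additive[OF additive_cons_op] null_cons Cons)
  also have "\<dots> = (\<Sum>i<?n. ?s (Z # nths Zs (- {i})) ((- 1) ^ i * nb (Zs ! i) 1)) +
      (\<Sum>j<?n. \<Sum>i<j. ?s (Z # br (Zs ! i) (Zs ! j) # nths Zs (- {i, j})) ((- 1) ^ (i + j)))"
    by (simp add: cons_op_add additive.sum[OF additive_cons_op])
  also have "\<dots> \<doteq> (\<Sum>i<?n. ?s (Z # nths Zs (- {i})) ((- 1) ^ i * nb (Zs ! i) 1)) +
      (\<Sum>j<?n. \<Sum>i<j. - ?s (br (Zs ! i) (Zs ! j) # Z # nths Zs (- {i, j})) ((- 1) ^ (i + j)))"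
  proof (intro E.eqm_add E.eqm_sum E.eqm_refl)
    fix i j
    show "?s (Z # br (Zs ! i) (Zs ! j) # nths Zs (- {i, j})) ((- 1) ^ (i + j)) \<doteq>
        - ?s (br (Zs ! i) (Zs ! j) # Z # nths Zs (- {i, j})) ((- 1) ^ (i + j))"
      using cons_op_swap[of Z "br (Zs ! i) (Zs ! j)" "?s (nths Zs (- {i, j})) ((- 1) ^ (i + j))"]
      by simp
  qed
  finally have "theta_word Z Zs 1 - cons_op Z (bd_word Zs 1) \<doteq>
      (?s Zs (nb Z 1) +
       (\<Sum>j<?n. ?s (br Z (Zs ! j) # nths Zs (- {j})) ((- 1) ^ Suc j * 1))) -
      ((\<Sum>i<?n. ?s (Z # nths Zs (- {i})) ((- 1) ^ i * nb (Zs ! i) 1)) +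
      (\<Sum>j<?n. \<Sum>i<j. - ?s (br (Zs ! i) (Zs ! j) # Z # nths Zs (- {i, j})) ((- 1) ^ (i + j))))"
    by (rule E.eqm_diff[OF theta_word_formula])
  then show ?case
    by (simp add: nths_Cons_Compl sum.lessThan_Suc_shift single_uminus sum.distrib sum_negf sum_subtractf
        algebra_simps del: sum.lessThan_Suc)
qed simp

lemma boundary_formula_homog: "boundary_formula A Zs \<in> homog (length Zs - 1)"
proof -
  have 1: "length (nths Zs (- {i})) = length Zs - 1" if "i < length Zs" for i
  proof -
    have "{k. k < length Zs \<and> k \<in> - {i}} = {..<length Zs} - {i}" by auto
    then show ?thesis using that by (simp add: length_nths)
  qed
  have 2: "Suc (length (nths Zs (- {i, j}))) = length Zs - 1" if "i < j" "j < length Zs" for i j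
  proof -
    have "{k. k < length Zs \<and> k \<in> - {i, j}} = {..<length Zs} - {i, j}" by auto
    then show ?thesis using that by (simp add: length_nths card_Diff_subset)
  qed
  show ?thesis
    unfolding boundary_formula_def
    by (intro homog_add homog_sum) (auto intro!: homog_single simp: 1 2)
qed

end

lemma (in lie_rinehart_measuring) fm_word_homog: "fm_word Zs r x \<in> homog (length Zs)"
  by (induction Zs arbitrary: x)
    (auto simp: sw_def lin_ext_def intro!: homog_single homog_sum homog_free_scale homog_cons_op)

lemma (in lie_rinehart_measuring) fm_homog: "p \<in> homog n \<Longrightarrow> fm x p \<in> homog n"
  by (induction rule: homog_induct) (use fm_word_homog in \<open>auto simp: fm_add fm_single intro: homog_add\<close>)

section \<open>Quotient modules\<close>

abbreviation type_module :: "('k::field, 'm) module \<Rightarrow> bool" where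
  "type_module M \<equiv> Module.module (ring_of_type_algebra :: 'k ring) M"

lemma carrier_ring_of_type_algebra [simp]: "carrier ring_of_type_algebra = UNIV"
  by (simp add: ring_of_type_algebra_def)

text \<open>Serves twice: for exterior powers as quotients of free modules, and for homology as
  cycles modulo boundaries.\<close>

locale module_quotient =
  fixes M :: "('k::field, 'm) module" (structure) and N :: "'m set"
  assumes type_module: "type_module M"
    and submodule: "submodule N (ring_of_type_algebra :: 'k ring) M"
begin

sublocale Module.module "ring_of_type_algebra :: 'k ring" M
  by (rule type_module)

sublocale N: abelian_subgroup N M
  by (rule abelian_subgroupI3[OF additive_subgroupI[OF submodule.axioms(1)[OF submodule]]
      module.axioms(2)[OF type_module]])

abbreviation Q where "Q \<equiv> quot_module M N"

lemma smult_mem: "u \<in> N \<Longrightarrow> c \<odot> u \<in> N"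
  using submoduleE(4)[OF submodule] by simp

lemma carrier_quot: "carrier Q = (\<lambda>u. N +> u) ` carrier M"
  by (auto simp: quot_module_def A_RCOSETS_def')

lemma coset_eq_iff:
  assumes "u \<in> carrier M" "v \<in> carrier M"
  shows "N +> u = N +> v \<longleftrightarrow> u \<ominus> v \<in> N"
proof -
  have "u \<in> N +> v \<longleftrightarrow> u \<ominus> v \<in> N"
    using assms N.a_rcos_module[of v u] by (simp add: minus_eq is_abelian_group)
  then show ?thesis
    using N.a_rcos_self[OF assms(1)] a_repr_independence[OF _ assms(2) N.a_subgroup] by blast
qed

lemma add_quot: "u \<in> carrier M \<Longrightarrow> v \<in> carrier M \<Longrightarrow> (N +> u) \<oplus>\<^bsub>Q\<^esub> (N +> v) = N +> (u \<oplus> v)"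
  by (simp add: quot_module_def N.a_rcos_sum)

lemma zero_quot: "\<zero>\<^bsub>Q\<^esub> = N +> \<zero>"
  by (simp add: quot_module_def a_coset_add_zero N.a_subset)

lemma smult_quot:
  assumes "u \<in> carrier M"
  shows "c \<odot>\<^bsub>Q\<^esub> (N +> u) = N +> (c \<odot> u)"
proof -
  have "N +> (c \<odot> v) = N +> (c \<odot> u)" if "v \<in> N +> u" for v
  proof -
    have v: "v \<in> carrier M"
      using that assms a_r_coset_subset_G[OF N.a_subset] by blast
    have "N +> v = N +> u"
      using a_repr_independence[OF that assms N.a_subgroup] by simp
    then have "c \<odot> (v \<ominus> u) \<in> N"
      using v assms by (simp add: coset_eq_iff smult_mem)
    then show ?thesis
      using v assms by (simp add: coset_eq_iff minus_eq smult_r_distr smult_r_minus)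
  qed
  then have "(\<Union>v\<in>N +> u. N +> (c \<odot> v)) = (\<Union>v\<in>N +> u. N +> (c \<odot> u))"
    by (intro SUP_cong) simp_all
  moreover have "N +> u \<noteq> {}"
    using N.a_rcos_self[OF assms] by blast
  ultimately show ?thesis
    by (simp add: quot_module_def)
qed

lemma module_quot: "type_module Q"
proof (rule moduleI)
  show "cring (ring_of_type_algebra :: 'k ring)" by (rule cring_from_type_algebra)
  show "abelian_group Q"
  proof (rule abelian_groupI)
    fix x assume "x \<in> carrier Q"
    then obtain u where u: "u \<in> carrier M" "x = N +> u" by (auto simp: carrier_quot)
    then have "(N +> (\<ominus> u)) \<oplus>\<^bsub>Q\<^esub> x = \<zero>\<^bsub>Q\<^esub>"
      by (simp add: add_quot zero_quot l_neg)
    then show "\<exists>y\<in>carrier Q. y \<oplus>\<^bsub>Q\<^esub> x = \<zero>\<^bsub>Q\<^esub>"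
      using u by (auto simp: carrier_quot)
  qed (auto simp: carrier_quot add_quot zero_quot a_ac)
qed (auto simp: carrier_quot add_quot smult_quot smult_l_distr smult_r_distr smult_assoc1)

end

text \<open>Cosets exhaust the quotient, so the values of h are forced; uniqueness as a function
  uses that \<open>linear_maps\<close> is extensional.\<close>

lemma quot_linear_map_ex1:
  fixes M :: "('k::field, 'm) module" and M' :: "('k, 'n) module"
  assumes "module_quotient M N" "module_quotient M' N'"
    and closed: "\<And>u. u \<in> carrier M \<Longrightarrow> f u \<in> carrier M'"
    and add: "\<And>u v. u \<in> carrier M \<Longrightarrow> v \<in> carrier M \<Longrightarrow> f (u \<oplus>\<^bsub>M\<^esub> v) = f u \<oplus>\<^bsub>M'\<^esub> f v"
    and smult: "\<And>c u. u \<in> carrier M \<Longrightarrow> f (c \<odot>\<^bsub>M\<^esub> u) = c \<odot>\<^bsub>M'\<^esub> f u"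
    and mem: "\<And>u. u \<in> N \<Longrightarrow> f u \<in> N'"
  shows "\<exists>!h. h \<in> linear_maps (quot_module M N) (quot_module M' N') \<and>
    (\<forall>u\<in>carrier M. h (N +>\<^bsub>M\<^esub> u) = N' +>\<^bsub>M'\<^esub> f u)"
proof -
  interpret Q: module_quotient M N by fact
  interpret Q': module_quotient M' N' by fact
  \<comment> \<open>Equality of cosets is expressed by a difference, so compatibility with negatives
    is derived here from additivity.\<close>
  have f_minus: "f (\<ominus>\<^bsub>M\<^esub> u) = \<ominus>\<^bsub>M'\<^esub> f u" if "u \<in> carrier M" for u
  proof -
    have "f \<zero>\<^bsub>M\<^esub> = f \<zero>\<^bsub>M\<^esub> \<oplus>\<^bsub>M'\<^esub> f \<zero>\<^bsub>M\<^esub>"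
      using add[of "\<zero>\<^bsub>M\<^esub>" "\<zero>\<^bsub>M\<^esub>"] by simp
    then have "f \<zero>\<^bsub>M\<^esub> = \<zero>\<^bsub>M'\<^esub>"
      using closed[of "\<zero>\<^bsub>M\<^esub>"] Q'.add.l_cancel_one[of "f \<zero>\<^bsub>M\<^esub>" "f \<zero>\<^bsub>M\<^esub>"] by simp
    then have "f (\<ominus>\<^bsub>M\<^esub> u) \<oplus>\<^bsub>M'\<^esub> f u = \<zero>\<^bsub>M'\<^esub>"
      using that add[of "\<ominus>\<^bsub>M\<^esub> u" u] by (simp add: Q.l_neg)
    then show ?thesis
      using that closed by (intro Q'.minus_equality[symmetric]) auto
  qed
  have wd: "N' +>\<^bsub>M'\<^esub> f u = N' +>\<^bsub>M'\<^esub> f v"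
    if uv: "u \<in> carrier M" "v \<in> carrier M" "N +>\<^bsub>M\<^esub> u = N +>\<^bsub>M\<^esub> v" for u v
  proof -
    have "f (u \<ominus>\<^bsub>M\<^esub> v) \<in> N'"
      using that by (intro mem) (simp add: Q.coset_eq_iff)
    then show ?thesis
      using uv closed by (simp add: Q'.coset_eq_iff Q.minus_eq Q'.minus_eq add f_minus)
  qed
  \<comment> \<open>A representative is chosen in each coset; the restriction to the carrier
    provides the required value outside it.\<close>
  define h where "h = (\<lambda>B\<in>carrier Q.Q. N' +>\<^bsub>M'\<^esub> f (SOME u. u \<in> carrier M \<and> B = N +>\<^bsub>M\<^esub> u))"
  have h: "h (N +>\<^bsub>M\<^esub> u) = N' +>\<^bsub>M'\<^esub> f u" if u: "u \<in> carrier M" for u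
  proof -
    let ?v = "SOME v. v \<in> carrier M \<and> N +>\<^bsub>M\<^esub> u = N +>\<^bsub>M\<^esub> v"
    have "?v \<in> carrier M \<and> N +>\<^bsub>M\<^esub> u = N +>\<^bsub>M\<^esub> ?v"
      by (rule someI[of _ u]) (simp add: u)
    then show ?thesis
      using u wd[of ?v u] by (simp add: h_def Q.carrier_quot)
  qed
  have "h \<in> linear_maps Q.Q Q'.Q"
    unfolding linear_maps_def
  proof (intro CollectI conjI ballI allI)
    show "h \<in> carrier Q.Q \<rightarrow>\<^sub>E carrier Q'.Q"
    proof (rule PiE_I)
      fix B assume "B \<in> carrier Q.Q"
      then show "h B \<in> carrier Q'.Q"
        using h closed by (auto simp: Q.carrier_quot Q'.carrier_quot)
    qed (simp add: h_def)
  qed (use h closed add smult in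
      \<open>auto simp: Q.carrier_quot Q.add_quot Q'.add_quot Q.smult_quot Q'.smult_quot\<close>)
  with h have hh: "h \<in> linear_maps Q.Q Q'.Q \<and> (\<forall>u\<in>carrier M. h (N +>\<^bsub>M\<^esub> u) = N' +>\<^bsub>M'\<^esub> f u)"
    by simp
  show ?thesis
  proof (rule ex1I, rule hh)
    fix g assume g: "g \<in> linear_maps Q.Q Q'.Q \<and> (\<forall>u\<in>carrier M. g (N +>\<^bsub>M\<^esub> u) = N' +>\<^bsub>M'\<^esub> f u)"
    show "g = h"
    proof (rule PiE_ext)
      show "g \<in> carrier Q.Q \<rightarrow>\<^sub>E carrier Q'.Q" "h \<in> carrier Q.Q \<rightarrow>\<^sub>E carrier Q'.Q"
        using g hh by (simp_all add: linear_maps_def)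
      fix B assume "B \<in> carrier Q.Q"
      then obtain u where "u \<in> carrier M" "B = N +>\<^bsub>M\<^esub> u"
        unfolding Q.carrier_quot by blast
      then show "g B = h B"
        using g hh by simp
    qed
  qed
qed

section \<open>Homology\<close>

lemma homology_quotient:
  assumes "chain_complex M d"
  shows "module_quotient ((M n)\<lparr>carrier := cycles M d n\<rparr>) (boundaries M d n)"
proof -
  have mod: "type_module (M n)" for n
    using assms by (simp add: chain_complex_def)
  interpret M: Module.module ring_of_type_algebra "M i" for i by (rule mod)
  have lin: "d n \<in> linear_maps (M n) (M (n - 1))" for n
    using assms by (simp add: chain_complex_def)
  have closed: "d n u \<in> carrier (M (n - 1))" if "u \<in> carrier (M n)" for n u
    using lin[of n] that by (auto simp: linear_maps_def)
  have add: "d n (u \<oplus>\<^bsub>M n\<^esub> v) = d n u \<oplus>\<^bsub>M (n - 1)\<^esub> d n v"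
    if "u \<in> carrier (M n)" "v \<in> carrier (M n)" for n u v
    using lin[of n] that by (simp add: linear_maps_def)
  have smult: "d n (c \<odot>\<^bsub>M n\<^esub> u) = c \<odot>\<^bsub>M (n - 1)\<^esub> d n u" if "u \<in> carrier (M n)" for n c u
    using lin[of n] that by (simp add: linear_maps_def)
  have dd: "d n (d (Suc n) u) = \<zero>\<^bsub>M (n - 1)\<^esub>" if "u \<in> carrier (M (Suc n))" for n u
    using assms that by (simp add: chain_complex_def)
  \<comment> \<open>With negation written as scaling by -1, compatibility of \<open>d\<close> with
    scalars covers it.\<close>
  have neg: "\<ominus>\<^bsub>M n\<^esub> u = (\<ominus>\<^bsub>ring_of_type_algebra\<^esub> \<one>\<^bsub>ring_of_type_algebra\<^esub>) \<odot>\<^bsub>M n\<^esub> u"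
    if "u \<in> carrier (M n)" for n u
    using that M.smult_l_minus[of "\<one>\<^bsub>ring_of_type_algebra\<^esub>" u n] by simp
  have zero: "d n \<zero>\<^bsub>M n\<^esub> = \<zero>\<^bsub>M (n - 1)\<^esub>" for n
    using smult[of "\<zero>\<^bsub>M n\<^esub>" n "\<zero>\<^bsub>ring_of_type_algebra\<^esub>"] closed by simp
  have Z: "submodule (cycles M d n) ring_of_type_algebra (M n)"
  proof (rule M.submoduleI)
    fix u assume "u \<in> cycles M d n"
    then show "\<ominus>\<^bsub>M n\<^esub> u \<in> cycles M d n"
      by (simp add: cycles_def neg smult del: M.smult_l_minus)
  qed (auto simp: cycles_def add smult zero)
  show ?thesis
  proof (rule module_quotient.intro)
    show mZ: "type_module ((M n)\<lparr>carrier := cycles M d n\<rparr>)"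
      by (rule submodule.submodule_is_module[OF Z mod])
    have "submodule (boundaries M d n) ring_of_type_algebra (M n)"
    proof (rule M.submoduleI)
      show "boundaries M d n \<subseteq> carrier (M n)"
        using closed[of _ "Suc n"] by (auto simp: boundaries_def)
      show "\<zero>\<^bsub>M n\<^esub> \<in> boundaries M d n"
        using zero[of "Suc n"] unfolding boundaries_def by (metis M.zero_closed diff_Suc_1 imageI)
    next
      fix u v assume "u \<in> boundaries M d n" "v \<in> boundaries M d n"
      then obtain w w' where "w \<in> carrier (M (Suc n))" "u = d (Suc n) w"
        "w' \<in> carrier (M (Suc n))" "v = d (Suc n) w'"
        by (auto simp: boundaries_def)
      then show "u \<oplus>\<^bsub>M n\<^esub> v \<in> boundaries M d n"
        using add[of w "Suc n" w'] unfolding boundaries_def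
        by (intro image_eqI[of _ _ "w \<oplus>\<^bsub>M (Suc n)\<^esub> w'"]) simp_all
    next
      fix c u assume "u \<in> boundaries M d n"
      then obtain w where "w \<in> carrier (M (Suc n))" "u = d (Suc n) w"
        by (auto simp: boundaries_def)
      then show "c \<odot>\<^bsub>M n\<^esub> u \<in> boundaries M d n"
        using smult[of w "Suc n" c] unfolding boundaries_def
        by (intro image_eqI[of _ _ "c \<odot>\<^bsub>M (Suc n)\<^esub> w"]) simp_all
    next
      fix u assume "u \<in> boundaries M d n"
      then obtain w where "w \<in> carrier (M (Suc n))" "u = d (Suc n) w"
        by (auto simp: boundaries_def)
      then have "\<ominus>\<^bsub>M n\<^esub> u = d (Suc n) (\<ominus>\<^bsub>M (Suc n)\<^esub> w)"
        using closed[of w "Suc n"] by (simp add: neg smult del: M.smult_l_minus)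
      then show "\<ominus>\<^bsub>M n\<^esub> u \<in> boundaries M d n"
        using \<open>w \<in> carrier (M (Suc n))\<close> by (auto simp: boundaries_def)
    qed
    note B = this
    have sub: "boundaries M d n \<subseteq> cycles M d n"
      using closed[of _ "Suc n"] dd by (auto simp: boundaries_def cycles_def)
    interpret Z: Module.module ring_of_type_algebra "(M n)\<lparr>carrier := cycles M d n\<rparr>" by (rule mZ)
    have "type_module ((M n)\<lparr>carrier := boundaries M d n\<rparr>)"
      by (rule submodule.submodule_is_module[OF B mod])
    then show "submodule (boundaries M d n) ring_of_type_algebra ((M n)\<lparr>carrier := cycles M d n\<rparr>)"
      using sub by (intro Z.module_incl_imp_submodule) simp_all
  qed
qed

text \<open>Cosets use only addition, so restricting the carrier to cycles leaves them unchanged;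
  this reconciles \<open>homology_class\<close> with the quotient in
  \<open>homology\<close>.\<close>

lemma coset_carrier_update: "B +>\<^bsub>M\<lparr>carrier := Z\<rparr>\<^esub> z = B +>\<^bsub>M\<^esub> z"
  for M :: "('k, 'm) module"
  by (simp add: a_r_coset_def')

lemma homology_map_ex1:
  assumes "chain_map M d M' d' F"
  shows "\<exists>!h. h \<in> linear_maps (homology M d n) (homology M' d' n) \<and>
    (\<forall>z\<in>cycles M d n. h (homology_class M d n z) = homology_class M' d' n (F n z))"
proof -
  have cM: "chain_complex M d" and cM': "chain_complex M' d'"
    and lin: "\<And>n. F n \<in> linear_maps (M n) (M' n)"
    and comm: "\<And>n u. u \<in> carrier (M n) \<Longrightarrow> F (n - 1) (d n u) = d' n (F n u)"
    using assms by (simp_all add: chain_map_def)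
  interpret M': Module.module ring_of_type_algebra "M' i" for i
    using cM' by (simp add: chain_complex_def)
  interpret M: Module.module ring_of_type_algebra "M i" for i
    using cM by (simp add: chain_complex_def)
  have closed: "F n u \<in> carrier (M' n)" if "u \<in> carrier (M n)" for n u
    using lin[of n] that by (auto simp: linear_maps_def)
  have F_smult: "F n (c \<odot>\<^bsub>M n\<^esub> u) = c \<odot>\<^bsub>M' n\<^esub> F n u" if "u \<in> carrier (M n)" for n c u
    using lin[of n] that by (simp add: linear_maps_def)
  have zero: "F n \<zero>\<^bsub>M n\<^esub> = \<zero>\<^bsub>M' n\<^esub>" for n
    using F_smult[of "\<zero>\<^bsub>M n\<^esub>" n "\<zero>\<^bsub>ring_of_type_algebra\<^esub>"] closed by simp
  have "\<exists>!h. h \<in> linear_maps (homology M d n) (homology M' d' n) \<and>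
    (\<forall>z\<in>carrier ((M n)\<lparr>carrier := cycles M d n\<rparr>).
      h (boundaries M d n +>\<^bsub>(M n)\<lparr>carrier := cycles M d n\<rparr>\<^esub> z) =
      boundaries M' d' n +>\<^bsub>(M' n)\<lparr>carrier := cycles M' d' n\<rparr>\<^esub> F n z)"
    unfolding homology_def
  proof (rule quot_linear_map_ex1[OF homology_quotient[OF cM] homology_quotient[OF cM']])
    fix u assume "u \<in> carrier ((M n)\<lparr>carrier := cycles M d n\<rparr>)"
    then show "F n u \<in> carrier ((M' n)\<lparr>carrier := cycles M' d' n\<rparr>)"
      using comm[of u n] by (auto simp: cycles_def closed zero)
  next
    fix u assume "u \<in> boundaries M d n"
    then obtain w where w: "w \<in> carrier (M (Suc n))" "u = d (Suc n) w"
      by (auto simp: boundaries_def)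
    then show "F n u \<in> boundaries M' d' n"
      using comm[of w "Suc n"] closed[of w "Suc n"] by (auto simp: boundaries_def)
  qed (use lin[of n] in \<open>auto simp: cycles_def linear_maps_def\<close>)
  then show ?thesis
    unfolding coset_carrier_update homology_class_def by simp
qed

section \<open>The exterior algebra complex\<close>

context flat_lie_rinehart
begin

lemma free_tuples_simps:
  "carrier (free_tuples \<eta> n) = homog n" "\<zero>\<^bsub>free_tuples \<eta> n\<^esub> = 0"
  "p \<oplus>\<^bsub>free_tuples \<eta> n\<^esub> q = p + q" "c \<odot>\<^bsub>free_tuples \<eta> n\<^esub> p = free_scale (\<eta> c) p"
  by (simp_all add: free_tuples_def homog_def)

lemma module_free_tuples: "type_module (free_tuples \<eta> n :: ('k, 'l list \<Rightarrow>\<^sub>0 'r) module)"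
proof (rule moduleI)
  show "abelian_group (free_tuples \<eta> n :: ('k, 'l list \<Rightarrow>\<^sub>0 'r) module)"
  proof (rule abelian_groupI)
    fix p :: "'l list \<Rightarrow>\<^sub>0 'r" assume "p \<in> carrier (free_tuples \<eta> n)"
    then show "\<exists>q\<in>carrier (free_tuples \<eta> n). q \<oplus>\<^bsub>free_tuples \<eta> n\<^esub> p = \<zero>\<^bsub>free_tuples \<eta> n\<^esub>"
      using homog_diff[OF homog_zero, of p n] by (intro bexI[of _ "- p"]) (simp_all add: free_tuples_simps)
  qed (simp_all add: free_tuples_simps homog_add algebra_simps)
qed (simp_all add: free_tuples_simps homog_free_scale free_scale_add free_scale_add_left
    free_scale_mult \<eta>_add \<eta>_mult cring_from_type_algebra, simp_all add: ring_of_type_algebra_def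
    free_scale_add_left free_scale_mult \<eta>_add \<eta>_mult)

lemma ext_quotient: "module_quotient (free_tuples \<eta> n) (ext_rels A n)"
proof (rule module_quotient.intro[OF module_free_tuples])
  interpret F: Module.module "ring_of_type_algebra :: 'k ring"
    "free_tuples \<eta> n :: ('k, 'l list \<Rightarrow>\<^sub>0 'r) module"
    by (rule module_free_tuples)
  show "submodule (ext_rels A n) ring_of_type_algebra (free_tuples \<eta> n)"
  proof (rule F.submoduleI)
    fix p assume p: "p \<in> ext_rels A n"
    then have "p \<in> homog n" by (simp add: ext_rels_eq)
    then have "- p \<in> homog n" using homog_diff[OF homog_zero, of p n] by simp
    have "\<ominus>\<^bsub>free_tuples \<eta> n\<^esub> p = - p"
      by (rule F.minus_equality)
        (use \<open>p \<in> homog n\<close> \<open>- p \<in> homog n\<close> in \<open>simp_all add: free_tuples_simps\<close>)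
    then show "\<ominus>\<^bsub>free_tuples \<eta> n\<^esub> p \<in> ext_rels A n"
      using ext_rels_diff[OF ext_rels_zero p] by simp
  qed (auto simp: free_tuples_simps ext_rels_add ext_rels_free_scale, simp add: ext_rels_eq)
qed

lemma module_ext_power: "type_module (ext_power A n)"
  unfolding ext_power_def by (rule module_quotient.module_quot[OF ext_quotient])

lemma carrier_ext_power: "carrier (ext_power A n) = ext_class A n ` homog n"
  unfolding ext_power_def module_quotient.carrier_quot[OF ext_quotient]
  by (simp add: free_tuples_simps ext_class_def[abs_def])

lemma ext_class_carrier: "p \<in> homog n \<Longrightarrow> ext_class A n p \<in> carrier (ext_power A n)"
  by (simp add: carrier_ext_power)

lemma ext_class_add: "p \<in> homog n \<Longrightarrow> q \<in> homog n \<Longrightarrow>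
    ext_class A n (p + q) = ext_class A n p \<oplus>\<^bsub>ext_power A n\<^esub> ext_class A n q"
  using module_quotient.add_quot[OF ext_quotient, of p n q]
  by (simp add: ext_power_def ext_class_def free_tuples_simps)

lemma ext_class_zero: "ext_class A n 0 = \<zero>\<^bsub>ext_power A n\<^esub>"
  using module_quotient.zero_quot[OF ext_quotient, of n]
  by (simp add: ext_power_def ext_class_def free_tuples_simps)

text \<open>The congruence ignores degrees, so homogeneity of both sides is what places their
  difference in \<open>ext_rels A n\<close>.\<close>

lemma ext_class_eqI:
  assumes "p \<in> homog n" "q \<in> homog n" "p \<doteq> q"
  shows "ext_class A n p = ext_class A n q"
proof -
  interpret F: module_quotient "free_tuples \<eta> n" "ext_rels A n" by (rule ext_quotient)
  have "q \<in> ext_rels A n +>\<^bsub>free_tuples \<eta> n\<^esub> p"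
    using E.eqm_sym[OF assms(3)] homog_diff[OF assms(2,1)]
    by (auto simp: a_r_coset_def' free_tuples_simps ext_rels_eq E.eqm_def intro!: bexI[of _ "q - p"])
  then show ?thesis
    unfolding ext_class_def
    using F.a_repr_independence[OF _ _ F.N.a_subgroup] assms(1) by (simp add: free_tuples_simps)
qed

text \<open>Applied to \<open>bd\<close> with m = n - 1, and to \<open>fm x\<close> with m =
  n.\<close>

lemma ext_induced_ex1:
  fixes A' :: "('k, 's::{comm_ring,comm_monoid_mult}, 'm::ab_group_add) lie_rinehart"
  assumes "flat_lie_rinehart A'"
    and f: "additive f" "\<And>c p. f (free_scale (\<eta> c) p) = free_scale (unit_map A' c) (f p)"
    and homog: "\<And>p. p \<in> homog n \<Longrightarrow> f p \<in> homog m"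
    and null: "\<And>p. p \<in> ext_null \<Longrightarrow> f p \<in> flat_lie_rinehart.ext_null A'"
  shows "\<exists>!h. h \<in> linear_maps (ext_power A n) (ext_power A' m) \<and>
    (\<forall>p\<in>homog n. h (ext_class A n p) = ext_class A' m (f p))"
proof -
  interpret L': flat_lie_rinehart A' by fact
  have "\<exists>!h. h \<in> linear_maps (quot_module (free_tuples \<eta> n) (ext_rels A n))
      (quot_module (free_tuples (unit_map A') m) (ext_rels A' m)) \<and>
    (\<forall>p\<in>carrier (free_tuples \<eta> n). h (ext_rels A n +>\<^bsub>free_tuples \<eta> n\<^esub> p) =
      ext_rels A' m +>\<^bsub>free_tuples (unit_map A') m\<^esub> f p)"
    by (rule quot_linear_map_ex1[OF ext_quotient L'.ext_quotient])
      (auto simp: free_tuples_simps L'.free_tuples_simps homog additive.add[OF f(1)] f(2)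
        ext_rels_eq L'.ext_rels_eq null)
  then show ?thesis
    by (simp only: ext_power_def ext_class_def free_tuples_simps)
qed

text \<open>The maps are only k-linear, so an R-coefficient cannot be pulled out. In positive degree
  it can be absorbed into the first letter, and wedge products span additively.\<close>

lemma linear_maps_eqI_wedge:
  assumes f: "f \<in> linear_maps (ext_power A n) M" and g: "g \<in> linear_maps (ext_power A n) M"
    and n: "n \<noteq> 0"
    and wedge: "\<And>Zs. length Zs = n \<Longrightarrow> f (wedge A Zs) = g (wedge A Zs)"
  shows "f = g"
proof (rule PiE_ext)
  show "f \<in> carrier (ext_power A n) \<rightarrow>\<^sub>E carrier M" "g \<in> carrier (ext_power A n) \<rightarrow>\<^sub>E carrier M"
    using f g by (auto simp: linear_maps_def)
  have single: "f (ext_class A n (Poly_Mapping.single Zs r)) = g (ext_class A n (Poly_Mapping.single Zs r))"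
    if len: "length Zs = n" for Zs r
  proof -
    obtain Y Ys where Zs: "Zs = Y # Ys"
      using len n by (cases Zs) auto
    have "Poly_Mapping.single Zs r \<doteq> Poly_Mapping.single (ls r Y # Ys) 1"
      using E.eqm_sym[OF cons_op_ls[of r Y "Poly_Mapping.single Ys 1"]] by (simp add: Zs)
    then have "ext_class A n (Poly_Mapping.single Zs r) = wedge A (ls r Y # Ys)"
      using len ext_class_eqI[of "Poly_Mapping.single Zs r" n "Poly_Mapping.single (ls r Y # Ys) 1"]
      by (simp add: wedge_def Zs homog_single)
    then show ?thesis using wedge[of "ls r Y # Ys"] len by (simp add: Zs)
  qed
  fix u assume "u \<in> carrier (ext_power A n)"
  then obtain p where p: "p \<in> homog n" "u = ext_class A n p"
    by (auto simp: carrier_ext_power)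
  have "f (ext_class A n p) = g (ext_class A n p)"
    using p(1)
  proof (induction rule: homog_induct)
    case zero
    \<comment> \<open>Zero is presented as a word with coefficient 0, so nothing has to be known
      about the zero of \<open>M\<close>.\<close>
    show ?case using single[of "replicate n 0" 0] by simp
  next
    case (add p q)
    have add': "h (ext_class A n (p + q)) = h (ext_class A n p) \<oplus>\<^bsub>M\<^esub> h (ext_class A n q)"
      if "h \<in> linear_maps (ext_power A n) M" for h
      using that add(1,2) by (simp add: linear_maps_def ext_class_add ext_class_carrier)
    show ?case using add'[OF f] add'[OF g] add(3,4) by simp
  qed (rule single)
  then show "f u = g u" by (simp add: p)
qed

section \<open>The differential on the exterior powers\<close>

definition bdq :: "nat \<Rightarrow> ('l list \<Rightarrow>\<^sub>0 'r) set \<Rightarrow> ('l list \<Rightarrow>\<^sub>0 'r) set" where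
  "bdq n = (THE h. h \<in> linear_maps (ext_power A n) (ext_power A (n - 1)) \<and>
    (\<forall>p\<in>homog n. h (ext_class A n p) = ext_class A (n - 1) (bd p)))"

lemma bdq_linear: "bdq n \<in> linear_maps (ext_power A n) (ext_power A (n - 1))"
  and bdq_class: "p \<in> homog n \<Longrightarrow> bdq n (ext_class A n p) = ext_class A (n - 1) (bd p)"
  using theI'[OF ext_induced_ex1[OF flat_lie_rinehart_axioms additive_bd bd_\<eta> bd_homog bd_null, of n]]
  unfolding bdq_def by blast+

lemma is_lr_differential_bdq: "is_lr_differential A bdq"
  unfolding is_lr_differential_def
proof (intro conjI allI ballI impI)
  show "bdq n \<in> linear_maps (ext_power A n) (ext_power A (n - 1))" for n
    by (rule bdq_linear)
next
  fix u assume "u \<in> carrier (ext_power A 0)"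
  then show "bdq 0 u = \<zero>\<^bsub>ext_power A 0\<^esub>"
    by (auto simp: carrier_ext_power bdq_class bd_homog_zero ext_class_zero)
next
  fix Zs :: "'l list"
  have "bdq (length Zs) (wedge A Zs) = ext_class A (length Zs - 1) (bd_word Zs 1)"
    by (simp add: wedge_def bdq_class homog_single bd_single)
  also have "\<dots> = ext_class A (length Zs - 1) (boundary_formula A Zs)"
    by (rule ext_class_eqI[OF bd_word_homog boundary_formula_homog bd_word_formula])
  finally show "bdq (length Zs) (wedge A Zs) = ext_class A (length Zs - 1) (boundary_formula A Zs)" .
qed

lemma is_lr_differential_unique:
  assumes d: "is_lr_differential A d"
  shows "d = bdq"
proof
  fix n
  show "d n = bdq n"
  proof (cases "n = 0")
    case True
    \<comment> \<open>Degree 0 lies outside \<open>linear_maps_eqI_wedge\<close>; there the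
      prescribed vanishing determines the map.\<close>
    have "d 0 \<in> linear_maps (ext_power A 0) (ext_power A (0 - 1))"
      using d unfolding is_lr_differential_def by blast
    then have "d 0 \<in> carrier (ext_power A 0) \<rightarrow>\<^sub>E carrier (ext_power A 0)"
      "bdq 0 \<in> carrier (ext_power A 0) \<rightarrow>\<^sub>E carrier (ext_power A 0)"
      using bdq_linear[of 0] by (simp_all add: linear_maps_def)
    then have "d 0 = bdq 0"
      by (rule PiE_ext) (use d is_lr_differential_bdq in \<open>simp add: is_lr_differential_def\<close>)
    then show ?thesis using True by simp
  next
    case False
    show ?thesis
    proof (rule linear_maps_eqI_wedge[OF _ bdq_linear False])
      show "d n \<in> linear_maps (ext_power A n) (ext_power A (n - 1))"
        using d by (simp add: is_lr_differential_def)
      fix Zs :: "'l list" assume "length Zs = n"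
      then have "Zs \<noteq> []" "n = length Zs" using False by auto
      then show "d n (wedge A Zs) = bdq n (wedge A Zs)"
        using d is_lr_differential_bdq by (simp add: is_lr_differential_def)
    qed
  qed
qed

lemma ex1_lr_differential: "\<exists>!d. is_lr_differential A d"
  using is_lr_differential_bdq is_lr_differential_unique by blast

lemma lr_differential_eq: "lr_differential A = bdq"
  unfolding lr_differential_def
  by (rule the_equality, rule is_lr_differential_bdq, rule is_lr_differential_unique)

lemma chain_complex_ext: "chain_complex (ext_power A) bdq"
  unfolding chain_complex_def
proof (intro conjI allI ballI)
  fix n u assume "u \<in> carrier (ext_power A (Suc n))"
  then obtain p where p: "p \<in> homog (Suc n)" "u = ext_class A (Suc n) p"
    by (auto simp: carrier_ext_power)
  have "bdq n (bdq (Suc n) u) = ext_class A (n - 1) (bd (bd p))"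
    using bd_homog[OF p(1)] by (simp add: p bdq_class)
  also have "\<dots> = ext_class A (n - 1) 0"
    using bd_homog[OF bd_homog[OF p(1)]] bd_bd[of p]
    by (intro ext_class_eqI) (simp_all add: E.eqm_def)
  finally show "bdq n (bdq (Suc n) u) = \<zero>\<^bsub>ext_power A (n - 1)\<^esub>"
    by (simp add: ext_class_zero)
qed (use is_lr_differential_bdq in \<open>auto simp: is_lr_differential_def module_ext_power\<close>)

end

section \<open>The maps induced on exterior powers\<close>

context lie_rinehart_measuring
begin

lemma \<psi>_\<eta>: "\<psi> x (L.\<eta> c * r) = L'.\<eta> c * \<psi> x r"
  using measuring
  by (simp add: lr_measuring_def Vector_Spaces.linear_iff flip: L.rscale_eq L'.rscale_eq)

text \<open>An equality, where \<open>fm_free_scale\<close> is a congruence: constants pass through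
  \<open>\<psi> x\<close> by k-linearity, without splitting x.\<close>

lemma fm_\<eta>: "fm x (free_scale (L.\<eta> c) p) = free_scale (L'.\<eta> c) (fm x p)"
  by (induction p arbitrary: x rule: word_induct)
    (simp_all add: \<psi>_\<eta> free_scale_cons_op fm_cons_op free_scale_sw free_scale_add fm_add)

definition fmq :: "'c \<Rightarrow> nat \<Rightarrow> ('l list \<Rightarrow>\<^sub>0 'r) set \<Rightarrow> ('m list \<Rightarrow>\<^sub>0 's) set" where
  "fmq x n = (THE h. h \<in> linear_maps (ext_power A n) (ext_power A' n) \<and>
    (\<forall>p\<in>homog n. h (ext_class A n p) = ext_class A' n (fm x p)))"

lemma fmq_linear: "fmq x n \<in> linear_maps (ext_power A n) (ext_power A' n)"
  and fmq_class: "p \<in> homog n \<Longrightarrow> fmq x n (ext_class A n p) = ext_class A' n (fm x p)"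
  using theI'[OF L.ext_induced_ex1[where f = "fm x" and n = n and m = n,
      OF L'.flat_lie_rinehart_axioms additive_fm fm_\<eta> fm_homog fm_null]]
  unfolding fmq_def by blast+

lemma is_wedge_family_fmq: "is_wedge_family C A A' \<Psi> \<psi> x (fmq x)"
  unfolding is_wedge_family_def
proof (intro conjI allI impI)
  show "fmq x n \<in> linear_maps (ext_power A n) (ext_power A' n)" for n
    by (rule fmq_linear)
  show "fmq x 0 (ext_class A 0 (Poly_Mapping.single [] r)) =
      ext_class A' 0 (Poly_Mapping.single [] (\<psi> x r))" for r
    by (simp add: fmq_class homog_single)
next
  fix Zs :: "'l list" assume "Zs \<noteq> []"
  then obtain m where m: "length Zs = Suc m" by (cases Zs) auto
  have "lin_ext sc (\<lambda>xs. Poly_Mapping.single (map2 \<Psi> xs Zs) 1) (sweedler C (length Zs) x) \<in> homog (length Zs)"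
    unfolding lin_ext_def
    by (intro homog_sum homog_free_scale homog_single) (use sweedler_keys[of _ m x] m in simp)
  then have "ext_class A' (length Zs) (fm x (Poly_Mapping.single Zs 1)) = ext_class A' (length Zs)
      (lin_ext sc (\<lambda>xs. Poly_Mapping.single (map2 \<Psi> xs Zs) 1) (sweedler C (length Zs) x))"
    by (intro L'.ext_class_eqI fm_homog homog_single refl fm_word_sweedler \<open>Zs \<noteq> []\<close>)
  then show "fmq x (length Zs) (wedge A Zs) = ext_class A' (length Zs)
      (lin_ext sc (\<lambda>xs. Poly_Mapping.single (map2 \<Psi> xs Zs) 1) (sweedler C (length Zs) x))"
    unfolding wedge_def by (simp only: fmq_class[OF homog_single[OF refl]])
qed

lemma is_wedge_family_unique:
  assumes F: "is_wedge_family C A A' \<Psi> \<psi> x F"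
  shows "F = fmq x"
proof
  fix n
  show "F n = fmq x n"
  proof (cases "n = 0")
    case True
    have "F 0 \<in> carrier (ext_power A 0) \<rightarrow>\<^sub>E carrier (ext_power A' 0)"
      "fmq x 0 \<in> carrier (ext_power A 0) \<rightarrow>\<^sub>E carrier (ext_power A' 0)"
      using F fmq_linear[of x 0] by (auto simp: is_wedge_family_def linear_maps_def)
    then have "F 0 = fmq x 0"
    proof (rule PiE_ext)
      fix u assume "u \<in> carrier (ext_power A 0)"
      then obtain p where p: "p \<in> homog 0" "u = ext_class A 0 p"
        by (auto simp: L.carrier_ext_power)
      \<comment> \<open>The only word of length 0 is the empty one, so p is a
        \<open>single []\<close> and the clause of \<open>is_wedge_family\<close> for degree 0
        decides the value.\<close>
      have "Poly_Mapping.lookup p k = Poly_Mapping.lookup (Poly_Mapping.single [] (Poly_Mapping.lookup p [])) k" for k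
      proof (cases "k = []")
        case False
        then have "k \<notin> Poly_Mapping.keys p" using p(1) by (auto simp: homog_def)
        then show ?thesis using False by (simp add: in_keys_iff lookup_single)
      qed simp
      then have "p = Poly_Mapping.single [] (Poly_Mapping.lookup p [])"
        by (rule poly_mapping_eqI)
      then obtain r where "p = Poly_Mapping.single [] r" by blast
      with F is_wedge_family_fmq[of x] p(2) show "F 0 u = fmq x 0 u"
        by (simp add: is_wedge_family_def)
    qed
    then show ?thesis using True by simp
  next
    case False
    show ?thesis
    proof (rule L.linear_maps_eqI_wedge[OF _ fmq_linear False])
      show "F n \<in> linear_maps (ext_power A n) (ext_power A' n)"
        using F by (simp add: is_wedge_family_def)
      fix Zs :: "'l list" assume "length Zs = n"
      then have "Zs \<noteq> []" "n = length Zs" using False by auto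
      then show "F n (wedge A Zs) = fmq x n (wedge A Zs)"
        using F is_wedge_family_fmq[of x] by (simp add: is_wedge_family_def)
    qed
  qed
qed

lemma chain_map_fmq: "chain_map (ext_power A) L.bdq (ext_power A') L'.bdq (fmq x)"
  unfolding chain_map_def
proof (intro conjI allI ballI L.chain_complex_ext L'.chain_complex_ext fmq_linear)
  fix n u assume "u \<in> carrier (ext_power A n)"
  then obtain p where p: "p \<in> homog n" "u = ext_class A n p"
    by (auto simp: L.carrier_ext_power)
  have "fmq x (n - 1) (L.bdq n u) = ext_class A' (n - 1) (fm x (L.bd p))"
    using L.bd_homog[OF p(1)] by (simp add: p L.bdq_class fmq_class)
  also have "\<dots> = ext_class A' (n - 1) (L'.bd (fm x p))"
    by (intro L'.ext_class_eqI fm_bd fm_homog L.bd_homog L'.bd_homog p(1))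
  also have "\<dots> = L'.bdq n (fmq x n u)"
    using p(1) by (simp add: p(2) fmq_class L'.bdq_class fm_homog)
  finally show "fmq x (n - 1) (L.bdq n u) = L'.bdq n (fmq x n u)" .
qed

end

theorem proposition7p2:
  fixes C :: "('k::field_char_0, 'c::ab_group_add) coalg"
    and A :: "('k, 'r::{comm_ring,comm_monoid_mult}, 'l::ab_group_add) lie_rinehart"
    and A' :: "('k, 's::{comm_ring,comm_monoid_mult}, 'm::ab_group_add) lie_rinehart"
    and \<Psi> :: "'c \<Rightarrow> 'l \<Rightarrow> 'm" and \<psi> :: "'c \<Rightarrow> 'r \<Rightarrow> 's"
  assumes "cocommutative_coalgebra C"
    and "projective_flat_lie_rinehart A"
    and "projective_flat_lie_rinehart A'"
    and "lr_measuring C A A' \<Psi> \<psi>"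
  shows "(\<exists>!d. is_lr_differential A d) \<and> (\<exists>!d'. is_lr_differential A' d') \<and>
    (\<forall>x.
      (\<exists>!F. is_wedge_family C A A' \<Psi> \<psi> x F) \<and>
      (\<forall>F. is_wedge_family C A A' \<Psi> \<psi> x F \<longrightarrow>
        chain_map (ext_power A) (lr_differential A) (ext_power A') (lr_differential A') F \<and>
        (\<forall>n. \<exists>!h.
          h \<in> linear_maps (homology (ext_power A) (lr_differential A) n)
                (homology (ext_power A') (lr_differential A') n) \<and>
          (\<forall>z\<in>cycles (ext_power A) (lr_differential A) n.
             h (homology_class (ext_power A) (lr_differential A) n z) =
               homology_class (ext_power A') (lr_differential A') n (F n z)))))"
proof -
  interpret L: flat_lie_rinehart A
    using assms(2) by (simp add: flat_lie_rinehart_def projective_flat_lie_rinehart_def)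
  interpret L': flat_lie_rinehart A'
    using assms(3) by (simp add: flat_lie_rinehart_def projective_flat_lie_rinehart_def)
  interpret lie_rinehart_measuring A A' C \<Psi> \<psi>
    using assms(1,4) by unfold_locales
  show ?thesis
  proof (intro conjI allI impI)
    fix x
    show "\<exists>!F. is_wedge_family C A A' \<Psi> \<psi> x F"
      using is_wedge_family_fmq is_wedge_family_unique by blast
    fix F assume "is_wedge_family C A A' \<Psi> \<psi> x F"
    \<comment> \<open>Uniqueness reduces the claims about an arbitrary family to the one constructed
      from words.\<close>
    then have F: "F = fmq x" by (rule is_wedge_family_unique)
    show cm: "chain_map (ext_power A) (lr_differential A) (ext_power A') (lr_differential A') F"
      unfolding F L.lr_differential_eq L'.lr_differential_eq by (rule chain_map_fmq)
    fix n
    show "\<exists>!h. h \<in> linear_maps (homology (ext_power A) (lr_differential A) n)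
        (homology (ext_power A') (lr_differential A') n) \<and>
      (\<forall>z\<in>cycles (ext_power A) (lr_differential A) n.
         h (homology_class (ext_power A) (lr_differential A) n z) =
           homology_class (ext_power A') (lr_differential A') n (F n z))"
      by (rule homology_map_ex1[OF cm])
  qed (rule L.ex1_lr_differential L'.ex1_lr_differential)+
qed

end
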